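(* Fix $\alpha\in(0,1)$ and $\tau\in\{\alpha/2,1-\alpha/2\}$, and assume (Boundedness), (Density) and (Smoothness), all stated in the context. Let $\widetilde f_{n,\tau}$ be a measurable empirical pinball risk minimizer over the sparse-ReLU class $\mathcal F_n^{\rm SH}$. There are constants $C_{\rm rate},C_{\rm conf}>0$, depending only on $(\alpha,\mu_{\rm low},\mu_{\rm up},\beta,d,M,L_\beta)$, such that, for every $\delta\in(0,1)$ and every integer $n\ge n_{\rm SH}$, with probability at least $1-\delta$ over $\mathcal D^{\rm tr}_n$, $$\|\widetilde f_{n,\tau}-f^\star_\tau\|_{L^2(P_X)}\le C_{\rm rate}\,n^{-\beta/(2\beta+d)}(\log n)^{3/2}+C_{\rm conf}\sqrt{\frac{\log(1/\delta)}{n}} .$$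
   Context: Data: $P_X$ is a probability measure on $\mathcal X$, $P_{Y\mid X}$ a conditional kernel, $P_{XY}=P_X\otimes P_{Y\mid X}$, $\mathcal D^{\rm tr}_n=\{(X_i,Y_i)\}_{i=1}^n\sim P_{XY}^{\otimes n}$. $f^\star_\tau(x)=\inf\{t:P_{Y\mid X=x}((-\infty,t])\ge\tau\}$. (Boundedness) $\mathcal X=[0,1]^d$ and $Y$ takes values in $\mathcal Y=[-M,M]$, $M>0$. (Density) For every $x\in\mathcal X$, $P_{Y\mid X=x}$ has support $\mathcal Y$ and a Lebesgue density with $0<\mu_{\rm low}\le p_{Y\mid X}(y\mid x)\le\mu_{\rm up}<\infty$ for every $y\in\mathcal Y$. (Smoothness) For each $\tau\in\{\alpha/2,1-\alpha/2\}$, $f^\star_\tau\in\mathcal H^\beta(\mathcal X,L_\beta)$ for some $\beta>0$, where with $k_\beta=\lceil\beta\rceil-1$, $$\mathcal H^\beta(\Omega,H)=\Bigl\{f:\Omega\to\mathbb R:\sum_{|\gamma|\le k_\beta}\|\partial^\gamma f\|_\infty+\sum_{|\gamma|=k_\beta}\sup_{x\ne y\in\Omega}\frac{|\partial^\gamma f(x)-\partial^\gamma f(y)|}{\|x-y\|_\infty^{\beta-k_\beta}}\le H\Bigr\}.$$ Pinball loss $\rho_\tau(u)=u(\tau-\mathbf 1\{u<0\})$; empirical risk $R_{n,\tau}(f)=\frac1n\sum_{i=1}^n\rho_\tau(Y_i-f(X_i))$. Sparse-ReLU class. $\sigma(t)=\max(t,0)$, $\sigma_{\mathbf v}(\mathbf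 y)=(\sigma(y_1-v_1),\dots,\sigma(y_r-v_r))^\top$. For depth $L$ and widths $\mathbf p=(p_0,\dots,p_{L+1})$, $p_0=d$, $p_{L+1}=1$, a network is $f_\theta(x)=W_Lh_L(x)$, where $h_0(x)=x$, $h_\ell(x)=\sigma_{\mathbf v_\ell}(W_{\ell-1}h_{\ell-1}(x))$, $1\le\ell\le L$, $W_\ell\in\mathbb R^{p_{\ell+1}\times p_\ell}$, $\mathbf v_\ell\in\mathbb R^{p_\ell}$, $\mathbf v_0=0$. Let $T_M(x)=\min\{\max(x,-M),M\}$. $\mathcal F(L,\mathbf p,s,M)$ is the set of $T_M\circ f_\theta$ with all entries of all $W_j,\mathbf v_j$ in $[-1,1]$ and total number of nonzero entries of all $W_j,\mathbf v_j$ ($0\le j\le L$) at most $s$. $\mathcal F_n^{\rm SH}=\mathcal F(L_{\rm SH}(n),\mathbf p_{\rm SH}(n),S_{\rm SH}(n),M)$ with $N_n=\lceil n^{d/(2\beta+d)}\rceil$; $L_{\rm SH}(n)=8+(\lceil\log_2n\rceil+5)(1+\lceil\log_2(d\vee\beta)\rceil)$; $\mathbf p_{\rm SH}(n)=(d,W_{\rm SH}(n),\dots,W_{\rm SH}(n),1)$ with $L_{\rm SH}(n)$ hidden entries $W_{\rm SH}(n)=6(d+\lceil\beta\rceil)N_n$; $S_{\rm SH}(n)=\lceil141(d+\beta+1)^{3+d}N_n(\lceil\log_2n\rceil+6)\rceil$. Training threshold: $n_{\rm SH}=\bigl\lceil(\beta+1)^{2\beta+d}\vee(L_\beta+1)^{(2\beta+d)/d}e^{2\beta+d}\vee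 e^{3(2\beta+d)/(2\beta)}\bigr\rceil$. *)

theory Defs
  imports "HOL-Probability.Probability"
begin

text \<open>
  Points of \<open>\<real>\<^sup>d\<close> are functions on \<open>nat\<close> of which only the coordinates \<open>i < d\<close> matter; points of
  the cube \<open>[0,1]\<^sup>d\<close> are moreover \<open>undefined\<close> outside \<open>{..<d}\<close>, so that the cube is the carrier
  of a product measurable space.
\<close>

definition cube :: "nat \<Rightarrow> (nat \<Rightarrow> real) set" where
  "cube d = {..<d} \<rightarrow>\<^sub>E {0..1}"

definition cube_space :: "nat \<Rightarrow> (nat \<Rightarrow> real) measure" where
  "cube_space d = PiM {..<d} (\<lambda>_. restrict_space borel {0..1})"

definition dist_sup :: "nat \<Rightarrow> (nat \<Rightarrow> real) \<Rightarrow> (nat \<Rightarrow> real) \<Rightarrow> real" where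
  "dist_sup d x y = (MAX i\<in>{..<d}. \<bar>x i - y i\<bar>)"

subsection \<open>Hoelder balls\<close>

definition multi_indices :: "nat \<Rightarrow> (nat \<Rightarrow> nat) set" where
  "multi_indices d = {\<gamma>. \<forall>i\<ge>d. \<gamma> i = 0}"

definition order_of :: "nat \<Rightarrow> (nat \<Rightarrow> nat) \<Rightarrow> nat" where
  "order_of d \<gamma> = (\<Sum>i<d. \<gamma> i)"

text \<open>
  \<open>Df \<gamma>\<close> is the partial derivative of \<open>f\<close> of multi-index \<open>\<gamma>\<close>, for all orders up to \<open>k\<close>.
  Derivatives are taken within the closed cube, i.e. they are one-sided at its faces; on the cube
  the functions \<open>Df \<gamma>\<close> with \<open>\<gamma>\<close> of order at most \<open>k\<close> are uniquely determined by \<open>f\<close>.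
\<close>

definition partial_derivs ::
  "nat \<Rightarrow> nat \<Rightarrow> ((nat \<Rightarrow> real) \<Rightarrow> real) \<Rightarrow> ((nat \<Rightarrow> nat) \<Rightarrow> (nat \<Rightarrow> real) \<Rightarrow> real) \<Rightarrow> bool" where
  "partial_derivs d k f Df \<longleftrightarrow>
     (\<forall>x\<in>cube d. Df (\<lambda>_. 0) x = f x) \<and>
     (\<forall>\<gamma>\<in>multi_indices d. order_of d \<gamma> < k \<longrightarrow> (\<forall>i<d. \<forall>x\<in>cube d.
        ((\<lambda>t. Df \<gamma> (x(i := t))) has_real_derivative Df (\<gamma>(i := Suc (\<gamma> i))) x)
          (at (x i) within {0..1})))"

text \<open>
  The suprema are taken in \<open>ereal\<close>, so that unbounded derivatives or difference quotients
  are excluded from the ball.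
\<close>

definition holder_ball :: "nat \<Rightarrow> real \<Rightarrow> real \<Rightarrow> ((nat \<Rightarrow> real) \<Rightarrow> real) set" where
  "holder_ball d \<beta> H =
     (let k = nat (\<lceil>\<beta>\<rceil> - 1) in
      {f. \<exists>Df. partial_derivs d k f Df \<and>
        (\<Sum>\<gamma> | \<gamma> \<in> multi_indices d \<and> order_of d \<gamma> \<le> k.
           SUP x\<in>cube d. ereal \<bar>Df \<gamma> x\<bar>) +
        (\<Sum>\<gamma> | \<gamma> \<in> multi_indices d \<and> order_of d \<gamma> = k.
           SUP (x, y)\<in>{(x, y). x \<in> cube d \<and> y \<in> cube d \<and> x \<noteq> y}.
             ereal (\<bar>Df \<gamma> x - Df \<gamma> y\<bar> / dist_sup d x y powr (\<beta> - real k)))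
        \<le> ereal H})"

subsection \<open>Data distribution and conditional quantiles\<close>

definition joint_distr ::
  "nat \<Rightarrow> (nat \<Rightarrow> real) measure \<Rightarrow> ((nat \<Rightarrow> real) \<Rightarrow> real measure) \<Rightarrow> ((nat \<Rightarrow> real) \<times> real) measure"
where
  "joint_distr d PX K =
     PX \<bind> (\<lambda>x. distr (K x) (cube_space d \<Otimes>\<^sub>M borel) (\<lambda>y. (x, y)))"

definition sample_distr ::
  "nat \<Rightarrow> (nat \<Rightarrow> real) measure \<Rightarrow> ((nat \<Rightarrow> real) \<Rightarrow> real measure) \<Rightarrow> nat \<Rightarrow>
    (nat \<Rightarrow> (nat \<Rightarrow> real) \<times> real) measure" where
  "sample_distr d PX K n = PiM {..<n} (\<lambda>_. joint_distr d PX K)"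

definition cond_quantile ::
  "((nat \<Rightarrow> real) \<Rightarrow> real measure) \<Rightarrow> real \<Rightarrow> (nat \<Rightarrow> real) \<Rightarrow> real" where
  "cond_quantile K \<tau> x = Inf {t. measure (K x) {..t} \<ge> \<tau>}"

definition bounded_model :: "nat \<Rightarrow> real \<Rightarrow> ((nat \<Rightarrow> real) \<Rightarrow> real measure) \<Rightarrow> bool" where
  "bounded_model d M K \<longleftrightarrow> M > 0 \<and> (\<forall>x\<in>cube d. measure (K x) {-M..M} = 1)"

definition measure_support :: "real measure \<Rightarrow> real set" where
  "measure_support \<mu> = {y. \<forall>U. open U \<longrightarrow> y \<in> U \<longrightarrow> emeasure \<mu> U > 0}"

definition density_bounds ::
  "nat \<Rightarrow> real \<Rightarrow> real \<Rightarrow> real \<Rightarrow> ((nat \<Rightarrow> real) \<Rightarrow> real measure) \<Rightarrow> bool" where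
  "density_bounds d M \<mu>low \<mu>up K \<longleftrightarrow> 0 < \<mu>low \<and>
     (\<forall>x\<in>cube d. measure_support (K x) = {-M..M} \<and>
        (\<exists>p \<in> borel_measurable borel.
           (\<forall>y. 0 \<le> p y) \<and> K x = density lborel (\<lambda>y. ennreal (p y)) \<and>
           (\<forall>y\<in>{-M..M}. \<mu>low \<le> p y \<and> p y \<le> \<mu>up)))"

definition smooth_quantiles ::
  "nat \<Rightarrow> real \<Rightarrow> real \<Rightarrow> real \<Rightarrow> ((nat \<Rightarrow> real) \<Rightarrow> real measure) \<Rightarrow> bool" where
  "smooth_quantiles d \<alpha> \<beta> L K \<longleftrightarrow> \<beta> > 0 \<and>
     (\<forall>\<tau>\<in>{\<alpha> / 2, 1 - \<alpha> / 2}. cond_quantile K \<tau> \<in> holder_ball d \<beta> L)"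

definition L2_norm :: "'a measure \<Rightarrow> ('a \<Rightarrow> real) \<Rightarrow> real" where
  "L2_norm \<mu> f = sqrt (LINT x|\<mu>. (f x)\<^sup>2)"

subsection \<open>Sparse ReLU networks\<close>

definition relu :: "real \<Rightarrow> real" where
  "relu t = max t 0"

definition truncate :: "real \<Rightarrow> real \<Rightarrow> real" where
  "truncate M t = min (max t (-M)) M"

text \<open>
  \<open>p l\<close> is the width of layer \<open>l\<close>; \<open>W l i j\<close> with \<open>i < p (Suc l)\<close>, \<open>j < p l\<close> are the entries
  of the weight matrix from layer \<open>l\<close> to layer \<open>Suc l\<close>, and \<open>v l i\<close> with \<open>i < p l\<close> those of the
  shift vector of layer \<open>l\<close>. Entries outside these ranges are never used.
\<close>

fun hidden :: "(nat \<Rightarrow> nat) \<Rightarrow> (nat \<Rightarrow> nat \<Rightarrow> nat \<Rightarrow> real) \<Rightarrow> (nat \<Rightarrow> nat \<Rightarrow> real) \<Rightarrow>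
    nat \<Rightarrow> (nat \<Rightarrow> real) \<Rightarrow> nat \<Rightarrow> real" where
  "hidden p W v 0 x = x"
| "hidden p W v (Suc l) x =
     (\<lambda>i. relu ((\<Sum>j<p l. W l i j * hidden p W v l x j) - v (Suc l) i))"

definition network :: "nat \<Rightarrow> (nat \<Rightarrow> nat) \<Rightarrow> (nat \<Rightarrow> nat \<Rightarrow> nat \<Rightarrow> real) \<Rightarrow>
    (nat \<Rightarrow> nat \<Rightarrow> real) \<Rightarrow> (nat \<Rightarrow> real) \<Rightarrow> real" where
  "network L p W v x = (\<Sum>j<p L. W L 0 j * hidden p W v L x j)"

definition sparse_relu :: "nat \<Rightarrow> (nat \<Rightarrow> nat) \<Rightarrow> nat \<Rightarrow> real \<Rightarrow> ((nat \<Rightarrow> real) \<Rightarrow> real) set" where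
  "sparse_relu L p s M =
     {\<lambda>x. truncate M (network L p W v x) | W v.
        (\<forall>i<p 0. v 0 i = 0) \<and>
        (\<forall>l\<le>L. \<forall>i<p (Suc l). \<forall>j<p l. W l i j \<in> {-1..1}) \<and>
        (\<forall>l\<le>L. \<forall>i<p l. v l i \<in> {-1..1}) \<and>
        card {(l, i, j). l \<le> L \<and> i < p (Suc l) \<and> j < p l \<and> W l i j \<noteq> 0} +
        card {(l, i). l \<le> L \<and> i < p l \<and> v l i \<noteq> 0} \<le> s}"

definition N_SH :: "nat \<Rightarrow> real \<Rightarrow> nat \<Rightarrow> nat" where
  "N_SH d \<beta> n = nat \<lceil>real n powr (real d / (2 * \<beta> + real d))\<rceil>"

definition L_SH :: "nat \<Rightarrow> real \<Rightarrow> nat \<Rightarrow> nat" where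
  "L_SH d \<beta> n = nat (8 + (\<lceil>log 2 (real n)\<rceil> + 5) * (1 + \<lceil>log 2 (max (real d) \<beta>)\<rceil>))"

definition W_SH :: "nat \<Rightarrow> real \<Rightarrow> nat \<Rightarrow> nat" where
  "W_SH d \<beta> n = 6 * (d + nat \<lceil>\<beta>\<rceil>) * N_SH d \<beta> n"

definition p_SH :: "nat \<Rightarrow> real \<Rightarrow> nat \<Rightarrow> nat \<Rightarrow> nat" where
  "p_SH d \<beta> n l = (if l = 0 then d else if l \<le> L_SH d \<beta> n then W_SH d \<beta> n else 1)"

definition S_SH :: "nat \<Rightarrow> real \<Rightarrow> nat \<Rightarrow> nat" where
  "S_SH d \<beta> n =
     nat \<lceil>141 * (real d + \<beta> + 1) ^ (3 + d) * real (N_SH d \<beta> n) * (of_int \<lceil>log 2 (real n)\<rceil> + 6)\<rceil>"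

definition F_SH :: "nat \<Rightarrow> real \<Rightarrow> real \<Rightarrow> nat \<Rightarrow> ((nat \<Rightarrow> real) \<Rightarrow> real) set" where
  "F_SH d \<beta> M n = sparse_relu (L_SH d \<beta> n) (p_SH d \<beta> n) (S_SH d \<beta> n) M"

definition n_SH :: "nat \<Rightarrow> real \<Rightarrow> real \<Rightarrow> nat" where
  "n_SH d \<beta> L = nat \<lceil>max ((\<beta> + 1) powr (2 * \<beta> + real d))
     (max ((L + 1) powr ((2 * \<beta> + real d) / real d) * exp (2 * \<beta> + real d))
          (exp (3 * (2 * \<beta> + real d) / (2 * \<beta>))))\<rceil>"

subsection \<open>Empirical pinball risk minimisation\<close>

definition pinball :: "real \<Rightarrow> real \<Rightarrow> real" where
  "pinball \<tau> u = u * (\<tau> - (if u < 0 then 1 else 0))"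

definition emp_risk ::
  "nat \<Rightarrow> real \<Rightarrow> (nat \<Rightarrow> (nat \<Rightarrow> real) \<times> real) \<Rightarrow> ((nat \<Rightarrow> real) \<Rightarrow> real) \<Rightarrow> real" where
  "emp_risk n \<tau> D f = 1 / real n * (\<Sum>i<n. pinball \<tau> (snd (D i) - f (fst (D i))))"

text \<open>
  The estimator maps a data set to a function; measurability is joint in the data and the
  covariate. The minimisation property is only required for data sets with labels in \<open>[-M,M]\<close>,
  which have full measure.
\<close>

definition measurable_erm ::
  "nat \<Rightarrow> real \<Rightarrow> real \<Rightarrow> nat \<Rightarrow> ((nat \<Rightarrow> real) \<Rightarrow> real) set \<Rightarrow>
    ((nat \<Rightarrow> (nat \<Rightarrow> real) \<times> real) \<Rightarrow> (nat \<Rightarrow> real) \<Rightarrow> real) \<Rightarrow> bool" where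
  "measurable_erm d M \<tau> n F fhat \<longleftrightarrow>
     (\<lambda>(D, x). fhat D x) \<in>
       borel_measurable (PiM {..<n} (\<lambda>_. cube_space d \<Otimes>\<^sub>M borel) \<Otimes>\<^sub>M cube_space d) \<and>
     (\<forall>D \<in> {..<n} \<rightarrow>\<^sub>E cube d \<times> {-M..M}.
        fhat D \<in> F \<and> (\<forall>f\<in>F. emp_risk n \<tau> D (fhat D) \<le> emp_risk n \<tau> D f))"

end

theory Submission
  imports Defs
begin

text \<open>
  Since the conditional density lies between \<open>\<mu>low\<close> and \<open>\<mu>up\<close>, the excess pinball risk of \<open>g\<close> is
  comparable to the squared \<open>L\<^sup>2\<close> distance of \<open>g\<close> from the conditional quantile, and so is an upper
  bound for the second moment of the excess loss. A Bernstein bound over a finite sup-norm net of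
  the network class (parameters rounded to a fine grid) therefore bounds the squared error of the
  empirical risk minimiser by the squared \<open>L\<^sup>2\<close> approximation error of the class plus its metric
  entropy divided by \<open>n\<close>; the entropy is of order \<open>N (ln n)\<^sup>3\<close>.

  Approximation is only needed in \<open>L\<^sup>2\<close> of the given covariate distribution. The cube is cut into
  about \<open>N\<close> cells, and steep ramps compute the Taylor coefficients of the cell of \<open>x\<close> and the
  position of \<open>x\<close> in it, exactly unless \<open>x\<close> lies in thin strips along the cell boundaries. Among
  polynomially many shifts of the grid, whose strips are disjoint, one has strips of small
  probability. The Taylor polynomial is then evaluated by \<open>O(1)\<close> many approximate multiplications,
  each made of two sawtooth approximations of \<open>t (1 - t)\<close> of logarithmic depth.
\<close>


subsection \<open>Bernstein's inequality and the pinball loss\<close>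

text \<open>Two constraints shape the construction: every parameter lies in [-1,1], and depth, width
  and sparsity are prescribed. Large slopes and output coefficients are therefore made by summing
  identical copies, and the squaring recursion is rescaled by powers of 4. Sparsity is accounted for
  layer by layer: each layer has a budget of \<open>N_SH\<close> nonzero parameters, which bounds
  the number of its active neurons as well, and L + 1 such budgets stay below \<open>S_SH\<close>. A
  ReLU network is continuous and cannot switch between cells exactly; this is why the error near
  cell boundaries is controlled in probability. With e = 2 \<beta> + d the choices are about c
  n^(1/e) cells per axis, n^(2 \<beta> / e) shifts of the grid and squaring depth about (log2 n) /
  4, where the constant c absorbs all costs that do not grow with n. The exponent 3/2 of the
  logarithm is half of 3: the sparsity contributes one factor ln n, and the logarithm of the number
  of choices per parameter contributes depth times log width, which is two more.\<close>

lemma pinball_lipschitz: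
  assumes "0 < \<tau>" "\<tau> < 1"
  shows "\<bar>pinball \<tau> u - pinball \<tau> v\<bar> \<le> \<bar>u - v\<bar>"
proof -
  have e: "pinball \<tau> w = max (\<tau> * w) ((\<tau> - 1) * w)" for w
    using assms by (auto simp: pinball_def max_def algebra_simps)
  have "\<bar>\<tau> * u - \<tau> * v\<bar> \<le> \<bar>u - v\<bar>" "\<bar>(\<tau> - 1) * u - (\<tau> - 1) * v\<bar> \<le> \<bar>u - v\<bar>"
    using assms by (simp_all add: right_diff_distrib[symmetric] abs_mult mult_left_le_one_le)
  then show ?thesis unfolding e by (auto simp: max_def)
qed

lemma exp_le_quadratic:
  fixes x :: real
  assumes "x \<le> 1"
  shows "exp x \<le> 1 + x + x\<^sup>2"
proof (cases "0 \<le> x")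
  case True
  then show ?thesis using assms exp_bound by blast
next
  case False
  define y where "y = - x"
  have y: "y > 0" using False y_def by simp
  \<comment> \<open>The product is 1 + y^3, so 1 - y + y^2 dominates 1 / (1 + y) and hence exp
    (-y).\<close>
  have "1 \<le> (1 + y) * (1 - y + y\<^sup>2)"
    using y by (simp add: algebra_simps power2_eq_square)
  also have "\<dots> \<le> exp y * (1 - y + y\<^sup>2)"
  proof (rule mult_right_mono)
    have "1 - y + y\<^sup>2 = (y - 1/2)\<^sup>2 + 3/4" by (simp add: power2_eq_square algebra_simps)
    then show "0 \<le> 1 - y + y\<^sup>2" by (simp add: add_nonneg_nonneg)
  qed simp
  finally have "exp (-y) \<le> 1 - y + y\<^sup>2"
    by (simp add: exp_minus divide_simps mult.commute)
  then show ?thesis by (simp add: y_def)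
qed

text \<open>Chernoff bound for \<open>- lam * Z\<close>, whose exponential moment is controlled by
  \<open>exp_le_quadratic\<close> because \<open>lam * B \<le> 1\<close>. The second moment is left
  uncentred since that is what the squared distance to the quantile bounds; \<open>lam\<close> is
  not optimised but kept fixed, so that \<open>lam * V\<close> can later be absorbed into the
  mean.\<close>

lemma bernstein_lower_tail:
  fixes Z :: "'a \<Rightarrow> real"
  assumes P: "prob_space P" and Z[measurable]: "Z \<in> borel_measurable P"
    and B: "\<And>x. x \<in> space P \<Longrightarrow> \<bar>Z x\<bar> \<le> B"
    and lam: "0 < lam" "lam * B \<le> 1"
  defines "E \<equiv> integral\<^sup>L P Z" and "V \<equiv> integral\<^sup>L P (\<lambda>x. (Z x)\<^sup>2)"
  shows "measure (PiM {..<n} (\<lambda>_. P))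
      {D \<in> space (PiM {..<n} (\<lambda>_. P)). (\<Sum>i<n. Z (D i)) \<le> real n * (E - lam * V) - t / lam}
    \<le> exp (- t)"
proof -
  interpret P: prob_space P by (rule P)
  interpret PP: product_prob_space "\<lambda>_::nat. P" "{..<n}" by unfold_locales
  let ?Q = "PiM {..<n} (\<lambda>_. P)"
  interpret Q: prob_space ?Q by (rule prob_space_PiM) (rule P)
  have B0: "0 \<le> B" using P.not_empty B by force
  have iZ: "integrable P Z"
    by (rule P.integrable_const_bound[of _ B]) (use B in auto)
  have iZ2: "integrable P (\<lambda>x. (Z x)\<^sup>2)"
  proof (rule P.integrable_const_bound[of _ "B\<^sup>2"])
    show "AE x in P. norm ((Z x)\<^sup>2) \<le> B\<^sup>2"
      using B B0 by (intro AE_I2) (simp add: abs_le_square_iff[symmetric])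
  qed simp
  have le: "- (lam * Z x) \<le> 1" if "x \<in> space P" for x
  proof -
    have "- (lam * Z x) \<le> lam * B"
      using B[OF that] lam(1) by (smt (verit) mult_left_mono mult_minus_right)
    then show ?thesis using lam(2) by linarith
  qed
  have iexp: "integrable P (\<lambda>x. exp (- (lam * Z x)))"
    by (rule P.integrable_const_bound[of _ "exp 1"]) (use le in auto)
  have "(\<integral>x. exp (- (lam * Z x)) \<partial>P) \<le> (\<integral>x. 1 + - (lam * Z x) + lam\<^sup>2 * (Z x)\<^sup>2 \<partial>P)"
  proof (rule integral_mono)
    fix x assume "x \<in> space P"
    from exp_le_quadratic[OF le[OF this]]
    show "exp (- (lam * Z x)) \<le> 1 + - (lam * Z x) + lam\<^sup>2 * (Z x)\<^sup>2"
      by (simp add: power_mult_distrib)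
  qed (use iZ iZ2 iexp in auto)
  also have "\<dots> = 1 + (- (lam * E) + lam\<^sup>2 * V)"
    using iZ iZ2 by (simp add: E_def V_def P.prob_space)
  also have "\<dots> \<le> exp (- (lam * E) + lam\<^sup>2 * V)" by (rule exp_ge_add_one_self)
  finally have mgf: "(\<integral>x. exp (- (lam * Z x)) \<partial>P) \<le> exp (- (lam * E) + lam\<^sup>2 * V)" .
  let ?u = "\<lambda>D. \<Prod>i<n. exp (- (lam * Z (D i)))"
  have iu: "integrable ?Q ?u"
    by (rule PP.product_integrable_prod) (use iexp in auto)
  have "(\<integral>D. ?u D \<partial>?Q) = (\<Prod>i<n. (\<integral>x. exp (- (lam * Z x)) \<partial>P))"
    by (rule PP.product_integral_prod) (use iexp in auto)
  also have "\<dots> \<le> (\<Prod>i<n. exp (- (lam * E) + lam\<^sup>2 * V))"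
    by (rule prod_mono) (use mgf in auto)
  also have "\<dots> = exp (real n * (- (lam * E) + lam\<^sup>2 * V))"
    by (simp add: exp_of_nat_mult)
  finally have iule: "(\<integral>D. ?u D \<partial>?Q) \<le> exp (real n * (- (lam * E) + lam\<^sup>2 * V))" .
  define c where "c = exp (real n * (- (lam * E) + lam\<^sup>2 * V) + t)"
  have eq: "{D \<in> space ?Q. (\<Sum>i<n. Z (D i)) \<le> real n * (E - lam * V) - t / lam} = {D \<in> space ?Q. ?u D \<ge> c}"
  proof (intro Collect_cong conj_cong refl)
    fix D
    have u: "?u D = exp (- lam * (\<Sum>i<n. Z (D i)))"
      by (simp add: exp_sum[symmetric] sum_negf sum_distrib_left)
    have "(\<Sum>i<n. Z (D i)) \<le> real n * (E - lam * V) - t / lam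
      \<longleftrightarrow> lam * (\<Sum>i<n. Z (D i)) \<le> lam * (real n * (E - lam * V) - t / lam)"
      using lam by simp
    also have "lam * (real n * (E - lam * V) - t / lam) = - (real n * (- (lam * E) + lam\<^sup>2 * V) + t)"
      using lam by (simp add: algebra_simps power2_eq_square)
    finally show "((\<Sum>i<n. Z (D i)) \<le> real n * (E - lam * V) - t / lam) = (c \<le> ?u D)"
      unfolding u c_def by (auto simp del: of_nat_mult)
  qed
  have "measure ?Q {D \<in> space ?Q. ?u D \<ge> c} \<le> (\<integral>D. ?u D \<partial>?Q) / c"
    by (rule integral_Markov_inequality_measure[OF iu, where A="{}"])
       (auto simp: c_def intro!: prod_nonneg)
  also have "\<dots> \<le> exp (real n * (- (lam * E) + lam\<^sup>2 * V)) / c"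
    using iule by (simp add: c_def divide_right_mono)
  also have "\<dots> = exp (- t)" by (simp add: c_def exp_diff[symmetric])
  finally show ?thesis unfolding eq .
qed

text \<open>Knight's identity. Integrated against a law with mass \<open>\<tau>\<close> on
  \<open>{..q}\<close>, the first term vanishes and only the nonnegative second one remains.\<close>

lemma pinball_diff:
  "pinball \<tau> (y - a) - pinball \<tau> (y - q)
     = (a - q) * (indicator {..q} y - \<tau>) + \<bar>a - y\<bar> * indicator {min a q<..max a q} y"
  by (auto simp: pinball_def indicator_def min_def max_def algebra_simps)

lemma pinball_measurable[measurable]: "pinball \<tau> \<in> borel_measurable borel"
  unfolding pinball_def by measurable

lemma integral_abs_diff:
  fixes l u :: real
  assumes "l \<le> u"
  shows "((\<lambda>y. u - y) has_integral (u - l)\<^sup>2 / 2) {l..u}"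
    and "((\<lambda>y. y - l) has_integral (u - l)\<^sup>2 / 2) {l..u}"
proof -
  have "((\<lambda>y. u - y) has_integral (- (u - u)\<^sup>2 / 2 - (- (u - l)\<^sup>2 / 2))) {l..u}"
    by (rule fundamental_theorem_of_calculus[OF assms])
       (auto intro!: derivative_eq_intros simp: has_real_derivative_iff_has_vector_derivative[symmetric] field_simps)
  then show "((\<lambda>y. u - y) has_integral (u - l)\<^sup>2 / 2) {l..u}" by simp
  have "((\<lambda>y. y - l) has_integral ((u - l)\<^sup>2 / 2 - (l - l)\<^sup>2 / 2)) {l..u}"
    by (rule fundamental_theorem_of_calculus[OF assms])
       (auto intro!: derivative_eq_intros simp: has_real_derivative_iff_has_vector_derivative[symmetric] field_simps)
  then show "((\<lambda>y. y - l) has_integral (u - l)\<^sup>2 / 2) {l..u}" by simp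
qed

lemma lborel_abs_diff:
  fixes a q :: real
  shows "integrable lborel (\<lambda>y. \<bar>a - y\<bar> * indicator {min a q<..max a q} y)"
    and "(\<integral>y. \<bar>a - y\<bar> * indicator {min a q<..max a q} y \<partial>lborel) = (a - q)\<^sup>2 / 2"
proof -
  have hi: "((\<lambda>y. \<bar>a - y\<bar>) has_integral (a - q)\<^sup>2 / 2) {min a q..max a q}"
  proof (cases "a \<le> q")
    case True
    have "((\<lambda>y. \<bar>a - y\<bar>) has_integral (q - a)\<^sup>2 / 2) {a..q}"
      by (rule has_integral_eq[OF _ integral_abs_diff(2)[OF True]]) auto
    then show ?thesis using True by (simp add: power2_commute)
  next
    case False
    have "((\<lambda>y. \<bar>a - y\<bar>) has_integral (a - q)\<^sup>2 / 2) {q..a}"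
      by (rule has_integral_eq[OF _ integral_abs_diff(1)]) (use False in auto)
    then show ?thesis using False by simp
  qed
  have "(\<lambda>y. \<bar>a - y\<bar>) absolutely_integrable_on {min a q..max a q}"
    by (rule nonnegative_absolutely_integrable_1) (use hi in \<open>auto simp: has_integral_integrable\<close>)
  then have si: "set_integrable lebesgue {min a q..max a q} (\<lambda>y. \<bar>a - y\<bar>)" .
  have "(LINT y:{min a q..max a q}|lebesgue. \<bar>a - y\<bar>) = (a - q)\<^sup>2 / 2"
    using set_lebesgue_integral_eq_integral(2)[OF si] integral_unique[OF hi] by simp
  then have i1: "(\<integral>y. indicator {min a q..max a q} y *\<^sub>R \<bar>a - y\<bar> \<partial>lborel) = (a - q)\<^sup>2 / 2"
    unfolding set_lebesgue_integral_def by (subst (asm) integral_completion) auto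
  have i2: "integrable lborel (\<lambda>y. indicator {min a q..max a q} y *\<^sub>R \<bar>a - y\<bar>)"
    using si unfolding set_integrable_def by (subst (asm) integrable_completion) auto
  have ae: "AE y in lborel. indicator {min a q..max a q} y *\<^sub>R \<bar>a - y\<bar> = \<bar>a - y\<bar> * indicator {min a q<..max a q} y"
    using AE_lborel_singleton[of "min a q"] by eventually_elim (auto simp: indicator_def)
  show "integrable lborel (\<lambda>y. \<bar>a - y\<bar> * indicator {min a q<..max a q} y)"
    using i2 by (subst (asm) integrable_cong_AE[OF _ _ ae]) auto
  show "(\<integral>y. \<bar>a - y\<bar> * indicator {min a q<..max a q} y \<partial>lborel) = (a - q)\<^sup>2 / 2"
    using i1 by (subst (asm) integral_cong_AE[OF _ _ ae]) auto
qed

text \<open>By Knight's identity the excess is the integral of |a - y| over the interval between q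
  and a, weighted by the density; unweighted, it is (a - q)^2 / 2. The interval lies in [-M,M]
  because its endpoints do, so the density bounds apply on all of it.\<close>

lemma pinball_excess_bounds:
  fixes \<kappa> :: "real measure"
  assumes \<kappa>: "prob_space \<kappa>" and p[measurable]: "p \<in> borel_measurable borel"
    and p0: "\<And>y. 0 \<le> p y" and dens: "\<kappa> = density lborel (\<lambda>y. ennreal (p y))"
    and bd: "\<And>y. y \<in> {-M..M} \<Longrightarrow> \<mu>low \<le> p y \<and> p y \<le> \<mu>up"
    and aq: "a \<in> {-M..M}" "q \<in> {-M..M}" and q: "measure \<kappa> {..q} = \<tau>"
  shows "\<mu>low / 2 * (a - q)\<^sup>2 \<le> (\<integral>y. pinball \<tau> (y - a) - pinball \<tau> (y - q) \<partial>\<kappa>)"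
    and "(\<integral>y. pinball \<tau> (y - a) - pinball \<tau> (y - q) \<partial>\<kappa>) \<le> \<mu>up / 2 * (a - q)\<^sup>2"
proof -
  interpret prob_space \<kappa> by (rule \<kappa>)
  let ?w = "\<lambda>y. \<bar>a - y\<bar> * indicator {min a q<..max a q} y :: real"
  have [measurable_cong]: "sets \<kappa> = sets borel" using dens by simp
  have w: "integrable \<kappa> ?w"
    by (rule integrable_const_bound[of _ "\<bar>a - q\<bar>"]) (auto simp: indicator_def)
  have "(\<integral>y. pinball \<tau> (y - a) - pinball \<tau> (y - q) \<partial>\<kappa>)
     = (\<integral>y. (a - q) * (indicator {..q} y - \<tau>) + ?w y \<partial>\<kappa>)"
    by (simp add: pinball_diff)
  also have "\<dots> = (a - q) * (measure \<kappa> {..q} - \<tau>) + (\<integral>y. ?w y \<partial>\<kappa>)"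
  proof -
    have i: "integrable \<kappa> (\<lambda>y. indicator {..q} y :: real)"
      by (rule integrable_const_bound[of _ 1]) auto
    then have "(\<integral>y. (indicator {..q} y - \<tau>) \<partial>\<kappa>) = measure \<kappa> {..q} - \<tau>"
      by (subst Bochner_Integration.integral_diff) (auto simp: prob_space)
    then have "(\<integral>y. (a - q) * (indicator {..q} y - \<tau>) \<partial>\<kappa>) = (a - q) * (measure \<kappa> {..q} - \<tau>)"
      by simp
    moreover have "integrable \<kappa> (\<lambda>y. (a - q) * (indicator {..q} y - \<tau>))" using i by auto
    ultimately show ?thesis using w by simp
  qed
  finally have eq: "(\<integral>y. pinball \<tau> (y - a) - pinball \<tau> (y - q) \<partial>\<kappa>) = (\<integral>y. ?w y \<partial>\<kappa>)"
    by (simp add: q)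
  have wd: "(\<integral>y. ?w y \<partial>\<kappa>) = (\<integral>y. p y * ?w y \<partial>lborel)"
    unfolding dens by (subst integral_density) (auto simp: p0)
  have pw: "integrable lborel (\<lambda>y. p y * ?w y)"
    using w unfolding dens by (subst (asm) integrable_density) (auto simp: p0)
  have in_: "y \<in> {-M..M}" if "indicator {min a q<..max a q} y \<noteq> (0::real)" for y
    using aq that by (auto simp: indicator_def split: if_splits)
  have "(\<integral>y. \<mu>low * ?w y \<partial>lborel) \<le> (\<integral>y. p y * ?w y \<partial>lborel)"
  proof (rule integral_mono)
    fix y show "\<mu>low * ?w y \<le> p y * ?w y"
      using bd[OF in_[of y]] by (cases "y \<in> {min a q<..max a q}") (auto intro!: mult_right_mono)
  qed (use pw lborel_abs_diff in auto)
  then show "\<mu>low / 2 * (a - q)\<^sup>2 \<le> (\<integral>y. pinball \<tau> (y - a) - pinball \<tau> (y - q) \<partial>\<kappa>)"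
    using lborel_abs_diff[of a q] by (simp add: eq wd)
  have "(\<integral>y. p y * ?w y \<partial>lborel) \<le> (\<integral>y. \<mu>up * ?w y \<partial>lborel)"
  proof (rule integral_mono)
    fix y show "p y * ?w y \<le> \<mu>up * ?w y"
      using bd[OF in_[of y]] by (cases "y \<in> {min a q<..max a q}") (auto intro!: mult_right_mono)
  qed (use pw lborel_abs_diff in auto)
  then show "(\<integral>y. pinball \<tau> (y - a) - pinball \<tau> (y - q) \<partial>\<kappa>) \<le> \<mu>up / 2 * (a - q)\<^sup>2"
    using lborel_abs_diff[of a q] by (simp add: eq wd)
qed

text \<open>A density excludes atoms, so the distribution function is continuous and takes the value
  \<open>\<tau>\<close> at the quantile. The third claim, the Galois connection of quantile and
  distribution function, later turns measurability of the kernel into measurability of the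
  quantile.\<close>

lemma cond_quantile_props:
  assumes \<kappa>: "prob_space (K x)" and p[measurable]: "p \<in> borel_measurable borel"
    and dens: "K x = density lborel (\<lambda>y. ennreal (p y))"
    and M: "measure (K x) {-M..M} = 1" and \<tau>: "0 < \<tau>" "\<tau> < 1"
  shows "cond_quantile K \<tau> x \<in> {-M..M}" "measure (K x) {..cond_quantile K \<tau> x} = \<tau>"
    and "cond_quantile K \<tau> x \<le> t \<longleftrightarrow> \<tau> \<le> measure (K x) {..t}"
proof -
  let ?F = "cdf (K x)"
  let ?S = "{t. ?F t \<ge> \<tau>}"
  interpret prob_space "K x" by (rule \<kappa>)
  have sets: "sets (K x) = sets borel" using dens by simp
  interpret rd: real_distribution "K x"
    by unfold_locales (use sets in auto)
  have at: "measure (K x) {y} = 0" for y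
  proof -
    have "emeasure (K x) {y} = (\<integral>\<^sup>+z. ennreal (p z) * indicator {y} z \<partial>lborel)"
      unfolding dens by (rule emeasure_density) auto
    also have "\<dots> = (\<integral>\<^sup>+(z::real). 0 \<partial>lborel)"
    proof (rule nn_integral_cong_AE)
      show "AE z in lborel. ennreal (p z) * indicator {y} z = 0"
        using AE_lborel_singleton[of y] by eventually_elim (auto simp: indicator_def)
    qed
    finally show ?thesis by (simp add: measure_def)
  qed
  then have cont: "isCont ?F y" for y by (simp add: rd.isCont_cdf)
  then have cF: "continuous_on UNIV ?F" by (simp add: continuous_at_imp_continuous_on)
  have FM: "?F M = 1"
  proof -
    have "measure (K x) {-M..M} \<le> measure (K x) {..M}"
      by (rule finite_measure_mono) (auto simp: sets)
    then show ?thesis using M prob_le_1[of "{..M}"] by (simp add: cdf_def)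
  qed
  have Fm: "?F t = 0" if "t \<le> -M" for t
  proof -
    have "{..-M} = {..<-M} \<union> {-M}" by auto
    then have "?F (-M) = measure (K x) ({..<-M} \<union> {-M})" by (simp only: cdf_def)
    also have "\<dots> \<le> measure (K x) {..<-M} + measure (K x) {-M}"
      by (rule measure_Un_le) (auto simp: sets)
    also have "\<dots> \<le> measure (K x) (space (K x) - {-M..M})"
      using at by simp (rule finite_measure_mono, auto simp: sets)
    also have "\<dots> = 0" using M by (subst prob_compl) (auto simp: sets)
    finally have "?F (-M) \<le> 0" .
    with rd.cdf_nondecreasing[OF that] show ?thesis
      by (metis antisym cdf_def measure_nonneg order_trans)
  qed
  have lb: "t \<ge> -M" if "t \<in> ?S" for t
    using that \<tau> Fm[of t] by (cases "t \<le> -M") auto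
  have bdd: "bdd_below ?S" using lb by (rule bdd_belowI)
  have ne: "M \<in> ?S" using FM \<tau> by simp
  have cl: "closed ?S"
    by (rule closed_Collect_le) (use cF in auto)
  define q where "q = Inf ?S"
  have qeq: "cond_quantile K \<tau> x = q" by (simp add: q_def cond_quantile_def cdf_def)
  have qS: "q \<in> ?S" unfolding q_def using closed_contains_Inf[OF _ bdd cl] ne by blast
  have qM: "q \<le> M" unfolding q_def by (rule cInf_lower[OF ne bdd])
  have qlb: "-M \<le> q" using lb[OF qS] .
  \<comment> \<open>Left continuity: if the distribution function exceeded \<open>\<tau>\<close> at
    q, it would already do so slightly below q, against the choice of q as an infimum.\<close>
  have "?F q \<le> \<tau>"
  proof (rule ccontr)
    assume "\<not> ?F q \<le> \<tau>"
    then have "\<tau> < ?F q" by simp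
    moreover have "(?F \<longlongrightarrow> ?F q) (at_left q)"
      using cont[of q] by (simp add: continuous_within filterlim_at_split isCont_def)
    ultimately have "eventually (\<lambda>t. \<tau> < ?F t) (at_left q)" by (rule order_tendstoD(1)[rotated])
    then obtain b where b: "b < q" "\<And>t. b < t \<Longrightarrow> t < q \<Longrightarrow> \<tau> < ?F t"
      by (auto simp: eventually_at_left_field)
    define t where "t = (b + q) / 2"
    have "t \<in> ?S" "t < q" using b(1) b(2)[of t] by (auto simp: t_def field_simps less_imp_le)
    then show False using cInf_lower[OF _ bdd, of t] q_def by auto
  qed
  with qS have Fq: "?F q = \<tau>" by simp
  show "cond_quantile K \<tau> x \<in> {-M..M}" using qeq qM qlb by simp
  show "measure (K x) {..cond_quantile K \<tau> x} = \<tau>" using Fq qeq by (simp add: cdf_def)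
  show "cond_quantile K \<tau> x \<le> t \<longleftrightarrow> \<tau> \<le> measure (K x) {..t}"
  proof
    assume "cond_quantile K \<tau> x \<le> t"
    then show "\<tau> \<le> measure (K x) {..t}"
      using rd.cdf_nondecreasing[of q t] Fq qeq by (simp add: cdf_def)
  next
    assume "\<tau> \<le> measure (K x) {..t}"
    then have "t \<in> ?S" by (simp add: cdf_def)
    then show "cond_quantile K \<tau> x \<le> t" using cInf_lower[OF _ bdd] qeq q_def by auto
  qed
qed

subsection \<open>Oracle inequality\<close>

lemma space_cube_space: "space (cube_space d) = cube d"
  by (simp add: cube_space_def cube_def space_PiM)

lemma cube_nonempty: "cube d \<noteq> {}"
  by (auto simp: cube_def PiE_eq_empty_iff)

locale quantile_model =
  fixes d :: nat and M \<mu>low \<mu>up \<tau> :: real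
    and PX :: "(nat \<Rightarrow> real) measure" and K :: "(nat \<Rightarrow> real) \<Rightarrow> real measure"
  assumes PX: "PX \<in> space (prob_algebra (cube_space d))"
    and K: "K \<in> cube_space d \<rightarrow>\<^sub>M prob_algebra borel"
    and bounded: "bounded_model d M K"
    and density: "density_bounds d M \<mu>low \<mu>up K"
    and \<tau>: "0 < \<tau>" "\<tau> < 1"
begin

abbreviation "q \<equiv> cond_quantile K \<tau>"

definition excess :: "((nat \<Rightarrow> real) \<Rightarrow> real) \<Rightarrow> (nat \<Rightarrow> real) \<times> real \<Rightarrow> real" where
  "excess g z = pinball \<tau> (snd z - g (fst z)) - pinball \<tau> (snd z - q (fst z))"

abbreviation "P \<equiv> joint_distr d PX K"

definition "kern = (\<lambda>x. distr (K x) (cube_space d \<Otimes>\<^sub>M borel) (\<lambda>y. (x, y)))"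

lemma P_eq: "P = PX \<bind> kern"
  by (simp add: joint_distr_def kern_def)

lemma M_pos: "0 < M" and \<mu>low_pos: "0 < \<mu>low"
  using bounded density by (simp_all add: bounded_model_def density_bounds_def)

lemma sets_PX[measurable_cong]: "sets PX = sets (cube_space d)"
  using PX by (simp add: space_prob_algebra)

lemma space_PX: "space PX = cube d"
  using sets_eq_imp_space_eq[OF sets_PX] by (simp add: space_cube_space)

sublocale PX: prob_space PX
  using PX by (simp add: space_prob_algebra)

lemma prob_space_K: "x \<in> cube d \<Longrightarrow> prob_space (K x)"
  and sets_K: "x \<in> cube d \<Longrightarrow> sets (K x) = sets borel"
  using measurable_space[OF K, of x] by (simp_all add: space_cube_space space_prob_algebra)

lemma density_K:
  assumes "x \<in> cube d"
  obtains p where "p \<in> borel_measurable borel" "\<And>y. 0 \<le> p y"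
    "K x = density lborel (\<lambda>y. ennreal (p y))" "\<And>y. y \<in> {-M..M} \<Longrightarrow> \<mu>low \<le> p y \<and> p y \<le> \<mu>up"
  using density assms unfolding density_bounds_def by blast

lemma q_props:
  assumes x: "x \<in> cube d"
  shows "q x \<in> {-M..M}" "measure (K x) {..q x} = \<tau>" "q x \<le> t \<longleftrightarrow> \<tau> \<le> measure (K x) {..t}"
proof -
  obtain p where p: "p \<in> borel_measurable borel" "K x = density lborel (\<lambda>y. ennreal (p y))"
    using density_K[OF x] by metis
  have "measure (K x) {-M..M} = 1" using bounded x by (simp add: bounded_model_def)
  from cond_quantile_props[where K=K and x=x, OF prob_space_K[OF x] p this \<tau>]
  show "q x \<in> {-M..M}" "measure (K x) {..q x} = \<tau>" "q x \<le> t \<longleftrightarrow> \<tau> \<le> measure (K x) {..t}"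
    by blast+
qed

lemma q_measurable[measurable]: "q \<in> borel_measurable (cube_space d)"
proof (rule borel_measurable_iff_le[THEN iffD2], intro allI)
  fix t
  have "(\<lambda>x. measure (K x) {..t}) \<in> borel_measurable (cube_space d)"
    by (rule measurable_compose[OF K measurable_measure_prob_algebra]) simp
  then have "{x \<in> space (cube_space d). \<tau> \<le> measure (K x) {..t}} \<in> sets (cube_space d)"
    by measurable
  also have "{x \<in> space (cube_space d). \<tau> \<le> measure (K x) {..t}} = {x \<in> space (cube_space d). q x \<le> t}"
    using q_props(3) by (auto simp: space_cube_space)
  finally show "{x \<in> space (cube_space d). q x \<le> t} \<in> sets (cube_space d)" .
qed

lemma kern_measurable: "kern \<in> PX \<rightarrow>\<^sub>M prob_algebra (cube_space d \<Otimes>\<^sub>M borel)"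
  unfolding kern_def
  by (rule measurable_distr_prob_space2[where M=borel]) (use K in measurable)

lemma sets_P[measurable_cong]: "sets P = sets (cube_space d \<Otimes>\<^sub>M borel)"
  unfolding P_eq by (rule sets_bind) (auto simp: kern_def PX.not_empty)

lemma space_P: "space P = cube d \<times> UNIV"
  using sets_eq_imp_space_eq[OF sets_P] by (simp add: space_pair_measure space_cube_space)

sublocale P: prob_space P
  unfolding P_eq
proof (rule PX.prob_space_bind)
  show "kern \<in> PX \<rightarrow>\<^sub>M subprob_algebra (cube_space d \<Otimes>\<^sub>M borel)"
    by (rule measurable_prob_algebraD[OF kern_measurable])
  show "AE x in PX. prob_space (kern x)"
    using measurable_space[OF kern_measurable] by (auto intro!: AE_I2 simp: space_prob_algebra)
qed

lemma Pair_measurable_K: "x \<in> cube d \<Longrightarrow> Pair x \<in> K x \<rightarrow>\<^sub>M cube_space d \<Otimes>\<^sub>M borel"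
  by (subst measurable_cong_sets[OF sets_K refl]) (auto simp: space_cube_space)

lemma integral_kern:
  fixes h :: "_ \<Rightarrow> real"
  assumes h: "h \<in> borel_measurable (cube_space d \<Otimes>\<^sub>M borel)" and x: "x \<in> cube d"
  shows "(\<integral>z. h z \<partial>kern x) = (\<integral>y. h (x, y) \<partial>K x)"
  unfolding kern_def by (rule integral_distr[OF Pair_measurable_K[OF x] h])

lemma integral_K_measurable:
  fixes h :: "_ \<Rightarrow> real"
  assumes h: "h \<in> borel_measurable (cube_space d \<Otimes>\<^sub>M borel)"
  shows "(\<lambda>x. \<integral>y. h (x, y) \<partial>K x) \<in> borel_measurable PX"
proof -
  have "(\<lambda>x. \<integral>z. h z \<partial>kern x) \<in> borel_measurable PX"
    by (rule measurable_compose[OF measurable_prob_algebraD[OF kern_measurable]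
        integral_measurable_subprob_algebra[OF h]])
  then show ?thesis
    by (subst measurable_cong[where g="\<lambda>x. \<integral>z. h z \<partial>kern x"]) (auto simp: space_PX integral_kern[OF h])
qed

lemma integral_P:
  fixes h :: "_ \<Rightarrow> real"
  assumes h[measurable]: "h \<in> borel_measurable (cube_space d \<Otimes>\<^sub>M borel)"
    and B: "\<And>x y. x \<in> cube d \<Longrightarrow> \<bar>h (x, y)\<bar> \<le> B"
  shows "(\<integral>z. h z \<partial>P) = (\<integral>x. (\<integral>y. h (x, y) \<partial>K x) \<partial>PX)"
proof -
  have "(\<integral>z. h z \<partial>P) = (\<integral>x. (\<integral>z. h z \<partial>kern x) \<partial>PX)"
    unfolding P_eq
  proof (rule integral_bind[where K="cube_space d \<Otimes>\<^sub>M borel" and B=B and B'=1])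
    show "kern \<in> PX \<rightarrow>\<^sub>M subprob_algebra (cube_space d \<Otimes>\<^sub>M borel)"
      by (rule measurable_prob_algebraD[OF kern_measurable])
    show "AE x in PX. emeasure (kern x) (space (kern x)) \<le> ennreal 1"
      using measurable_space[OF kern_measurable]
      by (auto intro!: AE_I2 simp: space_prob_algebra prob_space.emeasure_space_1)
    show "z \<in> space (cube_space d \<Otimes>\<^sub>M borel) \<Longrightarrow> \<bar>h z\<bar> \<le> B" for z
      using B by (cases z) (auto simp: space_pair_measure space_cube_space)
  qed (auto simp: PX.finite_measure_axioms)
  also have "\<dots> = (\<integral>x. (\<integral>y. h (x, y) \<partial>K x) \<partial>PX)"
    by (rule Bochner_Integration.integral_cong) (auto simp: space_PX integral_kern[OF h])
  finally show ?thesis .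
qed

text \<open>\<open>measurable_erm\<close> promises minimisation only for labels in [-M,M]; this
  makes the promise available almost surely.\<close>

lemma labels_AE: "AE z in P. snd z \<in> {-M..M}"
proof -
  have "AE x in PX. AE z in kern x. snd z \<in> {-M..M}"
  proof (rule AE_I2)
    fix x assume "x \<in> space PX"
    then have x: "x \<in> cube d" by (simp add: space_PX)
    interpret Kx: prob_space "K x" by (rule prob_space_K[OF x])
    have "measure (K x) {-M..M} = 1" using bounded x by (simp add: bounded_model_def)
    then have "AE y in K x. y \<in> {-M..M}" by (subst (asm) Kx.prob_eq_1) (auto simp: sets_K[OF x])
    then show "AE z in kern x. snd z \<in> {-M..M}"
      unfolding kern_def by (subst AE_distr_iff[OF Pair_measurable_K[OF x]]) auto
  qed
  then show ?thesis unfolding P_eq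
    by (subst AE_bind[OF measurable_prob_algebraD[OF kern_measurable]]) auto
qed

lemma excess_measurable[measurable]:
  assumes [measurable]: "g \<in> borel_measurable (cube_space d)"
  shows "excess g \<in> borel_measurable (cube_space d \<Otimes>\<^sub>M borel)"
proof -
  note measurable_compose[OF measurable_fst assms, measurable]
    measurable_compose[OF measurable_fst q_measurable, measurable]
  show ?thesis unfolding excess_def by measurable
qed

lemma excess_abs: "\<bar>excess g (x, y)\<bar> \<le> \<bar>g x - q x\<bar>"
  unfolding excess_def using pinball_lipschitz[OF \<tau>, of "y - g x" "y - q x"] by simp

lemma excess_bound:
  assumes "x \<in> cube d" "g x \<in> {-M..M}"
  shows "\<bar>excess g (x, y)\<bar> \<le> 2 * M"
  using excess_abs[of g x y] q_props(1)[OF assms(1)] assms(2) by auto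

context
  fixes g assumes g[measurable]: "g \<in> borel_measurable (cube_space d)"
    and gM: "\<And>x. x \<in> cube d \<Longrightarrow> g x \<in> {-M..M}"
begin

lemma sq_le: "x \<in> cube d \<Longrightarrow> (g x - q x)\<^sup>2 \<le> (2 * M)\<^sup>2"
  using gM[of x] q_props(1)[of x] by (intro abs_le_square_iff[THEN iffD1]) auto

lemma sq_integrable: "integrable PX (\<lambda>x. (g x - q x)\<^sup>2)"
  by (rule PX.integrable_const_bound[of _ "(2 * M)\<^sup>2"]) (use sq_le in \<open>auto simp: space_PX\<close>)

lemma excess_mean:
  "\<mu>low / 2 * (\<integral>x. (g x - q x)\<^sup>2 \<partial>PX) \<le> (\<integral>z. excess g z \<partial>P)" (is ?lo)
  "(\<integral>z. excess g z \<partial>P) \<le> \<mu>up / 2 * (\<integral>x. (g x - q x)\<^sup>2 \<partial>PX)" (is ?up)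
proof -
  let ?E = "\<lambda>x. \<integral>y. excess g (x, y) \<partial>K x"
  have eq: "(\<integral>z. excess g z \<partial>P) = (\<integral>x. ?E x \<partial>PX)"
    by (rule integral_P[where B="2*M"]) (use excess_bound gM in auto)
  have b: "\<mu>low / 2 * (g x - q x)\<^sup>2 \<le> ?E x \<and> ?E x \<le> \<mu>up / 2 * (g x - q x)\<^sup>2"
    if x: "x \<in> cube d" for x
  proof -
    obtain p where p: "p \<in> borel_measurable borel" "\<And>y. 0 \<le> p y"
      "K x = density lborel (\<lambda>y. ennreal (p y))" "\<And>y. y \<in> {-M..M} \<Longrightarrow> \<mu>low \<le> p y \<and> p y \<le> \<mu>up"
      using density_K[OF x] by metis
    from pinball_excess_bounds[OF prob_space_K[OF x] p gM[OF x] q_props(1,2)[OF x]]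
    show ?thesis by (simp add: excess_def)
  qed
  have mE: "?E \<in> borel_measurable PX"
    by (rule integral_K_measurable[OF excess_measurable[OF g]])
  \<comment> \<open>The larger of the two absolute values covers both estimates in \<open>b\<close>,
    whatever the sign of \<open>\<mu>up\<close>.\<close>
  have iE: "integrable PX ?E"
  proof (rule PX.integrable_const_bound[of _ "max \<bar>\<mu>low / 2\<bar> \<bar>\<mu>up / 2\<bar> * (2 * M)\<^sup>2"])
    show "AE x in PX. norm (?E x) \<le> max \<bar>\<mu>low / 2\<bar> \<bar>\<mu>up / 2\<bar> * (2 * M)\<^sup>2"
    proof (intro AE_I2)
      fix x assume "x \<in> space PX"
      then have x: "x \<in> cube d" by (simp add: space_PX)
      have "\<bar>?E x\<bar> \<le> max \<bar>\<mu>low / 2\<bar> \<bar>\<mu>up / 2\<bar> * (g x - q x)\<^sup>2"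
      proof -
        define m where "m = max \<bar>\<mu>low / 2\<bar> \<bar>\<mu>up / 2\<bar>"
        have m: "\<mu>up / 2 \<le> m" "- m \<le> \<mu>low / 2" unfolding m_def by linarith+
        have "\<mu>up / 2 * (g x - q x)\<^sup>2 \<le> m * (g x - q x)\<^sup>2" "(- m) * (g x - q x)\<^sup>2 \<le> \<mu>low / 2 * (g x - q x)\<^sup>2"
          by (rule mult_right_mono[OF m(1)], simp) (rule mult_right_mono[OF m(2)], simp)
        then show ?thesis using b[OF x] unfolding m_def[symmetric] by (simp add: abs_le_iff)
      qed
      also have "\<dots> \<le> max \<bar>\<mu>low / 2\<bar> \<bar>\<mu>up / 2\<bar> * (2 * M)\<^sup>2"
        by (rule mult_left_mono[OF sq_le[OF x]]) auto
      finally show "norm (?E x) \<le> \<dots>" by simp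
    qed
  qed (rule mE)
  show ?lo unfolding eq
    by (subst integral_mult_right_zero[symmetric], rule integral_mono)
       (use b iE sq_integrable in \<open>auto simp: space_PX\<close>)
  show ?up unfolding eq
    by (subst integral_mult_right_zero[symmetric], rule integral_mono)
       (use b iE sq_integrable in \<open>auto simp: space_PX\<close>)
qed

text \<open>The pinball loss is 1-Lipschitz, so the excess loss at (x, y) is at most |g x - q x| for
  every label. Together with the lower bound in \<open>excess_mean\<close> this is the Bernstein
  condition, second moment bounded by a multiple of the mean, which produces the fast rate.\<close>

lemma excess_square: "(\<integral>z. (excess g z)\<^sup>2 \<partial>P) \<le> (\<integral>x. (g x - q x)\<^sup>2 \<partial>PX)"
proof -
  have b: "(excess g (x, y))\<^sup>2 \<le> (g x - q x)\<^sup>2" for x y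
    using excess_abs by (simp add: abs_le_square_iff)
  let ?E = "\<lambda>x. \<integral>y. (excess g (x, y))\<^sup>2 \<partial>K x"
  have eq: "(\<integral>z. (excess g z)\<^sup>2 \<partial>P) = (\<integral>x. ?E x \<partial>PX)"
    by (rule integral_P[where B="(2*M)\<^sup>2"]) (use b sq_le in \<open>auto intro: order_trans\<close>)
  have bE: "?E x \<le> (g x - q x)\<^sup>2" if x: "x \<in> cube d" for x
  proof -
    interpret Kx: prob_space "K x" by (rule prob_space_K[OF x])
    have [measurable_cong]: "sets (K x) = sets borel" by (rule sets_K[OF x])
    have [measurable]: "(\<lambda>y. excess g (x, y)) \<in> borel_measurable (K x)"
      using measurable_compose[OF Pair_measurable_K[OF x] excess_measurable[OF g]] by simp
    have "?E x \<le> (\<integral>y. (g x - q x)\<^sup>2 \<partial>K x)"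
      by (rule integral_mono) (use b in \<open>auto intro!: Kx.integrable_const_bound[of _ "(g x - q x)\<^sup>2"]\<close>)
    then show ?thesis by (simp add: Kx.prob_space)
  qed
  show ?thesis unfolding eq
  proof (rule integral_mono')
    show "0 \<le> (g x - q x)\<^sup>2" for x by simp
  qed (use bE sq_integrable in \<open>auto simp: space_PX\<close>)
qed

end

lemma sets_sample_distr[measurable_cong]:
  "sets (sample_distr d PX K n) = sets (PiM {..<n} (\<lambda>_. cube_space d \<Otimes>\<^sub>M borel))"
  unfolding sample_distr_def by (rule sets_PiM_cong) (auto simp: sets_P)

lemma L2_risk_measurable:
  assumes erm: "measurable_erm d M \<tau> n F fhat"
  shows "(\<lambda>D. \<integral>x. (fhat D x - q x)\<^sup>2 \<partial>PX) \<in> borel_measurable (sample_distr d PX K n)"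
proof -
  have m: "(\<lambda>(D, x). fhat D x) \<in> borel_measurable (PiM {..<n} (\<lambda>_. cube_space d \<Otimes>\<^sub>M borel) \<Otimes>\<^sub>M cube_space d)"
    using erm by (simp add: measurable_erm_def)
  have "(\<lambda>(D, x). fhat D x) \<in> borel_measurable (sample_distr d PX K n \<Otimes>\<^sub>M PX)"
    using m by (subst measurable_cong_sets[OF sets_pair_measure_cong[OF sets_sample_distr sets_PX] refl])
  then have [measurable]: "(\<lambda>z. fhat (fst z) (snd z)) \<in> borel_measurable (sample_distr d PX K n \<Otimes>\<^sub>M PX)"
    by (simp add: case_prod_beta)
  have "(\<lambda>(D, x). (fhat D x - q x)\<^sup>2) \<in> borel_measurable (sample_distr d PX K n \<Otimes>\<^sub>M PX)"
    unfolding case_prod_beta by measurable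
  from PX.borel_measurable_lebesgue_integral[OF this] show ?thesis .
qed

text \<open>The minimiser depends on the data, so it is exchanged for a net element, and the tail
  bound is applied to all net elements and, with reversed sign, to \<open>f0\<close>. Off these
  exceptional events the empirical comparison of the minimiser with \<open>f0\<close> becomes a
  comparison of expectations.\<close>

lemma erm_oracle_inequality:
  fixes F Net :: "((nat \<Rightarrow> real) \<Rightarrow> real) set"
  assumes Net: "finite Net" "\<And>g. g \<in> Net \<Longrightarrow> g \<in> borel_measurable (cube_space d)"
      "\<And>g x. g \<in> Net \<Longrightarrow> x \<in> cube d \<Longrightarrow> g x \<in> {-M..M}"
    and cover: "\<And>f. f \<in> F \<Longrightarrow> \<exists>g\<in>Net. \<forall>x\<in>cube d. \<bar>f x - g x\<bar> \<le> \<epsilon>"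
    and f0: "f0 \<in> F" "f0 \<in> borel_measurable (cube_space d)" "\<And>x. x \<in> cube d \<Longrightarrow> f0 x \<in> {-M..M}"
    and A: "(\<integral>x. (f0 x - q x)\<^sup>2 \<partial>PX) \<le> A"
    and erm: "measurable_erm d M \<tau> n F fhat" and n: "n \<ge> 1"
    and \<delta>: "0 < \<delta>" "\<delta> < 1"
  defines "lam \<equiv> min (\<mu>low / 4) (1 / (2 * M))"
  defines "t \<equiv> ln ((real (card Net) + 1) / \<delta>)"
  shows "measure (sample_distr d PX K n)
      {D \<in> space (sample_distr d PX K n). (\<integral>x. (fhat D x - q x)\<^sup>2 \<partial>PX)
         \<le> 8 / \<mu>low * ((\<mu>up / 2 + lam) * A + 2 * t / (real n * lam) + \<epsilon>) + 2 * \<epsilon>\<^sup>2} \<ge> 1 - \<delta>"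
proof -
  let ?Q = "sample_distr d PX K n"
  have Qd: "?Q = PiM {..<n} (\<lambda>_. P)" by (simp add: sample_distr_def)
  interpret Q: prob_space ?Q unfolding Qd by (rule prob_space_PiM) (rule P.prob_space_axioms)
  interpret PP: product_prob_space "\<lambda>_::nat. P" "{..<n}" by unfold_locales
  \<comment> \<open>The bound 1 / (2 M) is the range condition of
    \<open>bernstein_lower_tail\<close>. The bound \<open>\<mu>low / 4\<close> keeps the
    second-moment term below half of the lower bound \<open>\<mu>low / 2\<close> for the mean, so
    that the other half survives.\<close>
  have lam: "0 < lam" "lam \<le> \<mu>low / 4" "lam * (2 * M) \<le> 1"
    using M_pos \<mu>low_pos by (auto simp: lam_def min_def field_simps)
  let ?N = "\<lambda>g. \<integral>x. (g x - q x)\<^sup>2 \<partial>PX"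
  define bad where "bad g = {D \<in> space ?Q. (\<Sum>i<n. excess g (D i)) \<le>
     real n * ((\<integral>z. excess g z \<partial>P) - lam * (\<integral>z. (excess g z)\<^sup>2 \<partial>P)) - t / lam}" for g
  define bad0 where "bad0 = {D \<in> space ?Q. (\<Sum>i<n. - excess f0 (D i)) \<le>
     real n * ((\<integral>z. - excess f0 z \<partial>P) - lam * (\<integral>z. (- excess f0 z)\<^sup>2 \<partial>P)) - t / lam}"
  have exP: "excess g \<in> borel_measurable P" if "g \<in> borel_measurable (cube_space d)" for g
    using excess_measurable[OF that] by (subst measurable_cong_sets[OF sets_P refl])
  have bad: "measure ?Q (bad g) \<le> exp (-t)" if g: "g \<in> Net" for g
    unfolding bad_def Qd
    by (rule bernstein_lower_tail[OF P.prob_space_axioms exP[OF Net(2)[OF g]], of "2 * M"])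
       (use lam excess_bound Net(3)[OF g] in \<open>auto simp: space_P\<close>)
  have bad0: "measure ?Q bad0 \<le> exp (-t)"
    unfolding bad0_def Qd
    by (rule bernstein_lower_tail[OF P.prob_space_axioms, of _ "2 * M"])
       (use lam excess_bound f0(3) exP[OF f0(2)] in \<open>auto simp: space_P\<close>)
  have bad_sets: "bad g \<in> sets ?Q" if g: "g \<in> Net" for g
  proof -
    have [measurable]: "excess g \<in> borel_measurable (cube_space d \<Otimes>\<^sub>M borel)"
      using Net(2)[OF g] by measurable
    show ?thesis unfolding bad_def by measurable
  qed
  have bad0_sets: "bad0 \<in> sets ?Q"
  proof -
    have [measurable]: "excess f0 \<in> borel_measurable (cube_space d \<Otimes>\<^sub>M borel)"
      using f0(2) by measurable
    show ?thesis unfolding bad0_def by measurable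
  qed
  define B where "B = bad0 \<union> (\<Union>g\<in>Net. bad g)"
  have Bs: "B \<in> sets ?Q" unfolding B_def using bad_sets bad0_sets Net(1) by auto
  have "measure ?Q B \<le> measure ?Q bad0 + measure ?Q (\<Union>g\<in>Net. bad g)"
    unfolding B_def by (rule measure_Un_le) (use bad_sets bad0_sets Net(1) in auto)
  also have "measure ?Q (\<Union>g\<in>Net. bad g) \<le> (\<Sum>g\<in>Net. measure ?Q (bad g))"
    by (rule Q.finite_measure_subadditive_finite) (use bad_sets Net(1) in auto)
  also have "\<dots> \<le> real (card Net) * exp (-t)"
    using sum_bounded_above[of Net "\<lambda>g. measure ?Q (bad g)" "exp (-t)"] bad by auto
  finally have "measure ?Q B \<le> (real (card Net) + 1) * exp (-t)" using bad0 by (simp add: algebra_simps)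
  \<comment> \<open>\<open>t\<close> is made for a union bound over \<open>card Net + 1\<close>
    events, one for each net element and one for \<open>f0\<close>.\<close>
  also have "\<dots> = \<delta>"
  proof -
    have "exp t = (real (card Net) + 1) / \<delta>" unfolding t_def using \<delta> by (intro exp_ln) auto
    then show ?thesis using \<delta> by (simp add: exp_minus)
  qed
  finally have PB: "measure ?Q B \<le> \<delta>" .
  define R where "R = 8 / \<mu>low * ((\<mu>up / 2 + lam) * A + 2 * t / (real n * lam) + \<epsilon>) + 2 * \<epsilon>\<^sup>2"
  define ev where "ev = {D \<in> space ?Q. ?N (fhat D) \<le> R}"
  have ev_sets: "ev \<in> sets ?Q"
  proof -
    note L2_risk_measurable[OF erm, measurable]
    show ?thesis unfolding ev_def by measurable
  qed
  have lab: "AE D in ?Q. \<forall>i<n. snd (D i) \<in> {-M..M}"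
  proof -
    have "AE D in ?Q. snd (D i) \<in> {-M..M}" if "i < n" for i
      unfolding Qd using PP.AE_component[of i "\<lambda>z. snd z \<in> {-M..M}"] that labels_AE by auto
    then have "AE D in ?Q. \<forall>i\<in>{..<n}. snd (D i) \<in> {-M..M}" by (subst AE_finite_all) auto
    then show ?thesis by auto
  qed
  have key: "?N (fhat D) \<le> R"
    if D: "D \<in> space ?Q" and l: "\<forall>i<n. snd (D i) \<in> {-M..M}" and nB: "D \<notin> B" for D
  proof -
    have Dsp: "D i \<in> cube d \<times> UNIV" if "i < n" for i
      using D that unfolding Qd by (auto simp: space_PiM space_P PiE_iff)
    have "D \<in> {..<n} \<rightarrow>\<^sub>E cube d \<times> {-M..M}"
      using D l Dsp unfolding Qd by (auto simp: space_PiM PiE_iff mem_Times_iff)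
    with erm have fF: "fhat D \<in> F" and fmin: "emp_risk n \<tau> D (fhat D) \<le> emp_risk n \<tau> D f0"
      using f0(1) unfolding measurable_erm_def by blast+
    from cover[OF fF] obtain g where g: "g \<in> Net" and fg: "\<And>x. x \<in> cube d \<Longrightarrow> \<bar>fhat D x - g x\<bar> \<le> \<epsilon>" by blast
    have e0: "0 \<le> \<epsilon>" using fg cube_nonempty by (meson abs_ge_zero all_not_in_conv order_trans)
    have n0: "real n > 0" using n by simp
    have er: "(\<Sum>i<n. pinball \<tau> (snd (D i) - f (fst (D i)))) = real n * emp_risk n \<tau> D f" for f
      using n by (simp add: emp_risk_def)
    have "(\<Sum>i<n. excess g (D i)) \<le> (\<Sum>i<n. pinball \<tau> (snd (D i) - fhat D (fst (D i))) + \<epsilon> - pinball \<tau> (snd (D i) - q (fst (D i))))"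
    proof (rule sum_mono)
      fix i assume i: "i \<in> {..<n}"
      have "\<bar>pinball \<tau> (snd (D i) - g (fst (D i))) - pinball \<tau> (snd (D i) - fhat D (fst (D i)))\<bar> \<le> \<epsilon>"
        using pinball_lipschitz[OF \<tau>, of "snd (D i) - g (fst (D i))" "snd (D i) - fhat D (fst (D i))"]
          fg[of "fst (D i)"] Dsp[of i] i by (auto simp: mem_Times_iff)
      then show "excess g (D i) \<le> pinball \<tau> (snd (D i) - fhat D (fst (D i))) + \<epsilon> - pinball \<tau> (snd (D i) - q (fst (D i)))"
        unfolding excess_def by linarith
    qed
    also have "\<dots> = real n * emp_risk n \<tau> D (fhat D) + real n * \<epsilon> - real n * emp_risk n \<tau> D q"
      by (simp add: sum.distrib sum_subtractf er)
    also have "\<dots> \<le> real n * emp_risk n \<tau> D f0 + real n * \<epsilon> - real n * emp_risk n \<tau> D q"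
      using fmin n0 by simp
    also have "\<dots> = (\<Sum>i<n. excess f0 (D i)) + real n * \<epsilon>"
      by (simp add: excess_def sum_subtractf er)
    finally have c1: "(\<Sum>i<n. excess g (D i)) \<le> (\<Sum>i<n. excess f0 (D i)) + real n * \<epsilon>" .
    have c2: "(\<Sum>i<n. excess g (D i)) > real n * ((\<integral>z. excess g z \<partial>P) - lam * (\<integral>z. (excess g z)\<^sup>2 \<partial>P)) - t / lam"
      using nB D g unfolding B_def bad_def by auto
    have "(\<Sum>i<n. - excess f0 (D i)) > real n * ((\<integral>z. - excess f0 z \<partial>P) - lam * (\<integral>z. (- excess f0 z)\<^sup>2 \<partial>P)) - t / lam"
      using nB D unfolding B_def bad0_def by auto
    then have c3: "(\<Sum>i<n. excess f0 (D i)) < real n * ((\<integral>z. excess f0 z \<partial>P) + lam * (\<integral>z. (excess f0 z)\<^sup>2 \<partial>P)) + t / lam"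
      by (simp add: sum_negf algebra_simps)
    have "real n * ((\<integral>z. excess g z \<partial>P) - lam * (\<integral>z. (excess g z)\<^sup>2 \<partial>P))
        \<le> real n * ((\<integral>z. excess f0 z \<partial>P) + lam * (\<integral>z. (excess f0 z)\<^sup>2 \<partial>P)) + 2 * (t / lam) + real n * \<epsilon>"
      using c1 c2 c3 by linarith
    also have "\<dots> = real n * ((\<integral>z. excess f0 z \<partial>P) + lam * (\<integral>z. (excess f0 z)\<^sup>2 \<partial>P) + 2 * t / (real n * lam) + \<epsilon>)"
      using n0 lam(1) by (simp add: field_simps)
    finally have c4: "(\<integral>z. excess g z \<partial>P) - lam * (\<integral>z. (excess g z)\<^sup>2 \<partial>P)
       \<le> (\<integral>z. excess f0 z \<partial>P) + lam * (\<integral>z. (excess f0 z)\<^sup>2 \<partial>P) + 2 * t / (real n * lam) + \<epsilon>"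
      using n0 by simp
    have g1: "\<mu>low / 2 * ?N g \<le> (\<integral>z. excess g z \<partial>P)" and g2: "(\<integral>z. (excess g z)\<^sup>2 \<partial>P) \<le> ?N g"
      using excess_mean(1)[of g] excess_square[of g] Net(2,3)[OF g] by auto
    have h1: "(\<integral>z. excess f0 z \<partial>P) \<le> \<mu>up / 2 * ?N f0" and h2: "(\<integral>z. (excess f0 z)\<^sup>2 \<partial>P) \<le> ?N f0"
      using excess_mean(2)[of f0] excess_square[of f0] f0(2,3) by auto
    have Ng0: "0 \<le> ?N g" by (rule integral_nonneg_AE) auto
    have \<mu>up0: "0 \<le> \<mu>up"
    proof -
      obtain x where x: "x \<in> cube d" using cube_nonempty by blast
      from density_K[OF x] have "\<mu>low \<le> \<mu>up" using M_pos
        by (metis atLeastAtMost_iff less_imp_le neg_le_0_iff_le order_trans)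
      then show ?thesis using \<mu>low_pos by linarith
    qed
    have l1: "lam * (\<integral>z. (excess g z)\<^sup>2 \<partial>P) \<le> \<mu>low / 4 * ?N g"
      by (rule mult_mono) (use lam g2 \<mu>low_pos in auto)
    have l2: "lam * (\<integral>z. (excess f0 z)\<^sup>2 \<partial>P) \<le> lam * ?N f0" using h2 lam by simp
    have l3: "(\<mu>up / 2 + lam) * ?N f0 \<le> (\<mu>up / 2 + lam) * A"
      by (rule mult_left_mono[OF A]) (use \<mu>up0 lam in auto)
    define T where "T = (\<mu>up / 2 + lam) * A + 2 * t / (real n * lam) + \<epsilon>"
    have e4: "\<mu>low / 2 * ?N g = 2 * (\<mu>low / 4 * ?N g)" by simp
    have l4: "\<mu>up / 2 * ?N f0 + lam * ?N f0 = (\<mu>up / 2 + lam) * ?N f0" by (rule distrib_right[symmetric])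
    have "\<mu>low / 4 * ?N g \<le> T"
      unfolding T_def using c4 g1 h1 l1 l2 l3 e4 l4 by linarith
    then have Ng: "?N g \<le> 4 / \<mu>low * T" using \<mu>low_pos by (simp add: field_simps)
    \<comment> \<open>Passing back from the net element to the minimiser by (u + v)^2 \<le> 2 u^2 +
      2 v^2 doubles the factor \<open>4 / \<mu>low\<close>.\<close>
    have "?N (fhat D) \<le> (\<integral>x. 2 * (g x - q x)\<^sup>2 + 2 * \<epsilon>\<^sup>2 \<partial>PX)"
    proof (rule integral_mono')
      show "integrable PX (\<lambda>x. 2 * (g x - q x)\<^sup>2 + 2 * \<epsilon>\<^sup>2)"
        using sq_integrable[of g] Net(2,3)[OF g] by auto
      fix x assume "x \<in> space PX"
      then have x: "x \<in> cube d" by (simp add: space_PX)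
      have "(fhat D x - g x)\<^sup>2 \<le> \<epsilon>\<^sup>2"
        using fg[OF x] e0 by (simp add: abs_le_square_iff[symmetric])
      moreover have "(fhat D x - q x)\<^sup>2 \<le> 2 * (g x - q x)\<^sup>2 + 2 * (fhat D x - g x)\<^sup>2"
      proof -
        have "2 * (g x - q x)\<^sup>2 + 2 * (fhat D x - g x)\<^sup>2 - (fhat D x - q x)\<^sup>2 = ((g x - q x) - (fhat D x - g x))\<^sup>2"
          by (simp add: power2_eq_square algebra_simps)
        then show ?thesis by (smt (verit) zero_le_power2)
      qed
      ultimately show "(fhat D x - q x)\<^sup>2 \<le> 2 * (g x - q x)\<^sup>2 + 2 * \<epsilon>\<^sup>2" by linarith
    qed simp
    also have "\<dots> = 2 * ?N g + 2 * \<epsilon>\<^sup>2"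
      using sq_integrable[of g] Net(2,3)[OF g] by (simp add: PX.prob_space)
    also have "\<dots> \<le> 2 * (4 / \<mu>low * T) + 2 * \<epsilon>\<^sup>2" using Ng by simp
    also have "\<dots> = R" unfolding R_def T_def by simp
    finally show ?thesis .
  qed
  \<comment> \<open>The inclusion in B holds only almost surely, because \<open>key\<close> needs
    all labels in [-M,M].\<close>
  have "measure ?Q (space ?Q - ev) \<le> measure ?Q B"
  proof (rule Q.finite_measure_mono_AE[OF _ Bs])
    show "AE D in ?Q. D \<in> space ?Q - ev \<longrightarrow> D \<in> B"
      using lab AE_space by eventually_elim (use key in \<open>auto simp: ev_def\<close>)
  qed
  then have "1 - measure ?Q ev \<le> \<delta>" using PB ev_sets by (simp add: Q.prob_compl)
  then show ?thesis unfolding ev_def R_def by linarith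
qed

end

subsection \<open>Taylor polynomials in several variables\<close>

lemma finite_multi_indices:
  "finite {\<gamma> \<in> multi_indices d. order_of d \<gamma> \<le> k}"
proof -
  have "{\<gamma> \<in> multi_indices d. order_of d \<gamma> \<le> k} \<subseteq> (\<lambda>f i. if i < d then f i else 0) ` ({..<d} \<rightarrow>\<^sub>E {..k})"
  proof
    fix \<gamma> assume "\<gamma> \<in> {\<gamma> \<in> multi_indices d. order_of d \<gamma> \<le> k}"
    then have a: "\<And>i. i \<ge> d \<Longrightarrow> \<gamma> i = 0" "order_of d \<gamma> \<le> k" by (auto simp: multi_indices_def)
    have "\<gamma> i \<le> k" if "i < d" for i
      using member_le_sum[of i "{..<d}" \<gamma>] that a(2) by (auto simp: order_of_def)
    then show "\<gamma> \<in> (\<lambda>f i. if i < d then f i else 0) ` ({..<d} \<rightarrow>\<^sub>E {..k})"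
      by (intro image_eqI[of _ _ "restrict \<gamma> {..<d}"]) (auto simp: a(1) fun_eq_iff)
  qed
  then show ?thesis by (rule finite_subset) (intro finite_imageI finite_PiE, auto)
qed

definition mfact :: "nat \<Rightarrow> (nat \<Rightarrow> nat) \<Rightarrow> real" where
  "mfact d \<gamma> = (\<Prod>i<d. fact (\<gamma> i))"

definition mpow :: "nat \<Rightarrow> (nat \<Rightarrow> real) \<Rightarrow> (nat \<Rightarrow> nat) \<Rightarrow> real" where
  "mpow d u \<gamma> = (\<Prod>i<d. u i ^ \<gamma> i)"

lemma mfact_ge_1: "mfact d \<gamma> \<ge> 1"
  unfolding mfact_def by (rule prod_ge_1) simp

lemma mfact_nonzero: "mfact d \<gamma> \<noteq> 0"
  using mfact_ge_1[of d \<gamma>] by auto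

text \<open>Expansion of the derivative \<open>Df \<gamma>\<close> and not only of the function
  itself: the offset \<open>\<gamma>\<close> makes the family closed under partial derivatives,
  which the induction for the remainder needs.\<close>

definition taylor :: "nat \<Rightarrow> nat \<Rightarrow> ((nat \<Rightarrow> nat) \<Rightarrow> (nat \<Rightarrow> real) \<Rightarrow> real) \<Rightarrow> (nat \<Rightarrow> nat) \<Rightarrow>
    (nat \<Rightarrow> real) \<Rightarrow> (nat \<Rightarrow> real) \<Rightarrow> real" where
  "taylor d m Df \<gamma> a x = (\<Sum>\<eta> | \<eta> \<in> multi_indices d \<and> order_of d \<eta> \<le> m.
     Df (\<lambda>i. \<gamma> i + \<eta> i) a / mfact d \<eta> * mpow d (\<lambda>i. x i - a i) \<eta>)"

lemma order_of_incr: "i < d \<Longrightarrow> order_of d (\<eta>(i := Suc (\<eta> i))) = Suc (order_of d \<eta>)"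
  unfolding order_of_def by (simp add: sum.remove[of "{..<d}" i])

lemma multi_incr: "i < d \<Longrightarrow> \<eta> \<in> multi_indices d \<Longrightarrow> \<eta>(i := Suc (\<eta> i)) \<in> multi_indices d"
  by (auto simp: multi_indices_def)

lemma mpow_upd:
  "i < d \<Longrightarrow> mpow d (\<lambda>j. (x(i := t)) j - a j) \<eta> = (t - a i) ^ \<eta> i * (\<Prod>j\<in>{..<d} - {i}. (x j - a j) ^ \<eta> j)"
  unfolding mpow_def by (subst prod.remove[of "{..<d}" i]) (auto intro!: prod.cong)

lemma mfact_upd: "i < d \<Longrightarrow> mfact d (\<eta>(i := Suc (\<eta> i))) = real (Suc (\<eta> i)) * mfact d \<eta>"
  unfolding mfact_def by (simp add: prod.remove[of "{..<d}" i] algebra_simps)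

text \<open>Differentiating a Taylor polynomial shifts the multi-index: terms with \<open>\<eta> i = 0\<close> vanish and
  the others are reindexed by \<open>\<eta> = \<zeta>(i := Suc (\<zeta> i))\<close>.\<close>

lemma taylor_deriv:
  assumes i: "i < d"
  shows "((\<lambda>t. taylor d (Suc m) Df \<gamma> a (x(i := t))) has_real_derivative
     taylor d m Df (\<gamma>(i := Suc (\<gamma> i))) a x) (at (x i) within S)"
proof -
  let ?I = "\<lambda>m. {\<eta>. \<eta> \<in> multi_indices d \<and> order_of d \<eta> \<le> m}"
  let ?c = "\<lambda>\<eta>. Df (\<lambda>j. \<gamma> j + \<eta> j) a / mfact d \<eta>"
  let ?r = "\<lambda>\<eta>. \<Prod>j\<in>{..<d} - {i}. (x j - a j) ^ \<eta> j"
  let ?t = "\<lambda>\<eta>. ?c \<eta> * (real (\<eta> i) * (x i - a i) ^ (\<eta> i - 1) * ?r \<eta>)"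
  have fin: "finite (?I m)" for m using finite_multi_indices by auto
  have "((\<lambda>t. \<Sum>\<eta>\<in>?I (Suc m). ?c \<eta> * ((t - a i) ^ \<eta> i * ?r \<eta>)) has_real_derivative
      (\<Sum>\<eta>\<in>?I (Suc m). ?t \<eta>)) (at (x i) within S)"
    by (rule DERIV_sum) (auto intro!: derivative_eq_intros simp: mfact_nonzero)
  moreover have "(\<lambda>t. taylor d (Suc m) Df \<gamma> a (x(i := t))) = (\<lambda>t. \<Sum>\<eta>\<in>?I (Suc m). ?c \<eta> * ((t - a i) ^ \<eta> i * ?r \<eta>))"
    unfolding taylor_def mpow_upd[OF i] ..
  moreover have "(\<Sum>\<eta>\<in>?I (Suc m). ?t \<eta>) = taylor d m Df (\<gamma>(i := Suc (\<gamma> i))) a x"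
  proof -
    let ?up = "\<lambda>\<eta>::nat \<Rightarrow> nat. \<eta>(i := Suc (\<eta> i))"
    have inj: "inj_on ?up (?I m)"
    proof (rule inj_onI)
      fix u v :: "nat \<Rightarrow> nat" assume "?up u = ?up v"
      then have "?up u j = ?up v j" for j by simp
      then have "u j = v j" for j by (cases "j = i") (metis fun_upd_apply nat.inject)+
      then show "u = v" by auto
    qed
    have sub: "?up ` ?I m \<subseteq> ?I (Suc m)" using i by (auto simp: order_of_incr multi_incr)
    have "(\<Sum>\<eta>\<in>?I (Suc m). ?t \<eta>) = (\<Sum>\<eta>\<in>?up ` ?I m. ?t \<eta>)"
    proof (rule sum.mono_neutral_right[OF fin sub], intro ballI)
      fix \<eta> assume e: "\<eta> \<in> ?I (Suc m) - ?up ` ?I m"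
      have "\<eta> i = 0"
      proof (rule ccontr)
        assume n0: "\<eta> i \<noteq> 0"
        define z where "z = \<eta>(i := \<eta> i - 1)"
        have ez: "\<eta> = ?up z" using n0 by (auto simp: z_def)
        have "z \<in> multi_indices d" using e i by (auto simp: z_def multi_indices_def)
        moreover have "order_of d z \<le> m" using e order_of_incr[OF i, of z] ez by auto
        ultimately show False using e ez by blast
      qed
      then show "?t \<eta> = 0" by simp
    qed
    also have "\<dots> = (\<Sum>\<eta>\<in>?I m. ?t (?up \<eta>))" by (subst sum.reindex[OF inj]) simp
    also have "\<dots> = taylor d m Df (\<gamma>(i := Suc (\<gamma> i))) a x"
      unfolding taylor_def
    proof (rule sum.cong[OF refl])
      fix \<eta> assume "\<eta> \<in> ?I m"
      have 1: "(\<lambda>j. \<gamma> j + (?up \<eta>) j) = (\<lambda>j. (\<gamma>(i := Suc (\<gamma> i))) j + \<eta> j)" by auto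
      have 2: "mpow d (\<lambda>j. x j - a j) \<eta> = (x i - a i) ^ \<eta> i * ?r \<eta>"
        using mpow_upd[OF i, of x "x i"] by simp
      have 3: "?r (?up \<eta>) = ?r \<eta>" by (rule prod.cong) auto
      show "?t (?up \<eta>) = Df (\<lambda>j. (\<gamma>(i := Suc (\<gamma> i))) j + \<eta> j) a / mfact d \<eta> * mpow d (\<lambda>j. x j - a j) \<eta>"
        unfolding 1 2 3 mfact_upd[OF i] by (simp add: mfact_nonzero)
    qed
    finally show ?thesis .
  qed
  ultimately show ?thesis by simp
qed

lemma cube_upd: "x \<in> cube d \<Longrightarrow> i < d \<Longrightarrow> t \<in> {0..1} \<Longrightarrow> x(i := t) \<in> cube d"
  by (auto simp: cube_def PiE_iff extensional_def)

text \<open>The increment of \<open>R\<close> between \<open>a\<close> and \<open>x\<close> is estimated along the path that changes one coordinate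
  at a time.\<close>

lemma coordinate_path_bound:
  fixes R :: "(nat \<Rightarrow> real) \<Rightarrow> real"
  assumes a: "a \<in> cube d" and x: "x \<in> cube d" and h: "\<And>i. i < d \<Longrightarrow> \<bar>x i - a i\<bar> \<le> h"
    and der: "\<And>i y. i < d \<Longrightarrow> y \<in> cube d \<Longrightarrow> ((\<lambda>t. R (y(i := t))) has_real_derivative R' i y) (at (y i) within {0..1})"
    and bd: "\<And>i y. i < d \<Longrightarrow> y \<in> cube d \<Longrightarrow> (\<And>j. j < d \<Longrightarrow> \<bar>y j - a j\<bar> \<le> h) \<Longrightarrow> \<bar>R' i y\<bar> \<le> B"
    and B: "0 \<le> B"
  shows "\<bar>R x - R a\<bar> \<le> real d * (B * h)"
proof -
  define z where "z m = (\<lambda>j. if j < m then x j else a j)" for m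
  have xa: "x j \<in> {0..1}" "a j \<in> {0..1}" if "j < d" for j
    using PiE_mem[OF a[unfolded cube_def]] PiE_mem[OF x[unfolded cube_def]] that by blast+
  have ext: "x j = undefined" "a j = undefined" if "j \<notin> {..<d}" for j
    using PiE_arb[OF a[unfolded cube_def] that] PiE_arb[OF x[unfolded cube_def] that] by blast+
  have zc: "z m \<in> cube d" if "m \<le> d" for m
    unfolding cube_def
  proof (rule PiE_I)
    fix j assume "j \<in> {..<d}"
    then show "z m j \<in> {0..1}" using xa[of j] by (simp add: z_def)
  next
    fix j assume "j \<notin> {..<d}"
    then show "z m j = undefined" using ext[of j] that by (simp add: z_def)
  qed
  have step: "\<bar>R (z (Suc m)) - R (z m)\<bar> \<le> B * h" if m: "m < d" for m
  proof -
    have zm: "z m \<in> cube d" using zc m by simp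
    have up: "z (Suc m) = (z m)(m := x m)" "z m = (z m)(m := a m)" by (auto simp: z_def fun_eq_iff)
    let ?g = "\<lambda>t. R ((z m)(m := t))"
    let ?S = "closed_segment (a m) (x m)"
    have S: "?S \<subseteq> {0..1}" using xa[OF m] by (auto simp: closed_segment_eq_real_ivl split: if_splits)
    have "norm (?g (x m) - ?g (a m)) \<le> B * norm (x m - a m)"
    proof (rule field_differentiable_bound[where f="?g" and S="?S" and f'="\<lambda>t. R' m ((z m)(m := t))"];
        (rule convex_closed_segment ends_in_segment)?)
      fix t assume t: "t \<in> ?S"
      then have t01: "t \<in> {0..1}" using S by auto
      have y: "(z m)(m := t) \<in> cube d" by (rule cube_upd[OF zm m t01])
      from der[OF m y] have "(?g has_real_derivative R' m ((z m)(m := t))) (at t within {0..1})" by simp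
      from has_field_derivative_subset[OF this S]
      show "(?g has_field_derivative R' m ((z m)(m := t))) (at t within ?S)" .
      show "norm (R' m ((z m)(m := t))) \<le> B"
        unfolding real_norm_def
      proof (rule bd[OF m y])
        fix j assume j: "j < d"
        have "\<bar>t - a m\<bar> \<le> h" using h[OF m] t by (auto simp: closed_segment_eq_real_ivl split: if_splits)
        moreover have "0 \<le> h" using h[OF j] by linarith
        ultimately show "\<bar>((z m)(m := t)) j - a j\<bar> \<le> h" using h[OF j] by (auto simp: z_def)
      qed
    qed
    also have "\<dots> \<le> B * h" using h[OF m] B by (intro mult_left_mono) auto
    finally have "\<bar>?g (x m) - ?g (a m)\<bar> \<le> B * h" by simp
    moreover have "?g (a m) = R (z m)" by (rule arg_cong[OF up(2)[symmetric]])
    ultimately show ?thesis unfolding up(1) by simp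
  qed
  have "\<bar>R (z m) - R (z 0)\<bar> \<le> real m * (B * h)" if "m \<le> d" for m
    using that
  proof (induction m)
    case (Suc m)
    then have "\<bar>R (z m) - R (z 0)\<bar> \<le> real m * (B * h)" "\<bar>R (z (Suc m)) - R (z m)\<bar> \<le> B * h"
      using step[of m] by auto
    moreover have "real (Suc m) * (B * h) = real m * (B * h) + B * h" by (simp add: distrib_right)
    ultimately show ?case by linarith
  qed simp
  from this[of d] have "\<bar>R (z d) - R (z 0)\<bar> \<le> real d * (B * h)" by simp
  moreover have "z 0 = a" by (simp add: z_def)
  moreover have "z d = x" using ext by (force simp: z_def fun_eq_iff)
  ultimately show ?thesis by simp
qed

lemma taylor_0: "taylor d 0 Df \<gamma> a x = Df \<gamma> a"
proof -
  have "{\<eta>. \<eta> \<in> multi_indices d \<and> order_of d \<eta> \<le> 0} = {\<lambda>_. 0}"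
  proof (rule set_eqI)
    fix \<eta> :: "nat \<Rightarrow> nat"
    show "\<eta> \<in> {\<eta>. \<eta> \<in> multi_indices d \<and> order_of d \<eta> \<le> 0} \<longleftrightarrow> \<eta> \<in> {\<lambda>_. 0}"
      by (auto simp: multi_indices_def order_of_def fun_eq_iff) (metis lessThan_iff linorder_not_le)
  qed
  then show ?thesis by (simp add: taylor_def mfact_def mpow_def)
qed

lemma taylor_center: "taylor d m Df \<gamma> a a = Df \<gamma> a"
proof -
  let ?I = "{\<eta>. \<eta> \<in> multi_indices d \<and> order_of d \<eta> \<le> m}"
  have fin: "finite ?I" using finite_multi_indices by auto
  have z: "(\<lambda>_. 0) \<in> ?I" by (auto simp: multi_indices_def order_of_def)
  have "taylor d m Df \<gamma> a a = (\<Sum>\<eta>\<in>{\<lambda>_. 0}. Df (\<lambda>i. \<gamma> i + \<eta> i) a / mfact d \<eta> * mpow d (\<lambda>i. a i - a i) \<eta>)"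
    unfolding taylor_def
  proof (rule sum.mono_neutral_right[OF fin], use z in simp, intro ballI)
    fix \<eta> assume e: "\<eta> \<in> ?I - {\<lambda>_. 0}"
    then obtain i where i: "\<eta> i \<noteq> 0" by (auto simp: fun_eq_iff)
    have "i < d" by (rule ccontr) (use e i in \<open>auto simp: multi_indices_def\<close>)
    with i have "mpow d (\<lambda>i. a i - a i) \<eta> = 0" by (auto simp: mpow_def)
    then show "Df (\<lambda>i. \<gamma> i + \<eta> i) a / mfact d \<eta> * mpow d (\<lambda>i. a i - a i) \<eta> = 0" by simp
  qed
  then show ?thesis by (simp add: mfact_def mpow_def)
qed

text \<open>Induction over the degree. The remainder vanishes at the centre, and its partial
  derivatives are remainders of one degree less for derivatives of one order more; each passage
  along a coordinate path costs a factor d h. At degree 0 the oscillation of the derivatives of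
  order k is left.\<close>

lemma taylor_remainder:
  assumes pd: "partial_derivs d k f Df" and L: "0 \<le> L" and h: "0 \<le> h"
    and top: "\<And>\<gamma> x y. \<gamma> \<in> multi_indices d \<Longrightarrow> order_of d \<gamma> = k \<Longrightarrow> x \<in> cube d \<Longrightarrow> y \<in> cube d \<Longrightarrow>
       (\<And>j. j < d \<Longrightarrow> \<bar>x j - y j\<bar> \<le> h) \<Longrightarrow> \<bar>Df \<gamma> x - Df \<gamma> y\<bar> \<le> L * h powr s"
    and a: "a \<in> cube d"
  shows "\<gamma> \<in> multi_indices d \<Longrightarrow> order_of d \<gamma> + m = k \<Longrightarrow> x \<in> cube d \<Longrightarrow> (\<And>j. j < d \<Longrightarrow> \<bar>x j - a j\<bar> \<le> h) \<Longrightarrow>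
    \<bar>Df \<gamma> x - taylor d m Df \<gamma> a x\<bar> \<le> (real d * h) ^ m * (L * h powr s)"
proof (induction m arbitrary: \<gamma> x)
  case 0
  then show ?case using top[of \<gamma> x a] a by (simp add: taylor_0)
next
  case (Suc m)
  let ?R = "\<lambda>x. Df \<gamma> x - taylor d (Suc m) Df \<gamma> a x"
  let ?R' = "\<lambda>i x. Df (\<gamma>(i := Suc (\<gamma> i))) x - taylor d m Df (\<gamma>(i := Suc (\<gamma> i))) a x"
  have ord: "order_of d \<gamma> < k" using Suc.prems(2) by simp
  have der: "((\<lambda>t. ?R (y(i := t))) has_real_derivative ?R' i y) (at (y i) within {0..1})"
    if "i < d" "y \<in> cube d" for i y
    using pd that Suc.prems(1) ord unfolding partial_derivs_def
    by (intro DERIV_diff taylor_deriv) auto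
  have "\<bar>?R x - ?R a\<bar> \<le> real d * (((real d * h) ^ m * (L * h powr s)) * h)"
  proof (rule coordinate_path_bound[OF a Suc.prems(3,4) der])
    fix i y assume i: "i < d" and y: "y \<in> cube d" "\<And>j. j < d \<Longrightarrow> \<bar>y j - a j\<bar> \<le> h"
    show "\<bar>?R' i y\<bar> \<le> (real d * h) ^ m * (L * h powr s)"
    proof (rule Suc.IH[of "\<gamma>(i := Suc (\<gamma> i))" y, OF multi_incr[OF i Suc.prems(1)] _ y])
      show "order_of d (\<gamma>(i := Suc (\<gamma> i))) + m = k"
        using order_of_incr[OF i, of \<gamma>] Suc.prems(2) by linarith
    qed
  qed (use L h in auto)
  then show ?case by (simp add: taylor_center mult_ac)
qed

lemma ereal_member_le_sum:
  fixes f :: "'a \<Rightarrow> ereal"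
  assumes "x \<in> A" "finite A" "\<And>y. 0 \<le> f y"
  shows "f x \<le> sum f A"
proof -
  have "f x + 0 \<le> f x + sum f (A - {x})" by (intro add_left_mono sum_nonneg assms(3))
  then show ?thesis using assms by (simp add: sum.remove[of A x])
qed

text \<open>All suprema are nonnegative, so each single one is bounded by the whole sum and hence by
  L. Those of the first sum bound the coefficients, those of the second the oscillation of the top
  derivatives; the powers h^k and h^(\<beta> - k) combine to h^\<beta>.\<close>

lemma holder_ball_taylor:
  assumes f: "f \<in> holder_ball d \<beta> L" and \<beta>: "\<beta> > 0" and d: "d \<ge> 1"
  defines "k \<equiv> nat (\<lceil>\<beta>\<rceil> - 1)"
  obtains c where
    "\<And>a \<eta>. a \<in> cube d \<Longrightarrow> \<eta> \<in> multi_indices d \<Longrightarrow> order_of d \<eta> \<le> k \<Longrightarrow> \<bar>c a \<eta>\<bar> \<le> L"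
    "\<And>a x h. a \<in> cube d \<Longrightarrow> x \<in> cube d \<Longrightarrow> 0 < h \<Longrightarrow> (\<And>j. j < d \<Longrightarrow> \<bar>x j - a j\<bar> \<le> h) \<Longrightarrow>
      \<bar>f x - (\<Sum>\<eta> | \<eta> \<in> multi_indices d \<and> order_of d \<eta> \<le> k. c a \<eta> * mpow d (\<lambda>i. x i - a i) \<eta>)\<bar>
        \<le> real d ^ k * L * h powr \<beta>"
proof -
  let ?I = "{\<gamma>. \<gamma> \<in> multi_indices d \<and> order_of d \<gamma> \<le> k}"
  let ?T = "{\<gamma>. \<gamma> \<in> multi_indices d \<and> order_of d \<gamma> = k}"
  let ?Q = "{(x, y). x \<in> cube d \<and> y \<in> cube d \<and> x \<noteq> y}"
  have finI: "finite ?I" using finite_multi_indices by auto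
  have finT: "finite ?T" by (rule finite_subset[OF _ finI]) auto
  obtain Df where pd: "partial_derivs d k f Df" and
    H: "(\<Sum>\<gamma>\<in>?I. SUP x\<in>cube d. ereal \<bar>Df \<gamma> x\<bar>) +
        (\<Sum>\<gamma>\<in>?T. SUP (x, y)\<in>?Q. ereal (\<bar>Df \<gamma> x - Df \<gamma> y\<bar> / dist_sup d x y powr (\<beta> - real k))) \<le> ereal L"
    using f unfolding holder_ball_def Let_def k_def by auto
  let ?A = "\<lambda>\<gamma>. SUP x\<in>cube d. ereal \<bar>Df \<gamma> x\<bar>"
  let ?B = "\<lambda>\<gamma>. SUP (x, y)\<in>?Q. ereal (\<bar>Df \<gamma> x - Df \<gamma> y\<bar> / dist_sup d x y powr (\<beta> - real k))"
  \<comment> \<open>Two distinct points of the cube show that the set \<open>?Q\<close> is nonempty;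
    an empty supremum would be minus infinity in \<open>ereal\<close>, and the terms
    \<open>?B\<close> could not be bounded below by 0.\<close>
  define o0 where "o0 = (\<lambda>i. if i < d then 0 else undefined :: real)"
  define o1 where "o1 = (\<lambda>i. if i < d then 1 else undefined :: real)"
  have o: "o0 \<in> cube d" "o1 \<in> cube d" unfolding cube_def by (rule PiE_I; simp add: o0_def o1_def)+
  have "o0 0 \<noteq> o1 0" using d by (simp add: o0_def o1_def)
  then have oo: "(o0, o1) \<in> ?Q" using o by auto
  have A0: "0 \<le> ?A \<gamma>" for \<gamma> by (rule SUP_upper2[OF o(1)]) simp
  have B0: "0 \<le> ?B \<gamma>" for \<gamma> by (rule SUP_upper2[OF oo]) simp
  have Bsum: "0 \<le> (\<Sum>\<gamma>\<in>?T. ?B \<gamma>)" by (rule sum_nonneg) (rule B0)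
  have Asum: "0 \<le> (\<Sum>\<gamma>\<in>?I. ?A \<gamma>)" by (rule sum_nonneg) (rule A0)
  have AL: "\<bar>Df \<gamma> x\<bar> \<le> L" if "\<gamma> \<in> ?I" "x \<in> cube d" for \<gamma> x
  proof -
    have "ereal \<bar>Df \<gamma> x\<bar> \<le> ?A \<gamma>" by (rule SUP_upper[OF that(2)])
    also have "\<dots> \<le> (\<Sum>\<gamma>\<in>?I. ?A \<gamma>)" by (rule ereal_member_le_sum[OF that(1) finI A0])
    also have "\<dots> \<le> (\<Sum>\<gamma>\<in>?I. ?A \<gamma>) + (\<Sum>\<gamma>\<in>?T. ?B \<gamma>)" by (rule ereal_le_add_self[OF Bsum])
    also have "\<dots> \<le> ereal L" by (rule H)
    finally show ?thesis by simp
  qed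
  have BL: "\<bar>Df \<gamma> x - Df \<gamma> y\<bar> / dist_sup d x y powr (\<beta> - real k) \<le> L"
    if "\<gamma> \<in> ?T" "(x, y) \<in> ?Q" for \<gamma> x y
  proof -
    have "ereal (\<bar>Df \<gamma> x - Df \<gamma> y\<bar> / dist_sup d x y powr (\<beta> - real k)) \<le> ?B \<gamma>"
      using SUP_upper[OF that(2), of "\<lambda>(x, y). ereal (\<bar>Df \<gamma> x - Df \<gamma> y\<bar> / dist_sup d x y powr (\<beta> - real k))"] by simp
    also have "\<dots> \<le> (\<Sum>\<gamma>\<in>?T. ?B \<gamma>)" by (rule ereal_member_le_sum[OF that(1) finT B0])
    also have "\<dots> \<le> (\<Sum>\<gamma>\<in>?I. ?A \<gamma>) + (\<Sum>\<gamma>\<in>?T. ?B \<gamma>)" by (rule ereal_le_add_self2[OF Asum])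
    also have "\<dots> \<le> ereal L" by (rule H)
    finally show ?thesis by simp
  qed
  have L0: "0 \<le> L"
  proof -
    have "(\<lambda>_. 0) \<in> ?I" by (auto simp: multi_indices_def order_of_def)
    from AL[OF this o(1)] show ?thesis by linarith
  qed
  have bk: "0 < \<beta> - real k" "real k \<ge> 0"
    using \<beta> unfolding k_def by linarith+
  have top: "\<bar>Df \<gamma> x - Df \<gamma> y\<bar> \<le> L * h powr (\<beta> - real k)"
    if g: "\<gamma> \<in> multi_indices d" "order_of d \<gamma> = k" and x: "x \<in> cube d" and y: "y \<in> cube d"
      and h: "\<And>j. j < d \<Longrightarrow> \<bar>x j - y j\<bar> \<le> h" for \<gamma> x y h
  proof (cases "x = y")
    case True
    then show ?thesis using L0 by simp
  next
    case False
    then obtain j where j: "x j \<noteq> y j" by auto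
    \<comment> \<open>Points of the cube agree outside \<open>{..<d}\<close>, where they are
      \<open>undefined\<close>; so distinct points differ in a coordinate that
      \<open>dist_sup\<close> sees.\<close>
    have jd: "j < d"
      using j PiE_arb[OF x[unfolded cube_def], of j] PiE_arb[OF y[unfolded cube_def], of j] by (cases "j < d") auto
    let ?D = "dist_sup d x y"
    have ne: "(\<lambda>i. \<bar>x i - y i\<bar>) ` {..<d} \<noteq> {}" using d by (auto simp: lessThan_empty_iff)
    have "\<bar>x j - y j\<bar> \<le> ?D" unfolding dist_sup_def using jd by (intro Max_ge) auto
    then have D0: "0 < ?D" using j by linarith
    have Dh: "?D \<le> h" unfolding dist_sup_def using h ne by (subst Max_le_iff) auto
    have "\<bar>Df \<gamma> x - Df \<gamma> y\<bar> \<le> L * ?D powr (\<beta> - real k)"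
      using BL[of \<gamma> x y] g x y False D0 by (simp add: divide_le_eq)
    also have "\<dots> \<le> L * h powr (\<beta> - real k)"
      using D0 Dh bk L0 by (intro mult_left_mono powr_mono2) auto
    finally show ?thesis .
  qed
  define c where "c a \<eta> = Df \<eta> a / mfact d \<eta>" for a \<eta>
  show ?thesis
  proof (rule that[of c])
    fix a \<eta> assume "a \<in> cube d" "\<eta> \<in> multi_indices d" "order_of d \<eta> \<le> k"
    then have "\<bar>Df \<eta> a\<bar> \<le> L" using AL by auto
    then have "\<bar>Df \<eta> a\<bar> / mfact d \<eta> \<le> L / 1"
      using mfact_ge_1[of d \<eta>] L0 by (intro frac_le) auto
    then show "\<bar>c a \<eta>\<bar> \<le> L" using mfact_ge_1[of d \<eta>] by (simp add: c_def abs_divide)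
  next
    fix a x h assume a: "a \<in> cube d" and x: "x \<in> cube d" and h: "0 < h" "\<And>j. j < d \<Longrightarrow> \<bar>x j - a j\<bar> \<le> (h::real)"
    have "\<bar>Df (\<lambda>_. 0) x - taylor d k Df (\<lambda>_. 0) a x\<bar> \<le> (real d * h) ^ k * (L * h powr (\<beta> - real k))"
      by (rule taylor_remainder[OF pd L0 less_imp_le[OF h(1)] top a])
        (use x h in \<open>auto simp: multi_indices_def order_of_def\<close>)
    also have "\<dots> = real d ^ k * L * (h ^ k * h powr (\<beta> - real k))" by (simp add: power_mult_distrib)
    also have "h ^ k * h powr (\<beta> - real k) = h powr \<beta>"
      using h(1) by (simp add: powr_realpow[symmetric] powr_add[symmetric])
    finally have "\<bar>Df (\<lambda>_. 0) x - taylor d k Df (\<lambda>_. 0) a x\<bar> \<le> real d ^ k * L * h powr \<beta>" .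
    moreover have "Df (\<lambda>_. 0) x = f x" using pd x by (simp add: partial_derivs_def)
    ultimately show "\<bar>f x - (\<Sum>\<eta>\<in>?I. c a \<eta> * mpow d (\<lambda>i. x i - a i) \<eta>)\<bar> \<le> real d ^ k * L * h powr \<beta>"
      by (simp add: taylor_def c_def)
  qed
qed

subsection \<open>Metric entropy of sparse networks\<close>

lemma relu_lipschitz: "\<bar>relu s - relu t\<bar> \<le> \<bar>s - t\<bar>" by (auto simp: relu_def)

lemma relu_abs_le: "\<bar>relu t\<bar> \<le> \<bar>t\<bar>" by (auto simp: relu_def)

lemma truncate_lipschitz: "\<bar>truncate M s - truncate M t\<bar> \<le> \<bar>s - t\<bar>"
  by (auto simp: truncate_def min_def max_def)

lemma truncate_range: "M \<ge> 0 \<Longrightarrow> truncate M t \<in> {-M..M}"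
  by (auto simp: truncate_def)

lemma relu_measurable[measurable]: "relu \<in> borel_measurable borel"
  unfolding relu_def by measurable

lemma component_measurable: "j < d \<Longrightarrow> (\<lambda>x. x j) \<in> borel_measurable (cube_space d)"
proof -
  assume j: "j < d"
  have "(\<lambda>x. x j) \<in> cube_space d \<rightarrow>\<^sub>M restrict_space borel {0..1::real}"
    unfolding cube_space_def by (rule measurable_component_singleton) (use j in auto)
  then show ?thesis by (simp add: measurable_restrict_space2_iff)
qed

lemma hidden_measurable:
  assumes "p 0 = d"
  shows "i < p l \<Longrightarrow> (\<lambda>x. hidden p W v l x i) \<in> borel_measurable (cube_space d)"
proof (induction l arbitrary: i)
  case 0
  have "(\<lambda>x. x i) \<in> borel_measurable (cube_space d)"
    by (rule component_measurable) (use 0 assms in simp)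
  then show ?case by simp
next
  case (Suc l)
  have [measurable]: "(\<lambda>x. hidden p W v l x j) \<in> borel_measurable (cube_space d)" if "j < p l" for j
    by (rule Suc.IH[OF that])
  have "(\<lambda>x. \<Sum>j<p l. W l i j * hidden p W v l x j) \<in> borel_measurable (cube_space d)"
    by (rule borel_measurable_sum) auto
  then show ?case by simp
qed

lemma network_measurable:
  assumes "p 0 = d"
  shows "(\<lambda>x. truncate M (network L p W v x)) \<in> borel_measurable (cube_space d)"
proof -
  have [measurable]: "(\<lambda>x. hidden p W v L x j) \<in> borel_measurable (cube_space d)" if "j < p L" for j
    by (rule hidden_measurable[OF assms that])
  have "(\<lambda>x. network L p W v x) \<in> borel_measurable (cube_space d)"
    unfolding network_def by (rule borel_measurable_sum) auto
  then show ?thesis unfolding truncate_def by measurable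
qed

section \<open>Dependence of the network output on the parameters\<close>

definition weights_ok :: "nat \<Rightarrow> (nat \<Rightarrow> nat) \<Rightarrow> (nat \<Rightarrow> nat \<Rightarrow> nat \<Rightarrow> real) \<Rightarrow> (nat \<Rightarrow> nat \<Rightarrow> real) \<Rightarrow> bool" where
  "weights_ok L p W v \<longleftrightarrow> (\<forall>l\<le>L. \<forall>i<p (Suc l). \<forall>j<p l. \<bar>W l i j\<bar> \<le> 1) \<and> (\<forall>l\<le>L. \<forall>i<p l. \<bar>v l i\<bar> \<le> 1)"

lemma hidden_bound:
  assumes ok: "weights_ok L p W v" and w: "\<And>l. l \<le> L \<Longrightarrow> p l \<le> w" and p0: "p 0 = d" and x: "x \<in> cube d"
  shows "l \<le> L \<Longrightarrow> i < p l \<Longrightarrow> \<bar>hidden p W v l x i\<bar> \<le> (real w + 1) ^ l"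
proof (induction l arbitrary: i)
  case 0
  then show ?case using x p0 by (auto simp: cube_def PiE_iff)
next
  case (Suc l)
  have "\<bar>hidden p W v (Suc l) x i\<bar> \<le> \<bar>(\<Sum>j<p l. W l i j * hidden p W v l x j) - v (Suc l) i\<bar>"
    by (simp add: relu_abs_le)
  also have "\<dots> \<le> (\<Sum>j<p l. \<bar>W l i j * hidden p W v l x j\<bar>) + \<bar>v (Suc l) i\<bar>"
    using sum_abs[of "\<lambda>j. W l i j * hidden p W v l x j" "{..<p l}"] by linarith
  also have "(\<Sum>j<p l. \<bar>W l i j * hidden p W v l x j\<bar>) \<le> (\<Sum>j<p l. (real w + 1) ^ l)"
  proof (rule sum_mono)
    fix j assume j: "j \<in> {..<p l}"
    have "\<bar>W l i j\<bar> \<le> 1" using ok Suc.prems j by (auto simp: weights_ok_def)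
    then show "\<bar>W l i j * hidden p W v l x j\<bar> \<le> (real w + 1) ^ l"
      using mult_mono[of "\<bar>W l i j\<bar>" 1 "\<bar>hidden p W v l x j\<bar>" "(real w + 1) ^ l"] Suc j by (auto simp: abs_mult)
  qed
  also have "\<dots> \<le> real w * (real w + 1) ^ l" using w[of l] Suc.prems by (auto intro!: mult_right_mono)
  also have "\<bar>v (Suc l) i\<bar> \<le> (real w + 1) ^ l"
    using ok Suc.prems by (intro order_trans[OF _ one_le_power[of "real w + 1" l]]) (auto simp: weights_ok_def)
  finally show ?case by (simp add: algebra_simps)
qed

text \<open>The difference of two products is split into W' times the difference of the previous
  layers and W - W' times the previous layer, which \<open>hidden_bound\<close> controls. The growth
  (w + 1)^l is affordable because only the logarithm of the grid resolution enters the
  entropy.\<close>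

lemma hidden_perturb:
  assumes ok: "weights_ok L p W v" and ok': "weights_ok L p W' v'"
    and w: "\<And>l. l \<le> L \<Longrightarrow> p l \<le> w" and p0: "p 0 = d" and x: "x \<in> cube d"
    and dW: "\<And>l i j. l \<le> L \<Longrightarrow> i < p (Suc l) \<Longrightarrow> j < p l \<Longrightarrow> \<bar>W l i j - W' l i j\<bar> \<le> \<delta>"
    and dv: "\<And>l i. l \<le> L \<Longrightarrow> i < p l \<Longrightarrow> \<bar>v l i - v' l i\<bar> \<le> \<delta>" and \<delta>: "0 \<le> \<delta>"
  shows "l \<le> L \<Longrightarrow> i < p l \<Longrightarrow> \<bar>hidden p W v l x i - hidden p W' v' l x i\<bar> \<le> real l * \<delta> * (real w + 1) ^ l"
proof (induction l arbitrary: i)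
  case 0
  then show ?case by simp
next
  case (Suc l)
  let ?h = "hidden p W v l x" and ?h' = "hidden p W' v' l x" and ?w = "(real w + 1) ^ l"
  have "\<bar>hidden p W v (Suc l) x i - hidden p W' v' (Suc l) x i\<bar>
     \<le> \<bar>((\<Sum>j<p l. W l i j * ?h j) - v (Suc l) i) - ((\<Sum>j<p l. W' l i j * ?h' j) - v' (Suc l) i)\<bar>"
    using relu_lipschitz by simp
  also have "((\<Sum>j<p l. W l i j * ?h j) - v (Suc l) i) - ((\<Sum>j<p l. W' l i j * ?h' j) - v' (Suc l) i)
     = (\<Sum>j<p l. W' l i j * (?h j - ?h' j) + (W l i j - W' l i j) * ?h j) - (v (Suc l) i - v' (Suc l) i)"
    by (simp add: sum_subtractf sum.distrib algebra_simps)
  also have "\<bar>\<dots>\<bar> \<le> (\<Sum>j<p l. \<bar>W' l i j * (?h j - ?h' j) + (W l i j - W' l i j) * ?h j\<bar>) + \<bar>v (Suc l) i - v' (Suc l) i\<bar>"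
    using sum_abs[of "\<lambda>j. W' l i j * (?h j - ?h' j) + (W l i j - W' l i j) * ?h j" "{..<p l}"] by linarith
  also have "(\<Sum>j<p l. \<bar>W' l i j * (?h j - ?h' j) + (W l i j - W' l i j) * ?h j\<bar>)
     \<le> (\<Sum>j<p l. (real l + 1) * \<delta> * ?w)"
  proof (rule sum_mono)
    fix j assume j: "j \<in> {..<p l}"
    have 1: "\<bar>W' l i j\<bar> \<le> 1" using ok' Suc.prems j by (auto simp: weights_ok_def)
    have 2: "\<bar>W l i j - W' l i j\<bar> \<le> \<delta>" using dW Suc.prems j by auto
    have 3: "\<bar>?h j\<bar> \<le> ?w" using hidden_bound[OF ok w p0 x, of l j] Suc.prems j by auto
    have 4: "\<bar>?h j - ?h' j\<bar> \<le> real l * \<delta> * ?w" using Suc.IH[of j] Suc.prems j by auto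
    have "\<bar>W' l i j * (?h j - ?h' j)\<bar> \<le> 1 * (real l * \<delta> * ?w)"
      unfolding abs_mult by (rule mult_mono) (use 1 4 in auto)
    moreover have "\<bar>(W l i j - W' l i j) * ?h j\<bar> \<le> \<delta> * ?w"
      unfolding abs_mult by (rule mult_mono) (use 2 3 \<delta> in auto)
    ultimately show "\<bar>W' l i j * (?h j - ?h' j) + (W l i j - W' l i j) * ?h j\<bar> \<le> (real l + 1) * \<delta> * ?w"
      by (simp add: algebra_simps)
  qed
  also have "\<dots> \<le> real w * ((real l + 1) * \<delta> * ?w)" using w[of l] Suc.prems \<delta> by (auto intro!: mult_right_mono)
  also have "\<bar>v (Suc l) i - v' (Suc l) i\<bar> \<le> (real l + 1) * \<delta> * ?w"
  proof -
    have "\<bar>v (Suc l) i - v' (Suc l) i\<bar> \<le> 1 * \<delta> * 1" using dv Suc.prems by simp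
    also have "\<dots> \<le> (real l + 1) * \<delta> * ?w" by (intro mult_mono) (use \<delta> in auto)
    finally show ?thesis .
  qed
  finally show ?case by (simp add: algebra_simps)
qed

lemma network_perturb:
  assumes ok: "weights_ok L p W v" and ok': "weights_ok L p W' v'"
    and w: "\<And>l. l \<le> L \<Longrightarrow> p l \<le> w" and p0: "p 0 = d" and p1: "0 < p (Suc L)" and x: "x \<in> cube d"
    and dW: "\<And>l i j. l \<le> L \<Longrightarrow> i < p (Suc l) \<Longrightarrow> j < p l \<Longrightarrow> \<bar>W l i j - W' l i j\<bar> \<le> \<delta>"
    and dv: "\<And>l i. l \<le> L \<Longrightarrow> i < p l \<Longrightarrow> \<bar>v l i - v' l i\<bar> \<le> \<delta>" and \<delta>: "0 \<le> \<delta>"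
  shows "\<bar>network L p W v x - network L p W' v' x\<bar> \<le> (real L + 1) * \<delta> * (real w + 1) ^ Suc L"
proof -
  let ?h = "hidden p W v L x" and ?h' = "hidden p W' v' L x" and ?w = "(real w + 1) ^ L"
  have "\<bar>network L p W v x - network L p W' v' x\<bar>
     = \<bar>\<Sum>j<p L. W' L 0 j * (?h j - ?h' j) + (W L 0 j - W' L 0 j) * ?h j\<bar>"
    by (simp add: network_def sum_subtractf sum.distrib algebra_simps)
  also have "\<dots> \<le> (\<Sum>j<p L. \<bar>W' L 0 j * (?h j - ?h' j) + (W L 0 j - W' L 0 j) * ?h j\<bar>)"
    by (rule sum_abs)
  also have "\<dots> \<le> (\<Sum>j<p L. (real L + 1) * \<delta> * ?w)"
  proof (rule sum_mono)
    fix j assume j: "j \<in> {..<p L}"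
    have 1: "\<bar>W' L 0 j\<bar> \<le> 1" using ok'[unfolded weights_ok_def, THEN conjunct1, rule_format, of L 0 j] p1 j by simp
    have 2: "\<bar>W L 0 j - W' L 0 j\<bar> \<le> \<delta>" using dW[of L 0 j] p1 j by simp
    have 3: "\<bar>?h j\<bar> \<le> ?w" using hidden_bound[OF ok w p0 x, of L j] j by auto
    have 4: "\<bar>?h j - ?h' j\<bar> \<le> real L * \<delta> * ?w"
      using hidden_perturb[OF ok ok' w p0 x dW dv \<delta>, of L j] j by auto
    have "\<bar>W' L 0 j * (?h j - ?h' j)\<bar> \<le> 1 * (real L * \<delta> * ?w)"
      unfolding abs_mult by (rule mult_mono) (use 1 4 in auto)
    moreover have "\<bar>(W L 0 j - W' L 0 j) * ?h j\<bar> \<le> \<delta> * ?w"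
      unfolding abs_mult by (rule mult_mono) (use 2 3 \<delta> in auto)
    ultimately show "\<bar>W' L 0 j * (?h j - ?h' j) + (W L 0 j - W' L 0 j) * ?h j\<bar> \<le> (real L + 1) * \<delta> * ?w"
      by (simp add: algebra_simps)
  qed
  also have "\<dots> \<le> (real w + 1) * ((real L + 1) * \<delta> * ?w)"
    using w[of L] \<delta> by (simp, intro mult_right_mono) auto
  finally show ?thesis by (simp add: algebra_simps)
qed

text \<open>A parameter is addressed by \<open>(0, l, i, j)\<close> (weight) or \<open>(1, l, i, 0)\<close> (shift); a sparse
  parameter vector is then a finite set of (address, integer) pairs, in units of the grid width.\<close>

lemma sparse_relu_cover:
  assumes w: "\<And>l. l \<le> L \<Longrightarrow> p l \<le> w" and p0: "p 0 = d" and p1: "p (Suc L) = 1" and M: "M \<ge> 0" and m: "m \<ge> 1"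
    and w1: "w \<ge> 1"
  obtains Net where "finite Net"
    "real (card Net) \<le> (real (2 * (L + 1) * w * w * (2 * m + 1)) + 1) ^ s"
    "\<And>g. g \<in> Net \<Longrightarrow> g \<in> borel_measurable (cube_space d)"
    "\<And>g x. g \<in> Net \<Longrightarrow> g x \<in> {-M..M}"
    "\<And>f. f \<in> sparse_relu L p s M \<Longrightarrow>
       \<exists>g\<in>Net. \<forall>x\<in>cube d. \<bar>f x - g x\<bar> \<le> (real L + 1) * (1 / real m) * (real w + 1) ^ Suc L"
proof -
  define A where "A = {..<2::nat} \<times> {..L} \<times> {..<w} \<times> {..<w}"
  define V where "V = {-int m..int m}"
  define G where "G = A \<times> V"
  have finG: "finite G" by (simp add: G_def A_def V_def)
  have cV: "card V = 2 * m + 1" by (simp add: V_def nat_add_distrib nat_mult_distrib)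
  have cG: "card G = 2 * (L + 1) * w * w * (2 * m + 1)"
    by (simp add: G_def A_def card_cartesian_product cV algebra_simps)
  \<comment> \<open>Addresses without an entry get the value 0. \<open>SOME\<close> settles sets
    with several entries at one address; these merely add functions to the net that are also
    measurable and bounded by M.\<close>
  define val where "val S a = (if \<exists>k. (a, k) \<in> S then real_of_int (SOME k. (a, k) \<in> S) / real m else 0)"
    for S :: "((nat \<times> nat \<times> nat \<times> nat) \<times> int) set" and a
  define fn where "fn S = (\<lambda>x. truncate M (network L p (\<lambda>l i j. val S (0, l, i, j)) (\<lambda>l i. val S (1, l, i, 0)) x))" for S
  \<comment> \<open>\<open>None\<close> pads parameter sets with fewer than s entries, so that the
    count is a plain power.\<close>
  define lists where "lists = {xs :: ((nat \<times> nat \<times> nat \<times> nat) \<times> int) option list. set xs \<subseteq> insert None (Some ` G) \<and> length xs = s}"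
  define Net where "Net = (\<lambda>xs. fn {a. Some a \<in> set xs}) ` lists"
  have finl: "finite lists" unfolding lists_def using finG by (intro finite_lists_length_eq) auto
  have cl: "card lists = (card G + 1) ^ s"
    unfolding lists_def using finG by (subst card_lists_length_eq) (auto simp: card_image card_insert_if)
  have ent: "0 < real m" using m by simp
  show ?thesis
  proof (rule that[of Net])
    show "finite Net" unfolding Net_def using finl by simp
    have "card Net \<le> (card G + 1) ^ s" unfolding Net_def using card_image_le[OF finl] cl by metis
    then have "real (card Net) \<le> real ((card G + 1) ^ s)" by (simp only: of_nat_le_iff)
    then show "real (card Net) \<le> (real (2 * (L + 1) * w * w * (2 * m + 1)) + 1) ^ s"
      unfolding cG by (simp only: of_nat_power of_nat_add of_nat_1)
    fix g assume "g \<in> Net"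
    then obtain S where g: "g = fn S" unfolding Net_def by auto
    show "g \<in> borel_measurable (cube_space d)" unfolding g fn_def by (rule network_measurable) (rule p0)
    show "g x \<in> {-M..M}" for x unfolding g fn_def by (rule truncate_range[OF M])
  next
    fix f assume "f \<in> sparse_relu L p s M"
    then obtain W v where f: "f = (\<lambda>x. truncate M (network L p W v x))"
      and W1: "\<And>l i j. l \<le> L \<Longrightarrow> i < p (Suc l) \<Longrightarrow> j < p l \<Longrightarrow> W l i j \<in> {-1..1}"
      and v1: "\<And>l i. l \<le> L \<Longrightarrow> i < p l \<Longrightarrow> v l i \<in> {-1..1}"
      and sp: "card {(l, i, j). l \<le> L \<and> i < p (Suc l) \<and> j < p l \<and> W l i j \<noteq> 0} +
        card {(l, i). l \<le> L \<and> i < p l \<and> v l i \<noteq> 0} \<le> s"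
      unfolding sparse_relu_def by blast
    \<comment> \<open>Rounding towards zero: the error is at most one grid unit and the modulus does
      not grow.\<close>
    define rnd where "rnd t = (if t \<ge> 0 then \<lfloor>real m * t\<rfloor> else - \<lfloor>real m * (-t)\<rfloor>)" for t :: real
    have rnd: "\<bar>t - real_of_int (rnd t) / real m\<bar> \<le> 1 / real m" "\<bar>real_of_int (rnd t) / real m\<bar> \<le> 1" "rnd t \<in> V"
      if "t \<in> {-1..1}" for t
    proof -
      have *: "\<bar>real m * t - real_of_int (rnd t)\<bar> \<le> 1" unfolding rnd_def by (auto; linarith)
      have "t - real_of_int (rnd t) / real m = (real m * t - real_of_int (rnd t)) / real m"
        using ent by (simp add: field_simps)
      then show "\<bar>t - real_of_int (rnd t) / real m\<bar> \<le> 1 / real m"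
        using * ent by (simp add: abs_divide divide_right_mono)
      have b: "\<bar>real m * t\<bar> \<le> real m" using that ent by (auto simp: abs_mult)
      have **: "\<bar>rnd t\<bar> \<le> int m"
      proof -
        have fl: "\<bar>\<lfloor>u\<rfloor>\<bar> \<le> int m" if "0 \<le> u" "u \<le> real m" for u :: real
          using that by (auto simp: abs_le_iff floor_le_iff)
        show ?thesis
        proof (cases "t \<ge> 0")
          case True
          then show ?thesis using fl[of "real m * t"] b ent by (simp add: rnd_def)
        next
          case False
          then show ?thesis using fl[of "real m * (-t)"] b ent by (simp add: rnd_def mult_le_0_iff)
        qed
      qed
      then show "rnd t \<in> V" by (auto simp: V_def)
      have "\<bar>real_of_int (rnd t)\<bar> \<le> real m" using ** by linarith
      then show "\<bar>real_of_int (rnd t) / real m\<bar> \<le> 1" using ent by (simp add: abs_divide)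
    qed
    define SW where "SW = {(l, i, j). l \<le> L \<and> i < p (Suc l) \<and> j < p l \<and> W l i j \<noteq> 0}"
    define Sv where "Sv = {(l, i). l \<le> L \<and> i < p l \<and> v l i \<noteq> 0}"
    define S where "S = (\<lambda>(l, i, j). ((0::nat, l, i, j), rnd (W l i j))) ` SW \<union> (\<lambda>(l, i). ((1, l, i, 0), rnd (v l i))) ` Sv"
    \<comment> \<open>The output layer has width 1, so \<open>w \<ge> 1\<close> makes its row index
      a valid address as well.\<close>
    have pw: "p (Suc l) \<le> w" if "l \<le> L" for l
      using w[of "Suc l"] w1 p1 that by (cases "l = L") auto
    have SWA: "SW \<subseteq> {..L} \<times> {..<w} \<times> {..<w}" using w pw by (auto simp: SW_def dest: order_less_le_trans)
    have SvA: "Sv \<subseteq> {..L} \<times> {..<w}" using w by (auto simp: Sv_def dest: order_less_le_trans)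
    have finS: "finite SW" "finite Sv" using SWA SvA by (auto intro: finite_subset)
    have SG: "S \<subseteq> G"
    proof -
      have "rnd (W l i j) \<in> V" if "(l, i, j) \<in> SW" for l i j
        using that by (intro rnd(3) W1) (auto simp: SW_def)
      moreover have "rnd (v l i) \<in> V" if "(l, i) \<in> Sv" for l i
        using that by (intro rnd(3) v1) (auto simp: Sv_def)
      ultimately show ?thesis using SWA SvA w1 by (force simp: S_def G_def A_def)
    qed
    have "card S \<le> card SW + card Sv"
      unfolding S_def by (rule order_trans[OF card_Un_le add_mono]) (auto intro!: card_image_le finS)
    then have cS: "card S \<le> s" using sp unfolding SW_def Sv_def by linarith
    have fS: "finite S" using SG finG by (rule finite_subset)
    obtain ys where ys: "set ys = S" "distinct ys" using finite_distinct_list[OF fS] by blast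
    define xs where "xs = map Some ys @ replicate (s - length ys) None"
    have "length ys \<le> s" using ys cS distinct_card by metis
    then have xs: "xs \<in> lists" using SG ys by (auto simp: lists_def xs_def)
    have Sxs: "{a. Some a \<in> set xs} = S" using ys by (auto simp: xs_def)
    have valW: "val S (0, l, i, j) = (if W l i j = 0 then 0 else real_of_int (rnd (W l i j)) / real m)"
      if "l \<le> L" "i < p (Suc l)" "j < p l" for l i j
    proof (cases "W l i j = 0")
      case True
      then have "\<not> (\<exists>k. ((0, l, i, j), k) \<in> S)" by (auto simp: S_def SW_def)
      then show ?thesis using True by (simp add: val_def)
    next
      case False
      then have "((0, l, i, j), k) \<in> S \<longleftrightarrow> k = rnd (W l i j)" for k using that by (force simp: S_def SW_def)
      then show ?thesis using False by (simp add: val_def)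
    qed
    have valv: "val S (1, l, i, 0) = (if v l i = 0 then 0 else real_of_int (rnd (v l i)) / real m)"
      if "l \<le> L" "i < p l" for l i
    proof (cases "v l i = 0")
      case True
      then have "\<not> (\<exists>k. ((1, l, i, 0), k) \<in> S)" by (auto simp: S_def Sv_def)
      then show ?thesis using True by (simp add: val_def)
    next
      case False
      then have "((1, l, i, 0), k) \<in> S \<longleftrightarrow> k = rnd (v l i)" for k using that by (force simp: S_def Sv_def)
      then show ?thesis using False by (simp add: val_def)
    qed
    let ?W = "\<lambda>l i j. val S (0, l, i, j)" and ?v = "\<lambda>l i. val S (1, l, i, 0)"
    have ok: "weights_ok L p W v" using W1 v1 by (fastforce simp: weights_ok_def abs_le_iff)
    have ok': "weights_ok L p ?W ?v"
      unfolding weights_ok_def using rnd(2) W1 v1 by (auto simp: valW valv[unfolded One_nat_def])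
    have "\<bar>f x - fn S x\<bar> \<le> (real L + 1) * (1 / real m) * (real w + 1) ^ Suc L" if x: "x \<in> cube d" for x
    proof -
      have "\<bar>f x - fn S x\<bar> \<le> \<bar>network L p W v x - network L p ?W ?v x\<bar>"
        unfolding f fn_def by (rule truncate_lipschitz)
      also have "\<dots> \<le> (real L + 1) * (1 / real m) * (real w + 1) ^ Suc L"
        by (rule network_perturb[OF ok ok' w p0 _ x]) (use p1 rnd(1) W1 v1 in \<open>auto simp: valW valv[unfolded One_nat_def]\<close>)
      finally show ?thesis .
    qed
    moreover have "fn S \<in> Net" unfolding Net_def using xs Sxs by blast
    ultimately show "\<exists>g\<in>Net. \<forall>x\<in>cube d. \<bar>f x - g x\<bar> \<le> (real L + 1) * (1 / real m) * (real w + 1) ^ Suc L" by blast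
  qed
qed

subsection \<open>Realizing families of functions by network layers\<close>

lemma relu_eq: "0 \<le> t \<Longrightarrow> relu t = t" by (simp add: relu_def)

text \<open>Agrees with \<open>p_SH\<close> up to the last hidden layer but does not mention the
  total depth, so that partial networks can be built before the depth is known.\<close>

definition unif_width :: "nat \<Rightarrow> nat \<Rightarrow> nat \<Rightarrow> nat" where
  "unif_width d w m = (if m = 0 then d else w)"

text \<open>The functions \<open>F i\<close> with \<open>i \<in> I\<close> are computed, on the cube, by distinct neurons of layer \<open>l\<close> of
  a network of width \<open>w\<close> all of whose layers have at most \<open>k\<close> nonzero parameters. Since \<open>F\<close> is a
  family, several neurons may compute the same function.\<close>

definition realizes :: "nat \<Rightarrow> nat \<Rightarrow> nat \<Rightarrow> nat \<Rightarrow> 'i set \<Rightarrow> ('i \<Rightarrow> (nat \<Rightarrow> real) \<Rightarrow> real) \<Rightarrow> bool" where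
  "realizes d w k l I F \<longleftrightarrow> finite I \<and> k \<le> w \<and> (\<exists>W v e.
     (\<forall>m a b. \<bar>W m a b\<bar> \<le> 1) \<and> (\<forall>m a. \<bar>v m a\<bar> \<le> 1) \<and> (\<forall>a. v 0 a = 0) \<and>
     (\<forall>m<l. card {(a, b). a < w \<and> b < unif_width d w m \<and> W m a b \<noteq> 0} +
            card {a. a < w \<and> v (Suc m) a \<noteq> 0} \<le> k) \<and>
     inj_on e I \<and> e ` I \<subseteq> {..<unif_width d w l} \<and>
     (\<forall>x\<in>cube d. \<forall>i\<in>I. F i x = hidden (unif_width d w) W v l x (e i)))"

lemma realizesE:
  assumes "realizes d w k l I F"
  obtains W v e where "finite I" "k \<le> w" "\<forall>m a b. \<bar>W m a b\<bar> \<le> 1" "\<forall>m a. \<bar>v m a\<bar> \<le> 1" "\<forall>a. v 0 a = 0"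
     "\<forall>m<l. card {(a, b). a < w \<and> b < unif_width d w m \<and> W m a b \<noteq> 0} + card {a. a < w \<and> v (Suc m) a \<noteq> 0} \<le> k"
     "inj_on e I" "e ` I \<subseteq> {..<unif_width d w l}"
     "\<forall>x\<in>cube d. \<forall>i\<in>I. F i x = hidden (unif_width d w) W v l x (e i)"
  using assms unfolding realizes_def by (elim conjE exE) (rule that; assumption)

lemma realizesI:
  assumes "finite I" "k \<le> w" "\<forall>m a b. \<bar>W m a b\<bar> \<le> 1" "\<forall>m a. \<bar>v m a\<bar> \<le> 1" "\<forall>a. v 0 a = 0"
     "\<forall>m<l. card {(a, b). a < w \<and> b < unif_width d w m \<and> W m a b \<noteq> 0} + card {a. a < w \<and> v (Suc m) a \<noteq> 0} \<le> k"
     "inj_on e I" "e ` I \<subseteq> {..<unif_width d w l}"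
     "\<forall>x\<in>cube d. \<forall>i\<in>I. F i x = hidden (unif_width d w) W v l x (e i)"
  shows "realizes d w k l I F"
  unfolding realizes_def using assms by (intro conjI exI[of _ W] exI[of _ v] exI[of _ e]) assumption+

lemma realizes_finite: "realizes d w k l I F \<Longrightarrow> finite I"
  by (simp add: realizes_def)

lemma hidden_cong:
  assumes "\<And>m i. m \<le> l \<Longrightarrow> v m i = v' m i" "\<And>m i j. m < l \<Longrightarrow> W m i j = W' m i j"
    and "\<And>m. m < l \<Longrightarrow> p m = p' m"
  shows "hidden p W v l x i = hidden p' W' v' l x i"
  using assms
proof (induction l arbitrary: i)
  case (Suc l)
  have "hidden p W v l x j = hidden p' W' v' l x j" for j by (rule Suc.IH) (use Suc.prems in auto)
  then show ?case using Suc.prems by simp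
qed simp

lemma realizes_inputs: "k \<le> w \<Longrightarrow> realizes d w k 0 {..<d} (\<lambda>i x. x i)"
  unfolding realizes_def
  by (intro conjI exI[of _ "\<lambda>_ _ _. 0"] exI[of _ "\<lambda>_ _. 0"] exI[of _ id]) (auto simp: unif_width_def)

lemma realizes_reindex:
  assumes R: "realizes d w k l I F" and g: "inj_on g J" "g ` J \<subseteq> I"
    and F': "\<And>x j. x \<in> cube d \<Longrightarrow> j \<in> J \<Longrightarrow> F' j x = F (g j) x"
  shows "realizes d w k l J F'"
proof -
  obtain W v e where *: "finite I" "k \<le> w" "\<forall>m a b. \<bar>W m a b\<bar> \<le> 1" "\<forall>m a. \<bar>v m a\<bar> \<le> 1" "\<forall>a. v 0 a = 0"
     "\<forall>m<l. card {(a, b). a < w \<and> b < unif_width d w m \<and> W m a b \<noteq> 0} + card {a. a < w \<and> v (Suc m) a \<noteq> 0} \<le> k"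
     "inj_on e I" "e ` I \<subseteq> {..<unif_width d w l}"
     "\<forall>x\<in>cube d. \<forall>i\<in>I. F i x = hidden (unif_width d w) W v l x (e i)"
    by (rule realizesE[OF R])
  have "finite J" using g *(1) by (meson finite_imageD finite_subset)
  moreover have "inj_on (e \<circ> g) J" by (rule comp_inj_on[OF g(1) inj_on_subset[OF *(7) g(2)]])
  moreover have "(e \<circ> g) ` J \<subseteq> {..<unif_width d w l}" using g(2) *(8) by (auto simp: image_subset_iff)
  moreover have "\<forall>x\<in>cube d. \<forall>j\<in>J. F' j x = hidden (unif_width d w) W v l x ((e \<circ> g) j)"
    using F' g(2) *(9) by (auto simp: image_subset_iff)
  ultimately show ?thesis by (intro realizesI[OF _ *(2-6)])
qed

text \<open>A neuron is charged for its incoming weights and one shift, so the budget k also bounds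
  the number of new neurons, and \<open>k \<le> w\<close> leaves room for them. Only the parameters
  leading into layer l + 1 are replaced, and layer l does not depend on these.\<close>

lemma realizes_step:
  fixes I :: "'i set" and J :: "'j set"
  assumes R: "realizes d w k l I F" and J: "finite J"
    and S: "\<And>j. j \<in> J \<Longrightarrow> S j \<subseteq> I"
    and c: "\<And>j i. j \<in> J \<Longrightarrow> i \<in> S j \<Longrightarrow> \<bar>c j i\<bar> \<le> 1" and b: "\<And>j. j \<in> J \<Longrightarrow> \<bar>b j\<bar> \<le> 1"
    and cost: "(\<Sum>j\<in>J. Suc (card (S j))) \<le> k"
    and F': "\<And>x j. x \<in> cube d \<Longrightarrow> j \<in> J \<Longrightarrow> F' j x = relu ((\<Sum>i\<in>S j. c j i * F i x) - b j)"
  shows "realizes d w k (Suc l) J F'"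
proof -
  let ?p = "unif_width d w"
  obtain W v e where *: "finite I" "k \<le> w" "\<forall>m a b. \<bar>W m a b\<bar> \<le> 1" "\<forall>m a. \<bar>v m a\<bar> \<le> 1" "\<forall>a. v 0 a = 0"
     "\<forall>m<l. card {(a, b). a < w \<and> b < ?p m \<and> W m a b \<noteq> 0} + card {a. a < w \<and> v (Suc m) a \<noteq> 0} \<le> k"
     "inj_on e I" "e ` I \<subseteq> {..<?p l}"
     "\<forall>x\<in>cube d. \<forall>i\<in>I. F i x = hidden ?p W v l x (e i)"
    by (rule realizesE[OF R])
  have "card J \<le> (\<Sum>j\<in>J. Suc (card (S j)))" using sum_mono[of J "\<lambda>_. 1" "\<lambda>j. Suc (card (S j))"] by simp
  then have cJ: "card J \<le> w" using cost *(2) by linarith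
  obtain e' where e': "bij_betw e' J {0..<card J}" using ex_bij_betw_finite_nat[OF J] by blast
  have inj': "inj_on e' J" and im': "e' ` J = {0..<card J}" using e' by (auto simp: bij_betw_def)
  have finS: "finite (S j)" if "j \<in> J" for j using S[OF that] *(1) by (rule finite_subset)
  define Wl where "Wl a b = (if a \<in> e' ` J \<and> b \<in> e ` S (inv_into J e' a)
      then c (inv_into J e' a) (inv_into I e b) else 0)" for a b
  define vl where "vl a = (if a \<in> e' ` J then b (inv_into J e' a) else 0)" for a
  have invJ: "inv_into J e' (e' j) = j" if "j \<in> J" for j using inj' that by (rule inv_into_f_f)
  have Wl: "Wl (e' j) (e i) = (if i \<in> S j then c j i else 0)" if "j \<in> J" "i \<in> I" for i j
  proof -
    have "e i \<in> e ` S j \<longleftrightarrow> i \<in> S j"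
      using *(7) that S[OF that(1)] by (auto dest: inj_onD)
    then show ?thesis using that *(7) by (simp add: Wl_def invJ)
  qed
  have Wl1: "\<bar>Wl a b\<bar> \<le> 1" for a b
  proof (cases "a \<in> e' ` J \<and> b \<in> e ` S (inv_into J e' a)")
    case True
    then obtain j i where "j \<in> J" "a = e' j" "i \<in> S j" "b = e i" by (auto simp: invJ)
    moreover then have "i \<in> I" using S by blast
    ultimately show ?thesis using Wl[of j i] c[of j i] by auto
  qed (auto simp: Wl_def)
  have vl1: "\<bar>vl a\<bar> \<le> 1" for a using b by (auto simp: vl_def invJ)
  define W' where "W' = W(l := Wl)"
  define v' where "v' = v(Suc l := vl)"
  have hid: "hidden ?p W' v' l x i = hidden ?p W v l x i" for x i
    by (rule hidden_cong) (auto simp: W'_def v'_def)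
  have out: "F' j x = hidden ?p W' v' (Suc l) x (e' j)" if x: "x \<in> cube d" and j: "j \<in> J" for x j
  proof -
    have "(\<Sum>b<?p l. Wl (e' j) b * hidden ?p W v l x b) = (\<Sum>b\<in>e ` S j. Wl (e' j) b * hidden ?p W v l x b)"
    proof (rule sum.mono_neutral_right)
      show "e ` S j \<subseteq> {..<?p l}" using S[OF j] *(8) by auto
      show "\<forall>i\<in>{..<?p l} - e ` S j. Wl (e' j) i * hidden ?p W v l x i = 0"
        using j by (auto simp: Wl_def invJ)
    qed simp
    also have "\<dots> = (\<Sum>i\<in>S j. Wl (e' j) (e i) * hidden ?p W v l x (e i))"
      by (subst sum.reindex) (use inj_on_subset[OF *(7) S[OF j]] in auto)
    also have "\<dots> = (\<Sum>i\<in>S j. c j i * F i x)"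
    proof (rule sum.cong[OF refl])
      fix i assume i: "i \<in> S j"
      then have "i \<in> I" using S[OF j] by blast
      then show "Wl (e' j) (e i) * hidden ?p W v l x (e i) = c j i * F i x"
        using Wl[OF j] i x *(9) by simp
    qed
    finally show ?thesis using F'[OF x j] j
      by (simp add: hid) (simp add: W'_def v'_def vl_def invJ)
  qed
  have new: "card {(a, b). a < w \<and> b < ?p l \<and> Wl a b \<noteq> 0} + card {a. a < w \<and> vl a \<noteq> 0} \<le> k"
  proof -
    have "{(a, b). a < w \<and> b < ?p l \<and> Wl a b \<noteq> 0} \<subseteq> (\<lambda>(j, i). (e' j, e i)) ` (SIGMA j:J. S j)"
      by (auto simp: Wl_def invJ image_iff split: if_splits)
    then have "card {(a, b). a < w \<and> b < ?p l \<and> Wl a b \<noteq> 0} \<le> card ((\<lambda>(j, i). (e' j, e i)) ` (SIGMA j:J. S j))"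
      using J finS by (intro card_mono) auto
    also have "\<dots> \<le> card (SIGMA j:J. S j)" using J finS by (intro card_image_le) auto
    also have "\<dots> = (\<Sum>j\<in>J. card (S j))" using J finS by (simp add: card_SigmaI)
    finally have 1: "card {(a, b). a < w \<and> b < ?p l \<and> Wl a b \<noteq> 0} \<le> (\<Sum>j\<in>J. card (S j))" .
    have "{a. a < w \<and> vl a \<noteq> 0} \<subseteq> e' ` J" by (auto simp: vl_def split: if_splits)
    then have "card {a. a < w \<and> vl a \<noteq> 0} \<le> card J"
      using J by (meson card_image_le card_mono finite_imageI order_trans)
    with 1 have "card {(a, b). a < w \<and> b < ?p l \<and> Wl a b \<noteq> 0} + card {a. a < w \<and> vl a \<noteq> 0} \<le> (\<Sum>j\<in>J. Suc (card (S j)))"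
      by (simp add: sum_Suc)
    then show ?thesis using cost by linarith
  qed
  show ?thesis
  proof (rule realizesI[where W=W' and v=v' and e=e'])
    show "\<forall>m<Suc l. card {(a, b). a < w \<and> b < ?p m \<and> W' m a b \<noteq> 0} + card {a. a < w \<and> v' (Suc m) a \<noteq> 0} \<le> k"
    proof (intro allI impI)
      fix m assume "m < Suc l"
      then consider "m < l" | "m = l" by linarith
      then show "card {(a, b). a < w \<and> b < ?p m \<and> W' m a b \<noteq> 0} + card {a. a < w \<and> v' (Suc m) a \<noteq> 0} \<le> k"
      proof cases
        case 1
        then have "W' m = W m" "v' (Suc m) = v (Suc m)" by (auto simp: W'_def v'_def)
        then show ?thesis using *(6) 1 by simp
      next
        case 2
        then have "W' m = Wl" "v' (Suc m) = vl" by (auto simp: W'_def v'_def)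
        then show ?thesis using new 2 by simp
      qed
    qed
    show "e' ` J \<subseteq> {..<?p (Suc l)}" using im' cJ by (auto simp: unif_width_def)
    show "\<forall>x\<in>cube d. \<forall>i\<in>J. F' i x = hidden ?p W' v' (Suc l) x (e' i)" using out by blast
    show "\<forall>m a b. \<bar>W' m a b\<bar> \<le> 1" using Wl1 *(3) by (simp add: W'_def)
    show "\<forall>m a. \<bar>v' m a\<bar> \<le> 1" using vl1 *(4) by (simp add: v'_def)
    show "\<forall>a. v' 0 a = 0" using *(5) by (simp add: v'_def)
  qed (use J *(2) inj' in auto)
qed

text \<open>A ReLU is the identity on nonnegative values. Such identity layers fill up the
  prescribed depth.\<close>

lemma realizes_carry:
  assumes "realizes d w k l I F" "\<And>x i. x \<in> cube d \<Longrightarrow> i \<in> I \<Longrightarrow> 0 \<le> F i x" "2 * card I \<le> k"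
  shows "realizes d w k (l + m) I F"
proof (induction m)
  case (Suc m)
  have "realizes d w k (Suc (l + m)) I F"
    by (rule realizes_step[OF Suc.IH, where S="\<lambda>i. {i}" and c="\<lambda>_ _. 1" and b="\<lambda>_. 0"])
       (use assms realizes_finite[OF Suc.IH] in \<open>auto simp: relu_eq\<close>)
  then show ?case by simp
qed (use assms in simp)

text \<open>With weights bounded by 1, a factor q per layer arises from adding q equal copies. Each
  of the q copies in a layer sums all q copies of the layer before, which costs q (q + 1) parameters
  per function; the first of the layers only creates the copies.\<close>

lemma realizes_amplify:
  assumes R: "realizes d w k l I F" and F: "\<And>x i. x \<in> cube d \<Longrightarrow> i \<in> I \<Longrightarrow> 0 \<le> F i x"
    and q: "q \<ge> 1" and cost: "card I * q * (q + 1) \<le> k"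
  shows "realizes d w k (l + Suc r) (I \<times> {..<q}) (\<lambda>(i, _) x. real q ^ r * F i x)"
proof (induction r)
  case 0
  have fin: "finite I" using R by (rule realizes_finite)
  have "card I * q * 2 \<le> card I * q * (q + 1)" using q by (intro mult_left_mono) auto
  then have c: "card I * q * 2 \<le> k" using cost by linarith
  have "realizes d w k (Suc l) (I \<times> {..<q}) (\<lambda>(i, _) x. real q ^ 0 * F i x)"
    by (rule realizes_step[OF R, where S="\<lambda>(i, _). {i}" and c="\<lambda>_ _. 1" and b="\<lambda>_. 0"])
       (use fin F c in \<open>auto simp: relu_eq card_cartesian_product case_prod_beta algebra_simps\<close>)
  then show ?case by simp
next
  case (Suc r)
  have fin: "finite I" using R by (rule realizes_finite)
  have "realizes d w k (Suc (l + Suc r)) (I \<times> {..<q}) (\<lambda>(i, _) x. real q ^ Suc r * F i x)"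
  proof (rule realizes_step[OF Suc.IH, where S="\<lambda>(i, _). {i} \<times> {..<q}" and c="\<lambda>_ _. 1" and b="\<lambda>_. 0"])
    show "(\<Sum>j\<in>I \<times> {..<q}. Suc (card (case j of (i, _) \<Rightarrow> {i} \<times> {..<q}))) \<le> k"
      using cost by (simp add: case_prod_beta card_cartesian_product mult_ac)
    fix x j assume x: "x \<in> cube d" and j: "j \<in> I \<times> {..<q}"
    obtain i s where ij: "j = (i, s)" "i \<in> I" using j by auto
    have "(\<Sum>i'\<in>{i} \<times> {..<q}. 1 * (case i' of (i, _) \<Rightarrow> \<lambda>x. real q ^ r * F i x) x) = real q ^ Suc r * F i x"
    proof -
      have "(\<Sum>i'\<in>{i} \<times> {..<q}. 1 * (case i' of (i, _) \<Rightarrow> \<lambda>x. real q ^ r * F i x) x)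
        = (\<Sum>i'\<in>{i} \<times> {..<q}. real q ^ r * F i x)" by (rule sum.cong) auto
      then show ?thesis by (simp add: card_cartesian_product)
    qed
    then show "(case j of (i, _) \<Rightarrow> \<lambda>x. real q ^ Suc r * F i x) x =
        relu ((\<Sum>i\<in>(case j of (i, _) \<Rightarrow> {i} \<times> {..<q}). 1 * (case i of (i, _) \<Rightarrow> \<lambda>x. real q ^ r * F i x) x) - 0)"
      using F[OF x ij(2)] by (simp add: ij(1) relu_eq)
  qed (use fin in auto)
  then show ?case by simp
qed

text \<open>Each of the functions \<open>F i\<close> is copied \<open>q\<close> times in front of the output layer, so that arbitrary
  coefficients are possible in the output in spite of the bound on the weights.\<close>

lemma realizes_output:
  fixes E :: "'e set"
  assumes R: "realizes d w k l I F" and F: "\<And>x i. x \<in> cube d \<Longrightarrow> i \<in> I \<Longrightarrow> 0 \<le> F i x"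
    and E: "finite E" "h ` E \<subseteq> I" and q: "q \<ge> 1" "(\<Sum>\<eta>\<in>E. \<bar>\<alpha> \<eta>\<bar>) \<le> real q"
    and cost: "card I * q * (q + 1) \<le> k" and L: "l + 1 \<le> L"
    and p: "p 0 = d" "\<And>m. 1 \<le> m \<Longrightarrow> m \<le> L \<Longrightarrow> p m = w" "p (Suc L) = 1"
    and s: "(L + 1) * k \<le> s"
  shows "\<exists>g\<in>sparse_relu L p s M. \<forall>x\<in>cube d. g x = truncate M (\<Sum>\<eta>\<in>E. \<alpha> \<eta> * F (h \<eta>) x)"
proof -
  have fin: "finite I" using R by (rule realizes_finite)
  let ?J = "I \<times> {..<q}"
  have "realizes d w k (l + Suc 0) ?J (\<lambda>(i, _) x. real q ^ 0 * F i x)"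
    by (rule realizes_amplify[OF R F q(1) cost])
  then have R1: "realizes d w k (l + 1) ?J (\<lambda>(i, _) x. F i x)" by simp
  have c2: "2 * card ?J \<le> k"
  proof -
    have "card I * q * 2 \<le> card I * q * (q + 1)" using q by (intro mult_left_mono) auto
    then have "card I * q * 2 \<le> k" using cost by linarith
    then show ?thesis by (simp add: card_cartesian_product mult_ac)
  qed
  have "realizes d w k (l + 1 + (L - (l + 1))) ?J (\<lambda>(i, _) x. F i x)"
    by (rule realizes_carry[OF R1 _ c2]) (use F in auto)
  then have RL: "realizes d w k L ?J (\<lambda>(i, _) x. F i x)" using L by simp
  obtain W v e where *: "finite ?J" "k \<le> w" "\<forall>m a b. \<bar>W m a b\<bar> \<le> 1" "\<forall>m a. \<bar>v m a\<bar> \<le> 1" "\<forall>a. v 0 a = 0"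
     "\<forall>m<L. card {(a, b). a < w \<and> b < unif_width d w m \<and> W m a b \<noteq> 0} + card {a. a < w \<and> v (Suc m) a \<noteq> 0} \<le> k"
     "inj_on e ?J" "e ` ?J \<subseteq> {..<unif_width d w L}"
     and hid: "\<forall>x\<in>cube d. \<forall>i\<in>?J. (case i of (i, _) \<Rightarrow> \<lambda>x. F i x) x = hidden (unif_width d w) W v L x (e i)"
    by (rule realizesE[OF RL])
  have pu: "unif_width d w m = p m" if "m \<le> L" for m
    using p(1) p(2)[of m] that by (cases m) (auto simp: unif_width_def)
  \<comment> \<open>Several \<open>\<eta>\<close> may share a neuron, so their coefficients are
    collected. The division by q is undone by the q copies in the output sum.\<close>
  define a where "a i = (\<Sum>\<eta>\<in>{\<eta>\<in>E. h \<eta> = i}. \<alpha> \<eta>) / real q" for i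
  have a1: "\<bar>a i\<bar> \<le> 1" for i
  proof -
    have "\<bar>\<Sum>\<eta>\<in>{\<eta>\<in>E. h \<eta> = i}. \<alpha> \<eta>\<bar> \<le> (\<Sum>\<eta>\<in>{\<eta>\<in>E. h \<eta> = i}. \<bar>\<alpha> \<eta>\<bar>)" by (rule sum_abs)
    also have "\<dots> \<le> (\<Sum>\<eta>\<in>E. \<bar>\<alpha> \<eta>\<bar>)" by (rule sum_mono2) (use E in auto)
    also note q(2)
    finally show ?thesis using q(1) by (simp add: a_def)
  qed
  define Wl where "Wl i b = (if i = 0 \<and> b \<in> e ` ?J then a (fst (inv_into ?J e b)) else 0)" for i b :: nat
  define W' where "W' = W(L := Wl)"
  have Wl1: "\<bar>Wl i b\<bar> \<le> 1" for i b using a1 by (simp add: Wl_def)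
  have out: "network L p W' v x = (\<Sum>\<eta>\<in>E. \<alpha> \<eta> * F (h \<eta>) x)" if x: "x \<in> cube d" for x
  proof -
    have h: "hidden p W' v L x j = hidden (unif_width d w) W v L x j" for j
      by (rule hidden_cong) (auto simp: W'_def pu)
    have "network L p W' v x = (\<Sum>j<p L. Wl 0 j * hidden (unif_width d w) W v L x j)"
      by (simp add: network_def h) (simp add: W'_def)
    also have "\<dots> = (\<Sum>j\<in>e ` ?J. Wl 0 j * hidden (unif_width d w) W v L x j)"
      by (rule sum.mono_neutral_right) (use *(8) pu[of L] in \<open>auto simp: Wl_def\<close>)
    also have "\<dots> = (\<Sum>i\<in>?J. Wl 0 (e i) * hidden (unif_width d w) W v L x (e i))"
      by (subst sum.reindex[OF *(7)]) simp
    also have "\<dots> = (\<Sum>i\<in>?J. a (fst i) * F (fst i) x)"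
    proof (rule sum.cong[OF refl])
      fix i assume i: "i \<in> ?J"
      have "F (fst i) x = hidden (unif_width d w) W v L x (e i)"
        using hid x i by (auto simp: case_prod_beta)
      then show "Wl 0 (e i) * hidden (unif_width d w) W v L x (e i) = a (fst i) * F (fst i) x"
        using i by (simp add: Wl_def inv_into_f_f[OF *(7)])
    qed
    also have "\<dots> = (\<Sum>i\<in>I. \<Sum>r<q. a i * F i x)"
      unfolding sum.cartesian_product by (simp add: case_prod_beta)
    also have "\<dots> = (\<Sum>i\<in>I. \<Sum>\<eta>\<in>{\<eta>\<in>E. h \<eta> = i}. \<alpha> \<eta> * F (h \<eta>) x)"
    proof (rule sum.cong[OF refl])
      fix i
      have "(\<Sum>\<eta>\<in>{\<eta>\<in>E. h \<eta> = i}. \<alpha> \<eta> * F (h \<eta>) x) = (\<Sum>\<eta>\<in>{\<eta>\<in>E. h \<eta> = i}. \<alpha> \<eta> * F i x)"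
        by (rule sum.cong) auto
      then show "(\<Sum>r<q. a i * F i x) = (\<Sum>\<eta>\<in>{\<eta>\<in>E. h \<eta> = i}. \<alpha> \<eta> * F (h \<eta>) x)"
        using q(1) by (simp add: a_def sum_distrib_right)
    qed
    also have "\<dots> = (\<Sum>\<eta>\<in>E. \<alpha> \<eta> * F (h \<eta>) x)" by (rule sum.group[OF E(1) fin E(2)])
    finally show ?thesis .
  qed
  have Lpos: "0 < L" using L by simp
  have nnz: "card {(l, i, j). l \<le> L \<and> i < p (Suc l) \<and> j < p l \<and> W' l i j \<noteq> 0} +
        card {(l, i). l \<le> L \<and> i < p l \<and> v l i \<noteq> 0} \<le> s"
  proof -
    let ?A = "\<lambda>l. {(i, j). i < p (Suc l) \<and> j < p l \<and> W' l i j \<noteq> 0}"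
    let ?B = "\<lambda>l. {i. i < p l \<and> v l i \<noteq> 0}"
    have fA: "finite (?A l)" for l by (rule finite_subset[of _ "{..<p (Suc l)} \<times> {..<p l}"]) auto
    have "{(l, i, j). l \<le> L \<and> i < p (Suc l) \<and> j < p l \<and> W' l i j \<noteq> 0} = (SIGMA l:{..L}. ?A l)" by auto
    then have 1: "card {(l, i, j). l \<le> L \<and> i < p (Suc l) \<and> j < p l \<and> W' l i j \<noteq> 0} = (\<Sum>l\<le>L. card (?A l))"
      using fA by (simp add: card_SigmaI)
    have "{(l, i). l \<le> L \<and> i < p l \<and> v l i \<noteq> 0} = (SIGMA l:{..L}. ?B l)" by auto
    then have "card {(l, i). l \<le> L \<and> i < p l \<and> v l i \<noteq> 0} = (\<Sum>l\<le>L. card (?B l))"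
      by (simp add: card_SigmaI)
    \<comment> \<open>Layer 0 has zero shifts, so the shifts of layer l + 1 can be charged together
      with the weights leading into it, as in \<open>realizes\<close>.\<close>
    also have "\<dots> = (\<Sum>l<L. card (?B (Suc l)))"
      using *(5) by (subst sum.atMost_shift) auto
    finally have 2: "card {(l, i). l \<le> L \<and> i < p l \<and> v l i \<noteq> 0} = (\<Sum>l<L. card (?B (Suc l)))" .
    have 3: "card (?A l) + card (?B (Suc l)) \<le> k" if "l < L" for l
      using *(6)[rule_format, OF that] that pu[of l] p(2)[of "Suc l"] by (simp add: W'_def)
    have "?A L \<subseteq> {0} \<times> e ` ?J" using p(3) by (auto simp: W'_def Wl_def split: if_splits)
    then have "card (?A L) \<le> card ({0::nat} \<times> e ` ?J)" using *(1) by (intro card_mono) auto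
    also have "\<dots> \<le> card ?J" using card_image_le[OF *(1), of e] by (simp add: card_cartesian_product)
    also have "\<dots> \<le> k" using c2 by linarith
    finally have 4: "card (?A L) \<le> k" .
    have "(\<Sum>l\<le>L. card (?A l)) + (\<Sum>l<L. card (?B (Suc l))) = (\<Sum>l<L. card (?A l) + card (?B (Suc l))) + card (?A L)"
      by (simp add: lessThan_Suc_atMost[symmetric] sum.distrib)
    also have "\<dots> \<le> (\<Sum>l<L. k) + k" using 3 4 by (intro add_mono sum_mono) auto
    also have "\<dots> \<le> s" using s by simp
    finally show ?thesis using 1 2 by simp
  qed
  show ?thesis
  proof (rule bexI)
    show "\<forall>x\<in>cube d. truncate M (network L p W' v x) = truncate M (\<Sum>\<eta>\<in>E. \<alpha> \<eta> * F (h \<eta>) x)"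
      using out by simp
    have "\<forall>l i j. W' l i j \<in> {-1..1}" using *(3) Wl1 by (auto simp: W'_def abs_le_iff minus_le_iff)
    moreover have "\<forall>l i. v l i \<in> {-1..1}" using *(4) by (auto simp: abs_le_iff minus_le_iff)
    ultimately show "(\<lambda>x. truncate M (network L p W' v x)) \<in> sparse_relu L p s M"
      unfolding sparse_relu_def using nnz *(5) by blast
  qed
qed

subsection \<open>Multiplication\<close>

definition tent :: "real \<Rightarrow> real" where
  "tent y = min (2 * y) (2 - 2 * y)"

text \<open>For s \<ge> 1 these are the terms of the series of t (1 - t) in iterates of the tent
  map, with weights 4^(-s).\<close>

definition saw :: "nat \<Rightarrow> real \<Rightarrow> real" where
  "saw s t = (tent ^^ s) t / 4 ^ s"

definition saw_sum :: "nat \<Rightarrow> real \<Rightarrow> real" where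
  "saw_sum s t = (\<Sum>\<sigma>=1..<s. saw \<sigma> t)"

lemma tent_range: "t \<in> {0..1} \<Longrightarrow> tent t \<in> {0..1}"
  by (auto simp: tent_def min_def)

lemma tent_pow_range: "t \<in> {0..1} \<Longrightarrow> (tent ^^ s) t \<in> {0..1}"
  by (induction s) (use tent_range in auto)

lemma saw_0: "saw 0 t = t" by (simp add: saw_def)

lemma saw_nonneg: "t \<in> {0..1} \<Longrightarrow> 0 \<le> saw s t"
  using tent_pow_range[of t s] by (simp add: saw_def)

text \<open>This is tent y = 2 y - 4 relu (y - 1/2) divided by 4^(s + 1). Carrying the factor 4^(-s)
  along turns the coefficients 2 and 4 into 1/2 and 1, which the bound on the weights
  permits.\<close>

lemma saw_Suc:
  assumes "t \<in> {0..1}"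
  shows "saw (Suc s) t = saw s t / 2 - relu (saw s t - 2 / 4 ^ Suc s)"
proof -
  define y where "y = (tent ^^ s) t"
  have e: "saw (Suc s) t = tent y / 4 ^ Suc s" "saw s t = 4 * y / 4 ^ Suc s"
    by (simp_all add: saw_def y_def)
  show ?thesis unfolding e relu_def tent_def
    by (cases "y \<le> 1/2") (auto simp: min_def max_def field_simps)
qed

lemma saw_sum_Suc: "saw_sum (Suc s) t = saw_sum s t + (if s = 0 then 0 else saw s t)"
  by (simp add: saw_sum_def)

text \<open>The function \<open>g t = t (1 - t)\<close> satisfies \<open>g t = (tent t + g (tent t)) / 4\<close>.\<close>

lemma saw_sum_error:
  "t * (1 - t) = saw_sum (Suc m) t + (tent ^^ m) t * (1 - (tent ^^ m) t) / 4 ^ m"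
proof (induction m)
  case 0
  then show ?case by (simp add: saw_sum_def)
next
  case (Suc m)
  have g: "y * (1 - y) = (tent y + tent y * (1 - tent y)) / 4" for y
    by (simp add: tent_def min_def field_simps)
  show ?case
    by (subst Suc.IH, subst g) (simp add: saw_sum_Suc[of "Suc m"] saw_def field_simps)
qed

text \<open>The first two bounds let both \<open>saw_sum\<close> and t - \<open>saw_sum\<close> pass
  through a ReLU unchanged; the last two give a one-sided error.\<close>

lemma saw_sum_bounds:
  assumes t: "t \<in> {0..1}"
  shows "0 \<le> saw_sum s t" "saw_sum s t \<le> t"
    "0 \<le> t * (1 - t) - saw_sum (Suc m) t" "t * (1 - t) - saw_sum (Suc m) t \<le> 1 / 4 ^ m"
proof -
  show nn: "0 \<le> saw_sum s t" for s unfolding saw_sum_def by (intro sum_nonneg saw_nonneg[OF t])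
  have y: "(tent ^^ m) t \<in> {0..1}" for m by (rule tent_pow_range[OF t])
  have q: "0 \<le> y * (1 - y)" "y * (1 - y) \<le> 1" if "y \<in> {0..1}" for y :: real
    using that by (auto intro: mult_le_one)
  show 1: "0 \<le> t * (1 - t) - saw_sum (Suc m) t" for m
    using saw_sum_error[of t m] q(1)[OF y[of m]] by simp
  show "t * (1 - t) - saw_sum (Suc m) t \<le> 1 / 4 ^ m"
    using saw_sum_error[of t m] q(2)[OF y[of m]] by (simp add: divide_right_mono)
  have "t * (1 - t) \<le> t" using t by (simp add: mult_left_le)
  then show "saw_sum s t \<le> t"
    using 1[of "s - 1"] t by (cases s) (auto simp: saw_sum_def)
qed

text \<open>Arguments of the polarization identity u v = g ((u - v + 1) / 2) - g ((u + v) / 2) + (u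
  + v) / 2 - 1/4 with g t = t (1 - t). The shift by 1/2 keeps the difference in [0,1].\<close>

definition pair_arg :: "bool \<Rightarrow> real \<Rightarrow> real \<Rightarrow> real" where
  "pair_arg b u v = (if b then u / 2 + v / 2 else u / 2 - v / 2 + 1 / 2)"

lemma pair_arg_range: "u \<in> {0..1} \<Longrightarrow> v \<in> {0..1} \<Longrightarrow> pair_arg b u v \<in> {0..1}"
  by (auto simp: pair_arg_def)

text \<open>State of the squaring iteration after \<open>s\<close> steps, with argument \<open>t\<close>: components 0 and 1 have
  difference \<open>saw s t\<close> and component 2 accumulates \<open>saw_sum s t\<close> (for \<open>b = False\<close>) or
  \<open>t - saw_sum s t\<close> (for \<open>b = True\<close>).\<close>

definition sq_state :: "nat \<Rightarrow> bool \<Rightarrow> nat \<Rightarrow> real \<Rightarrow> real" where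
  "sq_state s b c t =
    (if c = 0 then (case s of 0 \<Rightarrow> t | Suc s' \<Rightarrow> saw s' t / 2)
     else if c = 1 then (case s of 0 \<Rightarrow> 0 | Suc s' \<Rightarrow> relu (saw s' t - 2 / 4 ^ s))
     else if b then t - saw_sum s t else saw_sum s t)"

lemma sq_state_diff: "t \<in> {0..1} \<Longrightarrow> sq_state s b 0 t - sq_state s b 1 t = saw s t"
  by (cases s) (simp_all add: sq_state_def saw_0 saw_Suc)

text \<open>For i = j the index set collapses to one element and the coefficients add up, so squares
  need no separate treatment.\<close>

lemma sum_pair_coeff:
  fixes f :: "'i \<Rightarrow> real"
  shows "(\<Sum>i'\<in>{i, j}. ((if i' = i then a else 0) + (if i' = j then b else 0)) * f i') = a * f i + b * f j"
  by (cases "i = j") (auto simp: algebra_simps)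

text \<open>Each ordered pair has two arguments with three state components, and a neuron has at
  most three incoming weights and a shift: 6 * 4 = 24 parameters per pair.\<close>

lemma realizes_sq_states:
  fixes I :: "'i set"
  assumes R: "realizes d w k l I F" and F: "\<And>x i. x \<in> cube d \<Longrightarrow> i \<in> I \<Longrightarrow> F i x \<in> {0..1}"
    and cost: "24 * (card I * card I) \<le> k"
  shows "realizes d w k (l + Suc s) ((I \<times> I) \<times> UNIV \<times> {..<3})
    (\<lambda>((i, j), b, c) x. sq_state s b c (pair_arg b (F i x) (F j x)))"
proof (induction s)
  case 0
  have fin: "finite I" using R by (rule realizes_finite)
  let ?S = "\<lambda>((i, j), b, c::nat). if c = 1 \<or> (c = 2 \<and> \<not> b) then {} else {i, j :: 'i}"
  let ?c = "\<lambda>((i :: 'i, j :: 'i), b :: bool, c :: nat) i'. (if i' = i then 1/2 else 0) + (if i' = j then (if b then 1/2 else -1/2) else 0) :: real"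
  let ?b = "\<lambda>((i :: 'i, j :: 'i), b :: bool, c :: nat). if c = 1 \<or> b \<or> c = 2 then 0 else -1/2 :: real"
  have main: "(\<lambda>((i, j), b, c) x. sq_state 0 b c (pair_arg b (F i x) (F j x))) jj x =
      relu ((\<Sum>i'\<in>?S jj. ?c jj i' * F i' x) - ?b jj)"
    if x: "x \<in> cube d" and jj: "jj \<in> (I \<times> I) \<times> UNIV \<times> {..<3}" for x and jj :: "('i \<times> 'i) \<times> bool \<times> nat"
  proof -
    obtain i j b c where e: "jj = ((i, j), b, c)" by (metis prod.exhaust)
    have ij: "i \<in> I" "j \<in> I" "c < 3" using jj e by auto
    have r: "pair_arg b (F i x) (F j x) \<in> {0..1}" by (intro pair_arg_range F x ij)
    have c3: "c = 0 \<or> c = 1 \<or> c = 2" using ij(3) by linarith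
    show ?thesis
    proof (cases "c = 1 \<or> (c = 2 \<and> \<not> b)")
      case True
      then show ?thesis by (auto simp: e sq_state_def saw_sum_def relu_def)
    next
      case False
      have "sq_state 0 b c (pair_arg b (F i x) (F j x))
        = relu (1/2 * F i x + (if b then 1/2 else -1/2) * F j x - (if c = 1 \<or> b \<or> c = 2 then 0 else -1/2))"
        using False c3 r by (auto simp: sq_state_def saw_sum_def pair_arg_def relu_def)
      then show ?thesis unfolding e prod.case if_not_P[OF False] sum_pair_coeff .
    qed
  qed
  have "realizes d w k (Suc l) ((I \<times> I) \<times> UNIV \<times> {..<3})
    (\<lambda>((i, j), b, c) x. sq_state 0 b c (pair_arg b (F i x) (F j x)))"
  proof (rule realizes_step[OF R, where S="?S" and c="?c" and b="?b"])
    have "card (?S j) \<le> 3" for j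
      by (auto simp: case_prod_beta card_insert_if)
    then have "(\<Sum>j\<in>(I \<times> I) \<times> UNIV \<times> {..<3}. Suc (card (?S j))) \<le> (\<Sum>j\<in>(I \<times> I) \<times> (UNIV::bool set) \<times> {..<3::nat}. 4)"
      by (intro sum_mono) auto
    also have "\<dots> = 24 * (card I * card I)" by (simp add: card_cartesian_product)
    finally show "(\<Sum>j\<in>(I \<times> I) \<times> UNIV \<times> {..<3}. Suc (card (?S j))) \<le> k" using cost by linarith
  next
    fix x and jj :: "('i \<times> 'i) \<times> bool \<times> nat" assume "x \<in> cube d" "jj \<in> (I \<times> I) \<times> UNIV \<times> {..<3}"
    then show "(\<lambda>((i, j), b, c) x. sq_state 0 b c (pair_arg b (F i x) (F j x))) jj x =
      relu ((\<Sum>i'\<in>?S jj. ?c jj i' * F i' x) - ?b jj)" by (rule main)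
  next
    show "finite ((I \<times> I) \<times> (UNIV :: bool set) \<times> {..<3::nat})" using fin by simp
  next
    fix jj assume "jj \<in> (I \<times> I) \<times> (UNIV :: bool set) \<times> {..<3::nat}"
    then show "?S jj \<subseteq> I" by (cases jj) (auto split: if_splits)
    show "\<bar>?b jj\<bar> \<le> 1" by (auto simp: case_prod_beta)
    show "\<bar>?c jj i\<bar> \<le> 1" for i by (auto simp: case_prod_beta)
  qed
  then show ?case by simp
next
  case (Suc s)
  have fin: "finite I" using R by (rule realizes_finite)
  let ?J = "(I \<times> I) \<times> (UNIV::bool set) \<times> {..<3::nat}"
  let ?S = "\<lambda>(p, b, c::nat). if c = 2 then {(p, b, 0), (p, b, 1), (p, b, 2)} else {(p, b, 0), (p, b, 1::nat)} :: (('i \<times> 'i) \<times> bool \<times> nat) set"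
  \<comment> \<open>\<open>saw_sum\<close> starts at index 1, so \<open>saw 0\<close> is not
    accumulated. The sign is negative for \<open>b = True\<close>, where the accumulator holds t -
    \<open>saw_sum\<close>.\<close>
  let ?\<kappa> = "\<lambda>b::bool. if s = 0 then 0 else if b then -1 else 1 :: real"
  let ?c = "\<lambda>(p :: 'i \<times> 'i, b::bool, c::nat) (p' :: 'i \<times> 'i, b' :: bool, c' :: nat). if c' = 2 then 1 else
     (if c' = 0 then 1 else -1) * (if c = 0 then 1/2 else if c = 1 then 1 else ?\<kappa> b) :: real"
  let ?b = "\<lambda>(p :: 'i \<times> 'i, b::bool, c::nat). if c = 1 then 2 / 4 ^ Suc s else 0 :: real"
  have "realizes d w k (Suc (l + Suc s)) ?J (\<lambda>((i, j), b, c) x. sq_state (Suc s) b c (pair_arg b (F i x) (F j x)))"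
  proof (rule realizes_step[OF Suc.IH, where S="?S" and c="?c" and b="?b"])
    have "card (?S j) \<le> 3" for j
      by (auto simp: case_prod_beta card_insert_if)
    then have "(\<Sum>j\<in>?J. Suc (card (?S j))) \<le> (\<Sum>j\<in>?J. 4)"
      by (intro sum_mono) auto
    also have "\<dots> = 24 * (card I * card I)" by (simp add: card_cartesian_product)
    finally show "(\<Sum>j\<in>?J. Suc (card (?S j))) \<le> k" using cost by linarith
  next
    fix jj assume "jj \<in> ?J"
    have "1 \<le> (4::real) ^ s" by simp
    then have "2 \<le> (4::real) ^ Suc s" unfolding power_Suc by linarith
    then have "2 / 4 ^ Suc s \<le> (1::real)" by (simp only: divide_le_eq_1) simp
    then show "\<bar>?b jj\<bar> \<le> 1" by (auto simp: case_prod_beta)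
  next
    fix x and jj :: "('i \<times> 'i) \<times> bool \<times> nat" assume x: "x \<in> cube d" and jj: "jj \<in> ?J"
    obtain i j b c where e: "jj = ((i, j), b, c)" by (metis prod.exhaust)
    have ij: "i \<in> I" "j \<in> I" "c < 3" using jj e by auto
    define t where "t = pair_arg b (F i x) (F j x)"
    have t: "t \<in> {0..1}" unfolding t_def by (intro pair_arg_range F x ij)
    have c3: "c = 0 \<or> c = 1 \<or> c = 2" using ij(3) by linarith
    let ?V = "\<lambda>jj. (\<lambda>((i, j), b, c) x. sq_state s b c (pair_arg b (F i x) (F j x))) jj x"
    have V: "?V ((i, j), b, c) = sq_state s b c t" for c by (simp add: t_def)
    have sm: "(\<Sum>i'\<in>?S jj. ?c jj i' * ?V i')
       = (if c = 2 then sq_state s b 2 t else 0) + (sq_state s b 0 t - sq_state s b 1 t) * (if c = 0 then 1/2 else if c = 1 then 1 else ?\<kappa> b)"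
      unfolding e by (simp add: t_def[symmetric] algebra_simps)
    have sm': "(\<Sum>i'\<in>?S jj. ?c jj i' * ?V i') = (if c = 2 then sq_state s b 2 t else 0) + saw s t * (if c = 0 then 1/2 else if c = 1 then 1 else ?\<kappa> b)"
      unfolding sm sq_state_diff[OF t] ..
    have sb: "0 \<le> saw_sum (Suc s) t" "saw_sum (Suc s) t \<le> t" "0 \<le> saw s t"
      using saw_sum_bounds[OF t] saw_nonneg[OF t] by auto
    have "sq_state (Suc s) b c t = relu (((if c = 2 then sq_state s b 2 t else 0) + saw s t * (if c = 0 then 1/2 else if c = 1 then 1 else ?\<kappa> b))
       - (if c = 1 then 2 / 4 ^ Suc s else 0))"
      using c3
    proof (elim disjE)
      assume c: "c = 0"
      show ?thesis using sb by (simp add: c sq_state_def relu_eq)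
    next
      assume c: "c = 1"
      show ?thesis by (simp add: c sq_state_def)
    next
      assume c: "c = 2"
      have "relu (sq_state s b 2 t + saw s t * ?\<kappa> b) = sq_state (Suc s) b 2 t"
        using sb by (cases b; cases "s = 0") (auto simp: sq_state_def saw_sum_Suc relu_eq)
      then show ?thesis by (simp add: c)
    qed
    then show "(\<lambda>((i, j), b, c) x. sq_state (Suc s) b c (pair_arg b (F i x) (F j x))) jj x =
      relu ((\<Sum>i'\<in>?S jj. ?c jj i' * ?V i') - ?b jj)"
      unfolding sm' by (simp add: e t_def)
  next
    show "finite ?J" using fin by simp
  next
    fix jj assume "jj \<in> ?J"
    then show "?S jj \<subseteq> ?J" by (cases jj) (auto split: if_splits)
    show "\<bar>?c jj i\<bar> \<le> 1" for i by (auto simp: case_prod_beta)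
  qed
  then show ?case by simp
qed

text \<open>Both values of g are underestimated by at most 4^(-m), so their difference errs by at
  most 4^(-m). Of the m + 5 layers, m + 2 compute the states, one evaluates the polarization
  formula, and two applications of relu (1 - y) clip at 1; clipping to [0,1] cannot increase the
  distance to a product that lies there.\<close>

lemma realizes_products:
  fixes I :: "'i set"
  assumes R: "realizes d w k l I F" and F: "\<And>x i. x \<in> cube d \<Longrightarrow> i \<in> I \<Longrightarrow> F i x \<in> {0..1}"
    and cost: "24 * (card I * card I) \<le> k"
  obtains G where "realizes d w k (l + (m + 5)) (I \<times> I) G"
    "\<And>x i j. x \<in> cube d \<Longrightarrow> i \<in> I \<Longrightarrow> j \<in> I \<Longrightarrow> G (i, j) x \<in> {0..1}"
    "\<And>x i j. x \<in> cube d \<Longrightarrow> i \<in> I \<Longrightarrow> j \<in> I \<Longrightarrow> \<bar>G (i, j) x - F i x * F j x\<bar> \<le> 1 / 4 ^ m"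
proof -
  have fin: "finite I" using R by (rule realizes_finite)
  let ?t = "\<lambda>b i j x. pair_arg b (F i x) (F j x)"
  define z where "z i j x = saw_sum (Suc m) (?t False i j x) + (?t True i j x - saw_sum (Suc m) (?t True i j x)) - 1/4" for i j x
  have c: "card I * card I * 3 \<le> k" "card I * card I * 2 \<le> k" using cost by linarith+
  have "realizes d w k (Suc (l + Suc (Suc m))) (I \<times> I) (\<lambda>(i, j) x. relu (z i j x))"
    by (rule realizes_step[OF realizes_sq_states[OF R F cost, of "Suc m"],
        where S="\<lambda>p. {(p, False, 2), (p, True, 2)}" and c="\<lambda>_ _. 1" and b="\<lambda>_. 1/4"])
      (use fin c in \<open>auto simp: z_def sq_state_def card_cartesian_product algebra_simps\<close>)
  then have "realizes d w k (Suc (Suc (l + Suc (Suc m)))) (I \<times> I) (\<lambda>(i, j) x. relu (1 - relu (z i j x)))"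
    by (rule realizes_step[where S="\<lambda>p. {p}" and c="\<lambda>_ _. -1" and b="\<lambda>_. -1"])
      (use fin c in \<open>auto simp: card_cartesian_product algebra_simps\<close>)
  then have "realizes d w k (Suc (Suc (Suc (l + Suc (Suc m))))) (I \<times> I) (\<lambda>(i, j) x. relu (1 - relu (1 - relu (z i j x))))"
    by (rule realizes_step[where S="\<lambda>p. {p}" and c="\<lambda>_ _. -1" and b="\<lambda>_. -1"])
      (use fin c in \<open>auto simp: card_cartesian_product algebra_simps\<close>)
  moreover have "Suc (Suc (Suc (l + Suc (Suc m)))) = l + (m + 5)" by simp
  ultimately have RG: "realizes d w k (l + (m + 5)) (I \<times> I) (\<lambda>(i, j) x. relu (1 - relu (1 - relu (z i j x))))"
    by (simp only:)
  show ?thesis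
  proof (rule that[OF RG])
    fix x i j assume x: "x \<in> cube d" and i: "i \<in> I" and j: "j \<in> I"
    show "(case (i, j) of (i, j) \<Rightarrow> \<lambda>x. relu (1 - relu (1 - relu (z i j x)))) x \<in> {0..1}"
      by (auto simp: relu_def)
    let ?u = "F i x" and ?v = "F j x"
    have uv: "?u \<in> {0..1}" "?v \<in> {0..1}" using F x i j by auto
    have p: "0 \<le> ?u * ?v" "?u * ?v \<le> 1" using uv by (auto intro: mult_le_one)
    have t: "?t b i j x \<in> {0..1}" for b by (rule pair_arg_range[OF uv])
    note b0 = saw_sum_bounds(3,4)[OF t[of False], of m] and b1 = saw_sum_bounds(3,4)[OF t[of True], of m]
    have "?u * ?v = ?t False i j x * (1 - ?t False i j x) - ?t True i j x * (1 - ?t True i j x) + ?t True i j x - 1/4"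
      by (simp add: pair_arg_def field_simps)
    then have "\<bar>z i j x - ?u * ?v\<bar> \<le> 1 / 4 ^ m" using b0 b1 unfolding z_def by linarith
    moreover have "\<bar>relu (1 - relu (1 - relu (z i j x))) - ?u * ?v\<bar> \<le> \<bar>z i j x - ?u * ?v\<bar>"
      using p by (auto simp: relu_def max_def)
    ultimately show "\<bar>(case (i, j) of (i, j) \<Rightarrow> \<lambda>x. relu (1 - relu (1 - relu (z i j x)))) x - F i x * F j x\<bar> \<le> 1 / 4 ^ m"
      by simp
  qed
qed

text \<open>Multiplying all pairs in each of t rounds yields every product of 2^t factors, and the
  errors obey e' = 2 e + 4^(-m). The family is reindexed by natural numbers after each round, since
  pairs of pairs would change the index type during the induction.\<close>

lemma realizes_iterated_products:
  fixes I :: "'i set"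
  assumes R: "realizes d w k l I F" and F: "\<And>x i. x \<in> cube d \<Longrightarrow> i \<in> I \<Longrightarrow> F i x \<in> {0..1}"
    and cost: "24 * card I ^ (2 ^ t) \<le> k" and ne: "I \<noteq> {}"
  shows "\<exists>(J::nat set) G. realizes d w k (l + t * (m + 5)) J G \<and> card J = card I ^ (2 ^ t) \<and>
    (\<forall>x\<in>cube d. \<forall>j\<in>J. G j x \<in> {0..1}) \<and>
    (\<forall>xs. set xs \<subseteq> I \<longrightarrow> length xs = 2 ^ t \<longrightarrow>
       (\<exists>j\<in>J. \<forall>x\<in>cube d. \<bar>G j x - (\<Prod>i\<leftarrow>xs. F i x)\<bar> \<le> (2 ^ t - 1) / 4 ^ m))"
  using cost
proof (induction t)
  case 0
  have fin: "finite I" using R by (rule realizes_finite)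
  obtain e where e: "bij_betw e {0..<card I} I" using ex_bij_betw_nat_finite[OF fin] by blast
  have "realizes d w k l {0..<card I} (\<lambda>j. F (e j))"
    by (rule realizes_reindex[OF R, of e]) (use e in \<open>auto simp: bij_betw_def\<close>)
  moreover have "\<exists>j\<in>{0..<card I}. \<forall>x\<in>cube d. \<bar>F (e j) x - (\<Prod>i\<leftarrow>xs. F i x)\<bar> \<le> (2 ^ 0 - 1) / 4 ^ m"
    if xs: "set xs \<subseteq> I" "length xs = 2 ^ 0" for xs
  proof -
    obtain i where i: "xs = [i]" using xs(2) by (auto simp: length_Suc_conv)
    then have "i \<in> e ` {0..<card I}" using e xs(1) by (auto simp: bij_betw_def)
    then obtain j where "j \<in> {0..<card I}" "e j = i" by blast
    then show ?thesis using i by (intro bexI[of _ j]) auto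
  qed
  moreover have "F (e j) x \<in> {0..1}" if "x \<in> cube d" "j \<in> {0..<card I}" for x j
    using F[OF that(1)] bij_betwE[OF e] that(2) by blast
  ultimately show ?case
    by (intro exI[of _ "{0..<card I}"] exI[of _ "\<lambda>j. F (e j)"]) auto
next
  case (Suc t)
  have c1: "card I \<ge> 1" using ne realizes_finite[OF R] by (simp add: Suc_le_eq card_gt_0_iff)
  have sq: "card I ^ (2 ^ Suc t) = card I ^ (2 ^ t) * card I ^ (2 ^ t)"
    by (simp add: power_add[symmetric] mult_2)
  have "1 \<le> card I ^ (2 ^ t)" using c1 by simp
  then have "card I ^ (2 ^ t) \<le> card I ^ (2 ^ Suc t)" unfolding sq by (simp del: One_nat_def)
  then have "24 * card I ^ (2 ^ t) \<le> k" using Suc.prems by linarith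
  from Suc.IH[OF this] obtain J :: "nat set" and G where J: "realizes d w k (l + t * (m + 5)) J G"
    "card J = card I ^ (2 ^ t)" "\<And>x j. x \<in> cube d \<Longrightarrow> j \<in> J \<Longrightarrow> G j x \<in> {0..1}"
    and pr: "\<And>xs. set xs \<subseteq> I \<Longrightarrow> length xs = 2 ^ t \<Longrightarrow>
       \<exists>j\<in>J. \<forall>x\<in>cube d. \<bar>G j x - (\<Prod>i\<leftarrow>xs. F i x)\<bar> \<le> (2 ^ t - 1) / 4 ^ m"
    by (elim exE conjE) blast
  have finJ: "finite J" using J(1) by (rule realizes_finite)
  have "24 * (card J * card J) \<le> k" using Suc.prems by (simp only: J(2) sq)
  from realizes_products[OF J(1,3) this, where m=m] obtain H where
    H: "realizes d w k (l + t * (m + 5) + (m + 5)) (J \<times> J) H"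
    "\<And>x i j. x \<in> cube d \<Longrightarrow> i \<in> J \<Longrightarrow> j \<in> J \<Longrightarrow> H (i, j) x \<in> {0..1}"
    "\<And>x i j. x \<in> cube d \<Longrightarrow> i \<in> J \<Longrightarrow> j \<in> J \<Longrightarrow> \<bar>H (i, j) x - G i x * G j x\<bar> \<le> 1 / 4 ^ m"
    by blast
  define n where "n = card (J \<times> J)"
  obtain e where e: "bij_betw e {0..<n} (J \<times> J)"
    unfolding n_def using ex_bij_betw_nat_finite[of "J \<times> J"] finJ by blast
  have im: "e ` {0..<n} = J \<times> J" using e by (simp add: bij_betw_def)
  have "realizes d w k (l + t * (m + 5) + (m + 5)) {0..<n} (\<lambda>j. H (e j))"
    by (rule realizes_reindex[OF H(1), of e]) (use e in \<open>auto simp: bij_betw_def\<close>)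
  moreover have "l + t * (m + 5) + (m + 5) = l + Suc t * (m + 5)" by simp
  ultimately have R': "realizes d w k (l + Suc t * (m + 5)) {0..<n} (\<lambda>j. H (e j))" by simp
  have cn: "card {0..<n} = card I ^ (2 ^ Suc t)" by (simp only: sq n_def card_cartesian_product J(2) card_atLeastLessThan diff_zero)
  have rng: "H (e j) x \<in> {0..1}" if "x \<in> cube d" "j \<in> {0..<n}" for x j
  proof -
    have "e j \<in> J \<times> J" using im that(2) by blast
    then show ?thesis using H(2)[OF that(1)] by (cases "e j") auto
  qed
  have pr': "\<exists>j\<in>{0..<n}. \<forall>x\<in>cube d. \<bar>H (e j) x - (\<Prod>i\<leftarrow>xs. F i x)\<bar> \<le> (2 ^ Suc t - 1) / 4 ^ m"
    if xs: "set xs \<subseteq> I" "length xs = 2 ^ Suc t" for xs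
  proof -
    let ?a = "take (2 ^ t) xs" and ?b = "drop (2 ^ t) xs"
    have ab: "xs = ?a @ ?b" "length ?a = 2 ^ t" "length ?b = 2 ^ t" "set ?a \<subseteq> I" "set ?b \<subseteq> I"
      using xs by (auto dest: in_set_takeD in_set_dropD)
    obtain j1 where j1: "j1 \<in> J" "\<And>x. x \<in> cube d \<Longrightarrow> \<bar>G j1 x - (\<Prod>i\<leftarrow>?a. F i x)\<bar> \<le> (2 ^ t - 1) / 4 ^ m"
      using pr[OF ab(4,2)] by blast
    obtain j2 where j2: "j2 \<in> J" "\<And>x. x \<in> cube d \<Longrightarrow> \<bar>G j2 x - (\<Prod>i\<leftarrow>?b. F i x)\<bar> \<le> (2 ^ t - 1) / 4 ^ m"
      using pr[OF ab(5,3)] by blast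
    have "(j1, j2) \<in> e ` {0..<n}" unfolding im using j1(1) j2(1) by simp
    then obtain j where j: "j \<in> {0..<n}" "e j = (j1, j2)" by (elim imageE) simp
    have "\<bar>H (e j) x - (\<Prod>i\<leftarrow>xs. F i x)\<bar> \<le> (2 ^ Suc t - 1) / 4 ^ m" if x: "x \<in> cube d" for x
    proof -
      let ?A = "\<Prod>i\<leftarrow>?a. F i x" and ?B = "\<Prod>i\<leftarrow>?b. F i x"
      have eq: "(\<Prod>i\<leftarrow>xs. F i x) = ?A * ?B" by (subst ab(1)) (simp only: map_append prod_list.append)
      have pl: "(\<Prod>i\<leftarrow>js. F i x) \<in> {0..1}" if "set js \<subseteq> I" for js
        using that F[OF x] by (induction js) (auto intro: mult_le_one)
      have A: "?A \<in> {0..1}" by (rule pl[OF ab(4)])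
      have B: "G j2 x \<in> {0..1}" by (rule J(3)[OF x j2(1)])
      have "G j1 x * G j2 x - ?A * ?B = (G j1 x - ?A) * G j2 x + ?A * (G j2 x - ?B)"
        by (simp add: algebra_simps)
      moreover have "\<bar>(G j1 x - ?A) * G j2 x\<bar> \<le> (2 ^ t - 1) / 4 ^ m * 1"
        unfolding abs_mult by (rule mult_mono) (use j1(2)[OF x] B in auto)
      moreover have "\<bar>?A * (G j2 x - ?B)\<bar> \<le> 1 * ((2 ^ t - 1) / 4 ^ m)"
        unfolding abs_mult by (rule mult_mono) (use j2(2)[OF x] A in auto)
      moreover have "\<bar>H (e j) x - G j1 x * G j2 x\<bar> \<le> 1 / 4 ^ m"
        using H(3)[OF x j1(1) j2(1)] j(2) by simp
      ultimately have "\<bar>H (e j) x - ?A * ?B\<bar> \<le> 1 / 4 ^ m + 2 * ((2 ^ t - 1) / 4 ^ m)" by linarith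
      also have "\<dots> = (2 ^ Suc t - 1) / 4 ^ m" by (simp add: field_simps)
      finally show ?thesis unfolding eq .
    qed
    then show ?thesis using j(1) by blast
  qed
  show ?case
    by (intro exI[of _ "{0..<n}"] exI[of _ "\<lambda>j. H (e j)"]) (use R' cn rng pr' in blast)
qed

subsection \<open>Piecewise constant functions on a grid\<close>

text \<open>The thresholds \<open>g j 1 \<le> \<dots> \<le> g j K\<close> cut the \<open>j\<close>-th coordinate into the cells \<open>0, \<dots>, K\<close>; the
  extreme thresholds \<open>-1\<close> and \<open>1\<close> are always, respectively never, passed. The slope of the
  ramps that replace indicator functions is \<open>4 ^ r\<close>.\<close>

locale grid_net =
  fixes d K r w k :: nat and g :: "nat \<Rightarrow> nat \<Rightarrow> real" and E :: "'e set" and b :: "'e \<Rightarrow> (nat \<Rightarrow> nat) \<Rightarrow> real"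
  assumes d: "d \<ge> 1" and kw: "k \<le> w"
    and g_first: "\<And>j. g j 0 = -1" and g_last: "\<And>j. g j (Suc K) = 1"
    and g_range: "\<And>j i. j < d \<Longrightarrow> i \<in> {1..K} \<Longrightarrow> g j i \<in> {0..1}"
    and g_mono: "\<And>j i i'. j < d \<Longrightarrow> 1 \<le> i \<Longrightarrow> i \<le> i' \<Longrightarrow> i' \<le> K \<Longrightarrow> g j i \<le> g j i'"
    and finE: "finite E" and b_range: "\<And>\<eta> \<mu>. \<eta> \<in> E \<Longrightarrow> b \<eta> \<mu> \<in> {0..1}"
    and cost1: "20 * (d + 1) \<le> k" and cost2: "3 * d * (K + 3) \<le> k"
    and cost3: "d * (K + 2) + (K + 1) ^ d * (2 * d + 1) \<le> k"
    and cost4: "2 * (d + 1) + card E * ((K + 1) ^ d + 1) \<le> k"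
begin

text \<open>Left end of cell m. Cell 0 begins at 0, although its threshold is the dummy value
  -1.\<close>

definition base :: "nat \<Rightarrow> nat \<Rightarrow> real" where
  "base j m = (if m = 0 then 0 else g j m)"

text \<open>Continuous substitute for the indicator of \<open>x j \<le> g j i\<close>, exact except
  on an interval of length 4^(-r) to the right of the threshold.\<close>

definition ramp :: "nat \<Rightarrow> nat \<Rightarrow> (nat \<Rightarrow> real) \<Rightarrow> real" where
  "ramp j i x = relu (1 - relu (4 ^ r * (x j - g j i)))"

definition incr :: "nat \<Rightarrow> nat \<Rightarrow> real" where
  "incr j i = base j i - base j (i - 1)"

text \<open>Distance of \<open>x j\<close> from the left end of its cell: the increments of the
  thresholds not yet passed add up to \<open>base j K\<close> minus that left end.\<close>

definition offset :: "nat \<Rightarrow> (nat \<Rightarrow> real) \<Rightarrow> real" where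
  "offset j x = relu (x j + (\<Sum>i=1..K. incr j i * ramp j i x) - base j K)"

definition cells :: "(nat \<Rightarrow> nat) set" where
  "cells = {..<d} \<rightarrow>\<^sub>E {..K}"

text \<open>Conjunction of d indicators: away from the ramps the scaled sum exceeds (d - 1) / d only
  if all of them are 1. The height 1 / d instead of 1 keeps the weights in [-1,1].\<close>

definition cell :: "(nat \<Rightarrow> nat) \<Rightarrow> (nat \<Rightarrow> real) \<Rightarrow> real" where
  "cell \<mu> x = relu ((\<Sum>j<d. (ramp j (Suc (\<mu> j)) x - ramp j (\<mu> j) x) / real d) - real (d - 1) / real d)"

text \<open>Looks up the value of b for the current cell. Storing the complement lets the ReLU
  confine the result to [0,1] everywhere, so that the sum over cells need not be estimated near the
  boundaries.\<close>

definition coded :: "'e \<Rightarrow> (nat \<Rightarrow> real) \<Rightarrow> real" where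
  "coded \<eta> x = relu (1 - (\<Sum>\<mu>\<in>cells. b \<eta> \<mu> * cell \<mu> x))"

lemma finite_cells: "finite cells" and card_cells: "card cells = (K + 1) ^ d"
  by (simp_all add: cells_def finite_PiE card_PiE)

lemma base_range: "j < d \<Longrightarrow> m \<le> K \<Longrightarrow> base j m \<in> {0..1}"
  using g_range[of j m] by (auto simp: base_def)

lemma incr_range: "j < d \<Longrightarrow> i \<in> {1..K} \<Longrightarrow> incr j i \<in> {0..1}"
proof -
  assume j: "j < d" and i: "i \<in> {1..K}"
  have "base j (i - 1) \<le> base j i"
    using g_mono[OF j, of "i - 1" i] g_range[OF j i] i by (auto simp: base_def)
  moreover have "base j i \<in> {0..1}" "base j (i - 1) \<in> {0..1}" 
    by (rule base_range[OF j], use i in force)+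
  ultimately show ?thesis by (auto simp: incr_def)
qed

lemma incr_sum: "(\<Sum>i=1..m. incr j i) = base j m"
  by (induction m) (simp_all add: incr_def base_def)

lemma ramp_range: "ramp j i x \<in> {0..1}"
  by (auto simp: ramp_def relu_def)

text \<open>Shifts are at most 1, so the term 4^r \<open>g j i\<close> cannot be a shift. A constant
  neuron with index d is amplified together with the inputs and enters with weight
  \<open>- g j i\<close>. Index K + 2 carries \<open>x j\<close>, recovered from its amplified copy
  with weight 4^(-r). One layer makes the constant, r + 1 amplify, and two form the ramps.\<close>

lemma realizes_ramps:
  "realizes d w k (r + 4) ({..<d} \<times> {..K + 2})
     (\<lambda>(j, i) x. if i = K + 2 then x j else ramp j i x)"
proof -
  have R0: "realizes d w k 0 {..<d} (\<lambda>i x. x i)" by (rule realizes_inputs[OF kw])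
  have xr: "x j \<in> {0..1}" if "x \<in> cube d" "j < d" for x j
    using that by (auto simp: cube_def PiE_iff)
  let ?F1 = "\<lambda>j x. if j < d then x j else 1 :: real"
  have R1: "realizes d w k (Suc 0) {..d} ?F1"
  proof (rule realizes_step[OF R0, where S="\<lambda>j. if j < d then {j} else {}" and c="\<lambda>_ _. 1"
        and b="\<lambda>j. if j < d then 0 else -1"])
    have "(\<Sum>j\<in>{..d}. Suc (card (if j < d then {j} else {}))) \<le> (\<Sum>j\<in>{..d}. 2)"
      by (intro sum_mono) auto
    then show "(\<Sum>j\<in>{..d}. Suc (card (if j < d then {j} else {}))) \<le> k" using cost1 by simp
    show "\<And>x j. x \<in> cube d \<Longrightarrow> j \<in> {..d} \<Longrightarrow> (if j < d then x j else 1) =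
      relu ((\<Sum>i\<in>(if j < d then {j} else {}). 1 * x i) - (if j < d then 0 else -1))"
      using xr by (auto simp: relu_def)
  qed auto
  have R2: "realizes d w k (Suc 0 + Suc r) ({..d} \<times> {..<4::nat}) (\<lambda>(i, _) x. real 4 ^ r * ?F1 i x)"
    by (rule realizes_amplify[OF R1]) (use xr cost1 in auto)
  have R3: "realizes d w k (Suc (Suc 0 + Suc r)) ({..<d} \<times> {..K + 2})
     (\<lambda>(j, i) x. if i = K + 2 then x j else relu (4 ^ r * (x j - g j i)))"
  proof (rule realizes_step[OF R2, where S="\<lambda>(j, i). if i = K + 2 then {(j, 0)} else {(j, 0), (d, 0)}"
        and c="\<lambda>(j, i) (j', _). if i = K + 2 then 1 / 4 ^ r else if j' = d then - g j i else 1" and b="\<lambda>_. 0"])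
    have "(\<Sum>j\<in>{..<d} \<times> {..K + 2}. Suc (card ((\<lambda>(j, i). if i = K + 2 then {(j, 0::nat)} else {(j, 0), (d, 0)}) j)))
      \<le> (\<Sum>j\<in>{..<d} \<times> {..K + 2}. 3)"
      by (intro sum_mono) (auto simp: card_insert_if)
    also have "\<dots> = 3 * d * (K + 3)" by (simp add: card_cartesian_product algebra_simps)
    finally show "(\<Sum>j\<in>{..<d} \<times> {..K + 2}. Suc (card ((\<lambda>(j, i). if i = K + 2 then {(j, 0::nat)} else {(j, 0), (d, 0)}) j))) \<le> k"
      using cost2 by linarith
  next
    fix ji ji' assume "ji \<in> {..<d} \<times> {..K + 2}" "ji' \<in> (\<lambda>(j, i). if i = K + 2 then {(j, 0::nat)} else {(j, 0), (d, 0)}) ji"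
    then obtain j i where ji: "ji = (j, i)" "j < d" "i \<le> K + 2" by auto
    have "\<bar>g j i\<bar> \<le> 1" if ne: "i \<noteq> K + 2"
    proof -
      consider "i = 0" | "i \<in> {1..K}" | "i = Suc K" using ne ji(3) by force
      then show ?thesis using g_first[of j] g_last[of j] g_range[OF ji(2), of i] by cases auto
    qed
    then show "\<bar>(\<lambda>(j, i) (j', _). if i = K + 2 then 1 / 4 ^ r else if j' = d then - g j i else 1) ji ji'\<bar> \<le> 1"
      by (auto simp: ji case_prod_beta divide_le_eq)
  next
    fix x ji assume x: "x \<in> cube d" and "ji \<in> {..<d} \<times> {..K + 2}"
    then obtain j i where ji: "ji = (j, i)" "j < d" "i \<le> K + 2" by auto
    then show "(\<lambda>(j, i) x. if i = K + 2 then x j else relu (4 ^ r * (x j - g j i))) ji x =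
       relu ((\<Sum>i\<in>(\<lambda>(j, i). if i = K + 2 then {(j, 0::nat)} else {(j, 0), (d, 0)}) ji.
         (\<lambda>(j, i) (j', _). if i = K + 2 then 1 / 4 ^ r else if j' = d then - g j i else 1) ji i *
         (\<lambda>(i, _) x. real 4 ^ r * (if i < d then x i else 1)) i x) - 0)"
      using xr[OF x ji(2)] by (auto simp: relu_eq algebra_simps)
  qed (auto split: if_splits)
  have R4: "realizes d w k (Suc (Suc (Suc 0 + Suc r))) ({..<d} \<times> {..K + 2})
     (\<lambda>(j, i) x. if i = K + 2 then x j else ramp j i x)"
  proof (rule realizes_step[OF R3, where S="\<lambda>p. {p}" and c="\<lambda>(j, i) _. if i = K + 2 then 1 else -1"
        and b="\<lambda>(j, i). if i = K + 2 then 0 else -1"])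
    show "(\<Sum>j\<in>{..<d} \<times> {..K + 2}. Suc (card {j})) \<le> k"
      using cost2 by (simp add: card_cartesian_product algebra_simps)
    fix x ji assume x: "x \<in> cube d" and "ji \<in> {..<d} \<times> {..K + 2}"
    then obtain j i where ji: "ji = (j, i)" "j < d" "i \<le> K + 2" by auto
    then show "(\<lambda>(j, i) x. if i = K + 2 then x j else ramp j i x) ji x =
       relu ((\<Sum>i\<in>{ji}. (\<lambda>(j, i) _. if i = K + 2 then 1 else -1) ji i *
         (\<lambda>(j, i) x. if i = K + 2 then x j else relu (4 ^ r * (x j - g j i))) i x) -
         (\<lambda>(j, i). if i = K + 2 then 0 else -1) ji)"
      using xr[OF x ji(2)] by (auto simp: relu_eq ramp_def)
  qed auto
  moreover have "Suc (Suc (Suc 0 + Suc r)) = r + 4" by simp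
  ultimately show ?thesis by (simp only:)
qed

lemma realizes_cells:
  "realizes d w k (r + 5) ({..<d} <+> cells) (case_sum offset cell)"
proof -
  let ?I = "{..<d} \<times> {..K + 2}"
  let ?F = "\<lambda>(j, i) x. if i = K + 2 then x j else ramp j i x"
  let ?S = "case_sum (\<lambda>j. {j} \<times> insert (K + 2) {1..K}) (\<lambda>\<mu>. (\<lambda>j. (j, Suc (\<mu> j))) ` {..<d} \<union> (\<lambda>j. (j, \<mu> j)) ` {..<d})"
  let ?c = "case_sum (\<lambda>j (_, i). if i = K + 2 then 1 else incr j i)
     (\<lambda>\<mu> (j, i). if i = Suc (\<mu> j) then 1 / real d else - 1 / real d)"
  let ?b = "case_sum (\<lambda>j. base j K) (\<lambda>_. real (d - 1) / real d)"
  have "realizes d w k (Suc (r + 4)) ({..<d} <+> cells) (case_sum offset cell)"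
  proof (rule realizes_step[OF realizes_ramps, where S="?S" and c="?c" and b="?b"])
    show "finite ({..<d} <+> cells)" using finite_cells by simp
    have cS: "card (?S (Inl j)) \<le> K + 1" for j by (simp add: card_cartesian_product card_insert_if)
    have cS': "card (?S (Inr \<mu>)) \<le> 2 * d" for \<mu>
    proof -
      have "card (?S (Inr \<mu>)) \<le> card ((\<lambda>j. (j, Suc (\<mu> j))) ` {..<d}) + card ((\<lambda>j. (j, \<mu> j)) ` {..<d})"
        by (simp add: card_Un_le)
      also have "\<dots> \<le> d + d" by (intro add_mono order_trans[OF card_image_le]) auto
      finally show ?thesis by simp
    qed
    have "(\<Sum>j\<in>{..<d} <+> cells. Suc (card (?S j))) = (\<Sum>j<d. Suc (card (?S (Inl j)))) + (\<Sum>\<mu>\<in>cells. Suc (card (?S (Inr \<mu>))))"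
      using finite_cells by (simp add: sum.Plus)
    also have "\<dots> \<le> (\<Sum>j<d. K + 2) + (\<Sum>\<mu>\<in>cells. 2 * d + 1)"
    proof (intro add_mono sum_mono)
      show "Suc (card (?S (Inl j))) \<le> K + 2" for j using cS[of j] by linarith
      show "Suc (card (?S (Inr \<mu>))) \<le> 2 * d + 1" for \<mu> using cS'[of \<mu>] by linarith
    qed
    also have "\<dots> \<le> k" using cost3 by (simp add: card_cells)
    finally show "(\<Sum>j\<in>{..<d} <+> cells. Suc (card (?S j))) \<le> k" .
  next
    fix u assume "u \<in> {..<d} <+> cells"
    then show "?S u \<subseteq> ?I"
    proof (elim PlusE)
      fix \<mu> assume "\<mu> \<in> cells" "u = Inr \<mu>"
      then have "\<mu> j \<le> K" if "j < d" for j using that by (auto simp: cells_def)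
      then show ?thesis using \<open>u = Inr \<mu>\<close> by (fastforce intro: le_SucI)
    qed auto
  next
    fix u i assume "u \<in> {..<d} <+> cells" "i \<in> ?S u"
    then show "\<bar>?c u i\<bar> \<le> 1"
    proof (elim PlusE)
      fix j assume "j \<in> {..<d}" "u = Inl j"
      then show ?thesis using incr_range[of j "snd i"] \<open>i \<in> ?S u\<close> by (cases i) auto
    next
      fix \<mu> assume "\<mu> \<in> cells" "u = Inr \<mu>"
      then show ?thesis using d by (cases i) (simp add: abs_divide)
    qed
  next
    fix u assume "u \<in> {..<d} <+> cells"
    then show "\<bar>?b u\<bar> \<le> 1"
    proof (elim PlusE)
      fix j assume "j \<in> {..<d}" "u = Inl j"
      then show ?thesis using base_range[of j K] by auto
    next
      fix \<mu> assume "\<mu> \<in> cells" "u = Inr \<mu>"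
      then show ?thesis using d by (simp add: divide_le_eq)
    qed
  next
    fix x u assume x: "x \<in> cube d" and "u \<in> {..<d} <+> cells"
    then show "case_sum offset cell u x = relu ((\<Sum>i\<in>?S u. ?c u i * ?F i x) - ?b u)"
    proof (elim PlusE)
      fix j assume j: "j \<in> {..<d}" "u = Inl j"
      have "(\<Sum>i\<in>{j} \<times> insert (K + 2) {1..K}. (\<lambda>(_, i). if i = K + 2 then 1 else incr j i) i * ?F i x)
        = (\<Sum>i\<in>insert (K + 2) {1..K}. (if i = K + 2 then 1 else incr j i) * (if i = K + 2 then x j else ramp j i x))"
      proof -
        have eq: "{j} \<times> insert (K + 2) {1..K} = Pair j ` insert (K + 2) {1..K}" by auto
        show ?thesis unfolding eq by (subst sum.reindex) (auto simp: inj_on_def intro!: sum.cong)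
      qed
      also have "\<dots> = x j + (\<Sum>i=1..K. incr j i * ramp j i x)"
        by (subst sum.insert) (auto intro!: sum.cong)
      finally show ?thesis by (simp add: j(2) offset_def)
    next
      fix \<mu> assume \<mu>: "\<mu> \<in> cells" "u = Inr \<mu>"
      have le: "\<mu> j \<le> K" if "j < d" for j using that \<mu>(1) by (auto simp: cells_def)
      let ?A = "(\<lambda>j. (j, Suc (\<mu> j))) ` {..<d}" and ?B = "(\<lambda>j. (j, \<mu> j)) ` {..<d}"
      let ?f = "\<lambda>i. (\<lambda>(j, i). if i = Suc (\<mu> j) then 1 / real d else - 1 / real d) i * ?F i x"
      have "(\<Sum>i\<in>?A \<union> ?B. ?f i) = (\<Sum>i\<in>?A. ?f i) + (\<Sum>i\<in>?B. ?f i)"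
        by (rule sum.union_disjoint) auto
      also have "(\<Sum>i\<in>?A. ?f i) = (\<Sum>j<d. ramp j (Suc (\<mu> j)) x / real d)"
        by (subst sum.reindex) (use le in \<open>auto simp: inj_on_def intro!: sum.cong dest!: le\<close>)
      also have "(\<Sum>i\<in>?B. ?f i) = (\<Sum>j<d. - ramp j (\<mu> j) x / real d)"
        by (subst sum.reindex) (use le in \<open>auto simp: inj_on_def intro!: sum.cong dest!: le\<close>)
      also have "(\<Sum>j<d. ramp j (Suc (\<mu> j)) x / real d) + (\<Sum>j<d. - ramp j (\<mu> j) x / real d)
         = (\<Sum>j<d. (ramp j (Suc (\<mu> j)) x - ramp j (\<mu> j) x) / real d)"
        by (simp add: sum.distrib[symmetric] diff_divide_distrib)
      finally show ?thesis by (simp add: \<mu>(2) cell_def)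
    qed
  qed
  then show ?thesis by (simp add: numeral_eq_Suc)
qed

text \<open>The factors of the Taylor terms: offsets, coded coefficients, and the constant 1 at
  index d, which pads shorter products to a common length.\<close>

definition front :: "nat + 'e \<Rightarrow> (nat \<Rightarrow> real) \<Rightarrow> real" where
  "front = case_sum (\<lambda>j x. if j < d then offset j x else 1) coded"

lemma offset_le: "x \<in> cube d \<Longrightarrow> j < d \<Longrightarrow> offset j x \<in> {0..1}"
proof -
  assume x: "x \<in> cube d" and j: "j < d"
  have "(\<Sum>i=1..K. incr j i * ramp j i x) \<le> (\<Sum>i=1..K. incr j i * 1)"
    using ramp_range incr_range[OF j] by (intro sum_mono mult_left_mono) auto
  then have "(\<Sum>i=1..K. incr j i * ramp j i x) \<le> base j K" by (simp add: incr_sum[where j=j and m=K, simplified])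
  moreover have "x j \<in> {0..1}" using x j by (auto simp: cube_def PiE_iff)
  ultimately show ?thesis by (auto simp: offset_def relu_def)
qed

lemma realizes_front:
  "realizes d w k (r + 6) ({..d} <+> E) front"
proof -
  let ?I = "{..<d} <+> cells"
  let ?S = "case_sum (\<lambda>j. if j < d then {Inl j} else {}) (\<lambda>_. Inr ` cells) :: nat + 'e \<Rightarrow> (nat + (nat \<Rightarrow> nat)) set"
  let ?c = "case_sum (\<lambda>j _. 1) (\<lambda>\<eta>. case_sum (\<lambda>_. 0) (\<lambda>\<mu>. - b \<eta> \<mu>)) :: nat + 'e \<Rightarrow> (nat + (nat \<Rightarrow> nat)) \<Rightarrow> real"
  let ?b = "case_sum (\<lambda>j. if j < d then 0 else -1) (\<lambda>_. -1) :: nat + 'e \<Rightarrow> real"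
  have "realizes d w k (Suc (r + 5)) ({..d} <+> E) front"
  proof (rule realizes_step[OF realizes_cells, where S="?S" and c="?c" and b="?b"])
    show "finite ({..d} <+> E)" using finE by simp
    have "(\<Sum>j\<in>{..d} <+> E. Suc (card (?S j))) = (\<Sum>j\<le>d. Suc (card (?S (Inl j)))) + (\<Sum>\<eta>\<in>E. Suc (card (?S (Inr \<eta>))))"
      using finE by (simp add: sum.Plus)
    also have "\<dots> \<le> (\<Sum>j\<le>d. 2) + (\<Sum>\<eta>\<in>E. (K + 1) ^ d + 1)"
      by (intro add_mono sum_mono) (auto simp: card_image card_cells)
    also have "\<dots> \<le> k" using cost4 by simp
    finally show "(\<Sum>j\<in>{..d} <+> E. Suc (card (?S j))) \<le> k" .
  next
    fix u assume "u \<in> {..d} <+> E"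
    show "?S u \<subseteq> ?I" by (cases u) auto
    show "\<bar>?b u\<bar> \<le> 1" by (cases u) auto
  next
    fix u i assume "u \<in> {..d} <+> E" "i \<in> ?S u"
    then show "\<bar>?c u i\<bar> \<le> 1" using b_range by (cases u; cases i) auto
  next
    fix x u assume x: "x \<in> cube d" and u: "u \<in> {..d} <+> E"
    show "front u x = relu ((\<Sum>i\<in>?S u. ?c u i * case_sum offset cell i x) - ?b u)"
    proof (cases u)
      case (Inl j)
      then show ?thesis using offset_le[OF x, of j] by (auto simp: front_def relu_eq)
    next
      case (Inr \<eta>)
      then show ?thesis by (simp add: front_def coded_def sum.reindex sum_negf)
    qed
  qed
  then show ?thesis by (simp add: numeral_eq_Suc)
qed

lemma front_range:
  assumes x: "x \<in> cube d" and u: "u \<in> {..d} <+> E"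
  shows "front u x \<in> {0..1}"
  using u
proof (elim PlusE)
  fix j assume "u = Inl j"
  then show ?thesis using offset_le[OF x, of j] by (auto simp: front_def)
next
  fix \<eta> assume e: "\<eta> \<in> E" "u = Inr \<eta>"
  have "0 \<le> (\<Sum>\<mu>\<in>cells. b \<eta> \<mu> * cell \<mu> x)"
    using b_range[OF e(1)] by (intro sum_nonneg mult_nonneg_nonneg) (auto simp: cell_def relu_def)
  then show ?thesis using e by (auto simp: front_def coded_def relu_def)
qed

text \<open>Away from the strips every ramp is 0 or 1 and switches behind the last passed threshold,
  with index \<open>lam j\<close>. Hence the increments in the offset telescope and exactly one cell
  neuron is active.\<close>

lemma front_good:
  assumes x: "x \<in> cube d"
    and good: "\<And>j i. j < d \<Longrightarrow> i \<in> {1..K} \<Longrightarrow> x j \<le> g j i \<or> g j i + 1 / 4 ^ r \<le> x j"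
    and mesh: "\<And>j m. j < d \<Longrightarrow> m \<le> K \<Longrightarrow> g j (Suc m) - base j m \<le> h"
  obtains lam where "lam \<in> cells"
    "\<And>j. j < d \<Longrightarrow> front (Inl j) x = x j - base j (lam j) \<and> 0 \<le> x j - base j (lam j) \<and> x j - base j (lam j) \<le> h"
    "\<And>\<eta>. \<eta> \<in> E \<Longrightarrow> front (Inr \<eta>) x = 1 - b \<eta> lam / real d"
proof -
  have xr: "x j \<in> {0..1}" if "j < d" for j using x that by (auto simp: cube_def PiE_iff)
  have s1: "(1::real) \<le> 4 ^ r" by simp
  have s0: "(0::real) < 4 ^ r" by simp
  have hit: "ramp j i x = 0" if "g j i + 1 / 4 ^ r \<le> x j" for j i
  proof -
    have "1 / 4 ^ r \<le> x j - g j i" using that by linarith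
    then have "1 \<le> 4 ^ r * (x j - g j i)" by (simp add: divide_le_eq mult.commute)
    then show ?thesis by (simp add: ramp_def relu_def)
  qed
  have miss: "ramp j i x = 1" if "x j \<le> g j i" for j i
  proof -
    have "4 ^ r * (x j - g j i) \<le> 0" using that by (intro mult_nonneg_nonpos) auto
    then show ?thesis by (simp add: ramp_def relu_def)
  qed
  \<comment> \<open>The dummy index 0 keeps the set nonempty, so that its maximum exists.\<close>
  define H where "H j = {i \<in> {0..K}. i = 0 \<or> g j i + 1 / 4 ^ r \<le> x j}" for j
  define lam where "lam = (\<lambda>j\<in>{..<d}. Max (H j))"
  have H: "finite (H j)" "0 \<in> H j" for j by (auto simp: H_def)
  have lam_in: "lam j \<in> H j" if "j < d" for j
    using Max_in[OF H(1)[of j]] H(2)[of j] that by (auto simp: lam_def)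
  have lam_le: "lam j \<le> K" if "j < d" for j using lam_in[OF that] by (simp add: H_def)
  have zero: "ramp j i x = 0" if "j < d" "i \<le> lam j" for j i
  proof (cases "i = 0")
    case True
    have "1 / 4 ^ r \<le> (1::real)" by (simp only: divide_le_eq_1) simp
    moreover have "0 \<le> x j" using xr[OF that(1)] by simp
    ultimately have "g j 0 + 1 / 4 ^ r \<le> x j" unfolding g_first by linarith
    then show ?thesis using hit True by simp
  next
    case False
    then have "g j i \<le> g j (lam j)" using that lam_le by (intro g_mono) auto
    moreover have "g j (lam j) + 1 / 4 ^ r \<le> x j" using lam_in[OF that(1)] False that(2) by (auto simp: H_def)
    ultimately show ?thesis using hit by force
  qed
  have above: "x j \<le> g j i" if "j < d" "lam j < i" "i \<le> Suc K" for j i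
  proof (cases "i = Suc K")
    case True
    then show ?thesis using xr[OF that(1)] by (simp add: g_last)
  next
    case False
    then have i: "i \<in> {1..K}" using that by auto
    have "i \<notin> H j" using Max_ge[OF H(1), of i j] that by (auto simp: lam_def)
    then have "\<not> g j i + 1 / 4 ^ r \<le> x j" using i by (auto simp: H_def)
    then show ?thesis using good[OF that(1) i] by blast
  qed
  have one: "ramp j i x = 1" if "j < d" "lam j < i" "i \<le> Suc K" for j i
    by (rule miss[OF above[OF that]])
  have lamc: "lam \<in> cells" unfolding cells_def using lam_le by (auto simp: lam_def)
  have below: "base j (lam j) \<le> x j" if "j < d" for j
  proof (cases "lam j = 0")
    case True
    then show ?thesis using xr[OF that] by (simp add: base_def)
  next
    case False
    then have "g j (lam j) + 1 / 4 ^ r \<le> x j" using lam_in[OF that] by (auto simp: H_def)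
    moreover have "0 < 1 / (4::real) ^ r" by simp
    ultimately have "g j (lam j) \<le> x j" by linarith
    then show ?thesis using False by (simp add: base_def)
  qed
  have off: "offset j x = x j - base j (lam j)" if j: "j < d" for j
  proof -
    have "(\<Sum>i=1..K. incr j i * ramp j i x) = (\<Sum>i\<in>{1..K}. if i \<le> lam j then 0 else incr j i)"
      using zero[OF j] one[OF j] by (intro sum.cong) auto
    also have "\<dots> = (\<Sum>i\<in>{1..K}. incr j i - (if i \<le> lam j then incr j i else 0))"
      by (intro sum.cong) auto
    also have "\<dots> = base j K - (\<Sum>i\<in>{1..K}. if i \<le> lam j then incr j i else 0)"
      by (simp add: sum_subtractf incr_sum[where j=j and m=K, simplified])
    also have "(\<Sum>i\<in>{1..K}. if i \<le> lam j then incr j i else 0) = (\<Sum>i\<in>{1..lam j}. incr j i)"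
      using lam_le[OF j] by (subst sum.inter_filter[symmetric]) (auto intro!: sum.cong)
    also have "\<dots> = base j (lam j)" by (rule incr_sum)
    finally show ?thesis using below[OF j] by (simp add: offset_def relu_eq)
  qed
  have cl: "cell \<mu> x = (if \<mu> = lam then 1 / real d else 0)" if \<mu>: "\<mu> \<in> cells" for \<mu>
  proof -
    have t: "ramp j (Suc (\<mu> j)) x - ramp j (\<mu> j) x = (if \<mu> j = lam j then 1 else 0)" if j: "j < d" for j
    proof -
      have mk: "\<mu> j \<le> K" using \<mu> j by (auto simp: cells_def)
      consider "\<mu> j < lam j" | "\<mu> j = lam j" | "lam j < \<mu> j" by linarith
      then show ?thesis
      proof cases
        case 1
        then show ?thesis using zero[OF j, of "\<mu> j"] zero[OF j, of "Suc (\<mu> j)"] by simp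
      next
        case 2
        then show ?thesis using zero[OF j, of "\<mu> j"] one[OF j, of "Suc (\<mu> j)"] mk by simp
      next
        case 3
        then show ?thesis using one[OF j, of "\<mu> j"] one[OF j, of "Suc (\<mu> j)"] mk by simp
      qed
    qed
    have d0: "real d > 0" using d by simp
    have S: "(\<Sum>j<d. (ramp j (Suc (\<mu> j)) x - ramp j (\<mu> j) x) / real d) = (\<Sum>j<d. if \<mu> j = lam j then 1 / real d else 0)"
      using t by (intro sum.cong) auto
    show ?thesis
    proof (cases "\<mu> = lam")
      case True
      then have "(\<Sum>j<d. if \<mu> j = lam j then 1 / real d else 0) = 1" using d0 by simp
      then show ?thesis unfolding cell_def S using True d0 d by (simp add: relu_def of_nat_diff field_simps)
    next
      case False
      then obtain j where j: "\<mu> j \<noteq> lam j" by auto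
      then have jd: "j < d" using PiE_arb[OF \<mu>[unfolded cells_def], of j] PiE_arb[OF lamc[unfolded cells_def], of j]
        by (cases "j < d") auto
      have "(\<Sum>j<d. if \<mu> j = lam j then 1 / real d else 0) = (\<Sum>j\<in>{..<d} - {j}. if \<mu> j = lam j then 1 / real d else 0)"
        using j jd by (subst sum.remove[of "{..<d}" j]) auto
      also have "\<dots> \<le> (\<Sum>j\<in>{..<d} - {j}. 1 / real d)" by (intro sum_mono) auto
      also have "\<dots> = real (d - 1) / real d" using jd by simp
      finally show ?thesis unfolding cell_def S using False by (simp add: relu_def)
    qed
  qed
  have cod: "coded \<eta> x = 1 - b \<eta> lam / real d" if "b \<eta> lam \<le> 1" for \<eta>
  proof -
    have "(\<Sum>\<mu>\<in>cells. b \<eta> \<mu> * cell \<mu> x) = (\<Sum>\<mu>\<in>cells. if \<mu> = lam then b \<eta> lam / real d else 0)"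
      using cl by (intro sum.cong) auto
    also have "\<dots> = b \<eta> lam / real d" using finite_cells lamc by simp
    finally have e: "coded \<eta> x = relu (1 - b \<eta> lam / real d)" by (simp add: coded_def)
    have "b \<eta> lam / real d \<le> 1" using that d by (simp add: divide_le_eq)
    then show ?thesis unfolding e by (simp add: relu_eq)
  qed
  show ?thesis
  proof (rule that[OF lamc])
    fix j assume j: "j < d"
    have "x j \<le> g j (Suc (lam j))" using above[OF j, of "Suc (lam j)"] lam_le[OF j] by simp
    then have "x j - base j (lam j) \<le> h" using mesh[OF j lam_le[OF j]] by linarith
    then show "front (Inl j) x = x j - base j (lam j) \<and> 0 \<le> x j - base j (lam j) \<and> x j - base j (lam j) \<le> h"
      using off[OF j] below[OF j] j by (simp add: front_def)
  next
    fix \<eta> assume "\<eta> \<in> E"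
    then show "front (Inr \<eta>) x = 1 - b \<eta> lam / real d"
      using cod[of \<eta>] b_range[of \<eta> lam] by (simp add: front_def)
  qed
qed

end

subsection \<open>Approximation of smooth functions\<close>

text \<open>The points at which a ramp in direction j is neither 0 nor 1, for the grid shifted by
  the fraction \<open>\<rho> / R\<close> of a cell.\<close>

definition strip :: "nat \<Rightarrow> nat \<Rightarrow> nat \<Rightarrow> nat \<Rightarrow> nat \<Rightarrow> nat \<Rightarrow> (nat \<Rightarrow> real) set" where
  "strip d K R r j \<rho> = {x \<in> cube d. \<exists>i\<in>{1..K}. (real (i - 1) + real \<rho> / real R) / real K < x j \<and>
      x j < (real (i - 1) + real \<rho> / real R) / real K + 1 / 4 ^ r}"

text \<open>The strips for the \<open>R\<close> shifts of the grid are disjoint, so one of them has probability at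
  most \<open>1 / R\<close>.\<close>

lemma light_strip:
  assumes PX: "PX \<in> space (prob_algebra (cube_space d))" and j: "j < d"
    and K: "K \<ge> 1" and R: "R \<ge> 1" and KR: "K * R \<le> 4 ^ r"
  shows "\<exists>\<rho><R. strip d K R r j \<rho> \<in> sets PX \<and> measure PX (strip d K R r j \<rho>) \<le> 1 / real R"
proof -
  let ?S = "strip d K R r j"
  have sPX[measurable_cong]: "sets PX = sets (cube_space d)" and "prob_space PX"
    using PX by (auto simp: space_prob_algebra)
  interpret prob_space PX by fact
  have spX: "space PX = cube d" using sets_eq_imp_space_eq[OF sPX] by (simp add: space_cube_space)
  have [measurable]: "(\<lambda>x. x j) \<in> borel_measurable PX"
    using component_measurable[OF j] by (subst measurable_cong_sets[OF sPX refl])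
  have S: "?S \<rho> \<in> sets PX" for \<rho>
    unfolding strip_def spX[symmetric] by measurable
  have dis: "disjoint_family_on ?S {..<R}"
    unfolding disjoint_family_on_def
  proof (intro ballI impI, rule ccontr)
    fix \<rho> \<rho>' assume r: "\<rho> \<in> {..<R}" "\<rho>' \<in> {..<R}" "\<rho> \<noteq> \<rho>'" and "?S \<rho> \<inter> ?S \<rho>' \<noteq> {}"
    then obtain x i i' where
      x: "(real (i - 1) + real \<rho> / real R) / real K < x j" "x j < (real (i - 1) + real \<rho> / real R) / real K + 1 / 4 ^ r"
        "(real (i' - 1) + real \<rho>' / real R) / real K < x j" "x j < (real (i' - 1) + real \<rho>' / real R) / real K + 1 / 4 ^ r"
      unfolding strip_def by blast
    \<comment> \<open>The thresholds of all shifts lie on one grid of mesh 1 / (K R), here at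
      position N. Open strips of width 4^(-r) \<le> 1 / (K R) can meet only if their positions
      agree, and N modulo R is the shift.\<close>
    define N where "N = (i - 1) * R + \<rho>"
    define N' where "N' = (i' - 1) * R + \<rho>'"
    have "N mod R = \<rho>" "N' mod R = \<rho>'" using r by (auto simp: N_def N'_def)
    then have NN: "N \<noteq> N'" using r by auto
    have q: "0 < real K * real R" using K R by simp
    have eq: "(real (i - 1) + real \<rho> / real R) / real K = real N / (real K * real R)"
      "(real (i' - 1) + real \<rho>' / real R) / real K = real N' / (real K * real R)"
      using K R by (simp_all add: N_def N'_def field_simps)
    have "real K * real R \<le> 4 ^ r" using KR by (metis of_nat_le_iff of_nat_mult of_nat_numeral of_nat_power)
    then have le: "1 / 4 ^ r \<le> 1 / (real K * real R)" using q by (simp add: frac_le)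
    have "\<bar>real N / (real K * real R) - real N' / (real K * real R)\<bar> < 1 / (real K * real R)"
      using x le unfolding eq by linarith
    then have "\<bar>real N - real N'\<bar> / (real K * real R) < 1 / (real K * real R)"
      using q by (simp add: diff_divide_distrib[symmetric] abs_divide)
    then have "\<bar>real N - real N'\<bar> < 1" using q by (simp add: divide_less_cancel)
    then show False using NN by linarith
  qed
  have sum: "(\<Sum>\<rho><R. measure PX (?S \<rho>)) \<le> 1"
    using finite_measure_finite_Union[OF _ _ dis] S prob_le_1 by (metis finite_lessThan image_subsetI)
  have "\<exists>\<rho><R. measure PX (?S \<rho>) \<le> 1 / real R"
  proof (rule ccontr)
    assume "\<not> ?thesis"
    then have "(\<Sum>\<rho><R. 1 / real R) < (\<Sum>\<rho><R. measure PX (?S \<rho>))"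
      using R by (intro sum_strict_mono) (auto simp: not_le lessThan_empty_iff)
    then show False using sum R by simp
  qed
  then show ?thesis using S by blast
qed

section \<open>Monomials as lists of factors\<close>

definition mi_list :: "nat \<Rightarrow> (nat \<Rightarrow> nat) \<Rightarrow> (nat + 'e) list" where
  "mi_list d \<eta> = concat (map (\<lambda>j. replicate (\<eta> j) (Inl j)) [0..<d])"

lemma length_mi_list: "length (mi_list d \<eta>) = order_of d \<eta>"
  unfolding mi_list_def order_of_def
  by (simp add: length_concat comp_def interv_sum_list_conv_sum_set_nat atLeast0LessThan)

lemma set_mi_list: "set (mi_list d \<eta>) \<subseteq> Inl ` {..<d}"
  by (auto simp: mi_list_def)

lemma prod_mi_list: "(\<Prod>i\<leftarrow>mi_list d \<eta>. F i x) = mpow d (\<lambda>j. F (Inl j) x) \<eta>"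
  unfolding mi_list_def mpow_def
  by (induction d) (simp_all add: prod_list_replicate)

lemma sparse_relu_props:
  assumes "g \<in> sparse_relu L p s M" "p 0 = d" "M \<ge> 0"
  shows "g \<in> borel_measurable (cube_space d)" "g x \<in> {-M..M}"
proof -
  obtain W v where g: "g = (\<lambda>x. truncate M (network L p W v x))"
    using assms(1) by (auto simp: sparse_relu_def)
  show "g \<in> borel_measurable (cube_space d)" unfolding g by (rule network_measurable) (rule assms(2))
  show "g x \<in> {-M..M}" unfolding g by (rule truncate_range[OF assms(3)])
qed

lemma truncate_near: "y \<in> {-M..M} \<Longrightarrow> \<bar>truncate M t - y\<bar> \<le> \<bar>t - y\<bar>"
  by (auto simp: truncate_def min_def max_def)

text \<open>Off the strips the network evaluates the Taylor polynomial at the corner of the cell; on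
  them the bound 2 M is used, weighted by their probability d / R. The term q 2^t / 4^m is the total
  size of the output coefficients times the error of a product of 2^t factors.\<close>

lemma network_approximation:
  fixes \<beta> Lb M :: real and d K R r m t k w L s :: nat
  defines "kk \<equiv> nat (\<lceil>\<beta>\<rceil> - 1)"
  defines "E \<equiv> {\<eta>. \<eta> \<in> multi_indices d \<and> order_of d \<eta> \<le> kk}"
  defines "q \<equiv> nat \<lceil>4 * (\<bar>Lb\<bar> + 1) * real d * real (card E)\<rceil>"
  defines "J \<equiv> (d + 1 + card E) ^ (2 ^ t)"
  assumes f: "f \<in> holder_ball d \<beta> Lb" and fm: "f \<in> borel_measurable (cube_space d)"
    and fM: "\<And>x. x \<in> cube d \<Longrightarrow> f x \<in> {-M..M}" and \<beta>: "\<beta> > 0" and d: "d \<ge> 1"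
    and PX: "PX \<in> space (prob_algebra (cube_space d))"
    and t: "kk + 1 \<le> 2 ^ t" and K: "K \<ge> 1" and R: "R \<ge> 1" and KR: "K * R \<le> 4 ^ r" and kw: "k \<le> w"
    and cost: "20 * (d + 1) \<le> k" "3 * d * (K + 3) \<le> k" "d * (K + 2) + (K + 1) ^ d * (2 * d + 1) \<le> k"
      "2 * (d + 1) + card E * ((K + 1) ^ d + 1) \<le> k" "24 * J \<le> k" "J * q * (q + 1) \<le> k"
    and depth: "r + 6 + t * (m + 5) + 1 \<le> L"
    and p: "p 0 = d" "\<And>l. 1 \<le> l \<Longrightarrow> l \<le> L \<Longrightarrow> p l = w" "p (Suc L) = 1" and s: "(L + 1) * k \<le> s"
  shows "\<exists>g\<in>sparse_relu L p s M. (\<integral>x. (g x - f x)\<^sup>2 \<partial>PX)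
     \<le> (real d ^ kk * \<bar>Lb\<bar> * (1 / real K) powr \<beta> + real q * 2 ^ t / 4 ^ m)\<^sup>2 + (2 * M)\<^sup>2 * (real d / real R)"
proof -
  have sPX[measurable_cong]: "sets PX = sets (cube_space d)" and pPX: "prob_space PX"
    using PX by (auto simp: space_prob_algebra)
  interpret PX: prob_space PX by (rule pPX)
  have spX: "space PX = cube d" using sets_eq_imp_space_eq[OF sPX] by (simp add: space_cube_space)
  have M: "M \<ge> 0" using fM cube_nonempty by fastforce
  have finE: "finite E" unfolding E_def using finite_multi_indices by auto
  have E0: "(\<lambda>_. 0) \<in> E" by (auto simp: E_def multi_indices_def order_of_def)
  have cE: "card E \<ge> 1" using E0 finE by (metis One_nat_def Suc_leI card_gt_0_iff empty_iff)
  define A where "A = \<bar>Lb\<bar> + 1"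
  have A1: "A \<ge> 1" by (simp add: A_def)
  obtain c where cL: "\<And>a \<eta>. a \<in> cube d \<Longrightarrow> \<eta> \<in> E \<Longrightarrow> \<bar>c a \<eta>\<bar> \<le> Lb"
    and cT: "\<And>a x h. a \<in> cube d \<Longrightarrow> x \<in> cube d \<Longrightarrow> 0 < h \<Longrightarrow> (\<And>j. j < d \<Longrightarrow> \<bar>x j - a j\<bar> \<le> h) \<Longrightarrow>
      \<bar>f x - (\<Sum>\<eta>\<in>E. c a \<eta> * mpow d (\<lambda>i. x i - a i) \<eta>)\<bar> \<le> real d ^ kk * Lb * h powr \<beta>"
    by (rule holder_ball_taylor[OF f \<beta> d]) (auto simp: E_def kk_def)
  have Lb0: "0 \<le> Lb"
  proof -
    obtain a where "a \<in> cube d" using cube_nonempty by blast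
    from cL[OF this E0] show ?thesis by linarith
  qed
  have "\<forall>j. \<exists>\<rho>. j < d \<longrightarrow> \<rho> < R \<and> strip d K R r j \<rho> \<in> sets PX \<and> measure PX (strip d K R r j \<rho>) \<le> 1 / real R"
    using light_strip[OF PX _ K R KR] by blast
  then obtain \<rho> where \<rho>: "\<And>j. j < d \<Longrightarrow> \<rho> j < R" "\<And>j. j < d \<Longrightarrow> strip d K R r j (\<rho> j) \<in> sets PX"
     "\<And>j. j < d \<Longrightarrow> measure PX (strip d K R r j (\<rho> j)) \<le> 1 / real R"
    by metis
  define bad where "bad = (\<Union>j<d. strip d K R r j (\<rho> j))"
  have bad_sets: "bad \<in> sets PX" unfolding bad_def using \<rho>(2) by auto
  have "measure PX bad \<le> (\<Sum>j<d. measure PX (strip d K R r j (\<rho> j)))"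
    unfolding bad_def by (rule PX.finite_measure_subadditive_finite) (use \<rho>(2) in auto)
  also have "\<dots> \<le> (\<Sum>j<d. 1 / real R)" using \<rho>(3) by (intro sum_mono) auto
  finally have bad_le: "measure PX bad \<le> real d / real R" by simp
  define g where "g j i = (if i = 0 then -1 else if i = Suc K then 1 else (real (i - 1) + real (\<rho> j) / real R) / real K)" for j i :: nat
  define z where "z j i = (if i = 0 then 0 else g j i)" for j i :: nat
  define pt where "pt \<mu> = (\<lambda>j\<in>{..<d}. z j (\<mu> j))" for \<mu> :: "nat \<Rightarrow> nat"
  \<comment> \<open>Coefficients are mapped affinely from [-A,A] to [0,1]. The value 0 covers
    indices whose corner is no point of the cube, since the locale demands the range for every
    index.\<close>
  define b where "b \<eta> \<mu> = (if pt \<mu> \<in> cube d then (c (pt \<mu>) \<eta> + A) / (2 * A) else 0)" for \<eta> \<mu> :: "nat \<Rightarrow> nat"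
  have th: "0 \<le> real (\<rho> j) / real R" "real (\<rho> j) / real R \<le> 1" if "j < d" for j
    using \<rho>(1)[OF that] R by auto
  have g_in: "g j i = (real (i - 1) + real (\<rho> j) / real R) / real K" if "i \<in> {1..K}" for i j
    using that by (auto simp: g_def)
  have K0: "real K > 0" using K by simp
  interpret G: grid_net d K r w k g E b
  proof
    show "g j 0 = -1" "g j (Suc K) = 1" for j by (simp_all add: g_def)
    show "g j i \<in> {0..1}" if "j < d" "i \<in> {1..K}" for j i
    proof -
      have "real (i - 1) + real (\<rho> j) / real R \<le> real K" using th[OF that(1)] that(2) by (auto simp: of_nat_diff)
      then show ?thesis using th[OF that(1)] K0 by (auto simp: g_in[OF that(2)] divide_le_eq)
    qed
    show "g j i \<le> g j i'" if "j < d" "1 \<le> i" "i \<le> i'" "i' \<le> K" for j i i'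
      using that K0 by (simp add: g_in divide_right_mono)
    show "b \<eta> \<mu> \<in> {0..1}" if e: "\<eta> \<in> E" for \<eta> \<mu>
    proof (cases "pt \<mu> \<in> cube d")
      case True
      have "\<bar>c (pt \<mu>) \<eta>\<bar> \<le> A" using cL[OF True e] by (simp add: A_def)
      then show ?thesis using A1 True by (auto simp: b_def divide_le_eq)
    qed (simp add: b_def)
  qed (use d kw finE cost in auto)
  have zb: "G.base j i = z j i" for j i by (simp add: G.base_def z_def)
  have ptc: "pt \<mu> \<in> cube d" if "\<mu> \<in> G.cells" for \<mu>
    unfolding cube_def pt_def
  proof (rule restrict_PiE_iff[THEN iffD2], intro ballI)
    fix j assume "j \<in> {..<d}"
    then show "z j (\<mu> j) \<in> {0..1}" using G.base_range[of j "\<mu> j"] that by (auto simp: zb G.cells_def)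
  qed
  let ?I = "{..d} <+> E"
  have cI: "card ?I = d + 1 + card E" using finE by (simp add: card_Plus)
  have neI: "?I \<noteq> {}" by auto
  have c24: "24 * card ?I ^ (2 ^ t) \<le> k" unfolding cI using cost(5) by (simp add: J_def)
  have fr: "G.front i x \<in> {0..1}" if "x \<in> cube d" "i \<in> ?I" for x i by (rule G.front_range[OF that])
  obtain Jn :: "nat set" and H where H: "realizes d w k (r + 6 + t * (m + 5)) Jn H" "card Jn = J"
    "\<And>x j. x \<in> cube d \<Longrightarrow> j \<in> Jn \<Longrightarrow> H j x \<in> {0..1}"
    and pr: "\<And>xs. set xs \<subseteq> ?I \<Longrightarrow> length xs = 2 ^ t \<Longrightarrow>
       \<exists>j\<in>Jn. \<forall>x\<in>cube d. \<bar>H j x - (\<Prod>i\<leftarrow>xs. G.front i x)\<bar> \<le> (2 ^ t - 1) / 4 ^ m"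
  proof -
    have "\<exists>(Jn::nat set) H. realizes d w k (r + 6 + t * (m + 5)) Jn H \<and> card Jn = card ?I ^ (2 ^ t) \<and>
      (\<forall>x\<in>cube d. \<forall>j\<in>Jn. H j x \<in> {0..1}) \<and>
      (\<forall>xs. set xs \<subseteq> ?I \<longrightarrow> length xs = 2 ^ t \<longrightarrow>
         (\<exists>j\<in>Jn. \<forall>x\<in>cube d. \<bar>H j x - (\<Prod>i\<leftarrow>xs. G.front i x)\<bar> \<le> (2 ^ t - 1) / 4 ^ m))"
      by (rule realizes_iterated_products[OF G.realizes_front _ c24 neI]) (rule fr)
    then show ?thesis unfolding cI J_def[symmetric] by (elim exE conjE) (rule that, assumption, assumption, blast, simp)
  qed
  define \<epsilon> :: real where "\<epsilon> = 2 ^ t / 4 ^ m"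
  have eps: "(2 ^ t - 1) / 4 ^ m \<le> \<epsilon>" unfolding \<epsilon>_def by (intro divide_right_mono) auto
  have "\<exists>j\<in>Jn. \<forall>x\<in>cube d. \<bar>H j x - (if B then G.front (Inr \<eta>) x else 1) * mpow d (\<lambda>j. G.front (Inl j) x) \<eta>\<bar> \<le> \<epsilon>"
    if e: "\<eta> \<in> E" for \<eta> B
  proof -
    \<comment> \<open>An optional coefficient, the monomial, and constant factors up to length 2^t.
      The hypothesis \<open>kk + 1 \<le> 2 ^ t\<close> leaves room for the degree and the
      coefficient.\<close>
    define xs where "xs = (if B then [Inr \<eta>] else []) @ mi_list d \<eta> @ replicate (2 ^ t - (order_of d \<eta> + (if B then 1 else 0))) (Inl d)"
    have "order_of d \<eta> + 1 \<le> 2 ^ t" using e t by (simp add: E_def)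
    then have "length xs = 2 ^ t" by (simp add: xs_def length_mi_list)
    moreover have "set xs \<subseteq> ?I" using set_mi_list[of d \<eta>] e by (auto simp: xs_def)
    moreover have "(\<Prod>i\<leftarrow>xs. G.front i x) = (if B then G.front (Inr \<eta>) x else 1) * mpow d (\<lambda>j. G.front (Inl j) x) \<eta>" for x
      by (simp add: xs_def prod_mi_list prod_list_replicate G.front_def)
    ultimately show ?thesis using pr[of xs] eps by (metis order_trans)
  qed
  then have "\<forall>e. \<exists>j. fst e \<in> E \<longrightarrow> j \<in> Jn \<and> (\<forall>x\<in>cube d. \<bar>H j x - (if snd e then G.front (Inr (fst e)) x else 1) *
      mpow d (\<lambda>j. G.front (Inl j) x) (fst e)\<bar> \<le> \<epsilon>)" by blast
  then obtain h where h: "\<And>e. fst e \<in> E \<Longrightarrow> h e \<in> Jn"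
    "\<And>e x. fst e \<in> E \<Longrightarrow> x \<in> cube d \<Longrightarrow> \<bar>H (h e) x - (if snd e then G.front (Inr (fst e)) x else 1) *
      mpow d (\<lambda>j. G.front (Inl j) x) (fst e)\<bar> \<le> \<epsilon>" by metis
  \<comment> \<open>Decodes the lookup value 1 - b / d with b = (c + A) / (2 A): c = (2 A d - A) - 2
    A d (1 - b / d). So each monomial is used twice, without and with the lookup factor, and each
    pair of coefficients has total modulus at most 4 A d, the origin of q.\<close>
  define \<alpha> where "\<alpha> e = (if snd e then - (2 * A * real d) else 2 * A * real d - A)" for e :: "(nat \<Rightarrow> nat) \<times> bool"
  let ?E = "E \<times> (UNIV :: bool set)"
  have d1: "real d \<ge> 1" using d by simp
  have Ad: "A \<le> A * real d" using A1 d1 by simp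
  have sum_bool: "(\<Sum>e\<in>?E. u e) = (\<Sum>\<eta>\<in>E. u (\<eta>, False) + u (\<eta>, True))" for u :: "(nat \<Rightarrow> nat) \<times> bool \<Rightarrow> real"
    by (simp add: sum.cartesian_product' UNIV_bool)
  have q0: "4 * A * real d * real (card E) \<le> real q" unfolding q_def A_def by linarith
  have sa: "(\<Sum>e\<in>?E. \<bar>\<alpha> e\<bar>) \<le> real q"
  proof -
    have "(\<Sum>e\<in>?E. \<bar>\<alpha> e\<bar>) = (\<Sum>\<eta>\<in>E. \<bar>2 * A * real d - A\<bar> + 2 * A * real d)"
      unfolding sum_bool using A1 by (simp add: \<alpha>_def abs_mult)
    also have "\<dots> \<le> (\<Sum>\<eta>\<in>E. 4 * A * real d)" using Ad A1 by (intro sum_mono) auto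
    also have "\<dots> \<le> real q" using q0 by (simp add: mult_ac)
    finally show ?thesis .
  qed
  have q1: "q \<ge> 1"
  proof -
    have a: "1 \<le> A * real d" using A1 Ad by linarith
    have "1 \<le> real (card E)" using cE by simp
    then have "1 * 1 \<le> (A * real d) * real (card E)" by (intro mult_mono) (use a in linarith)+
    then have "1 \<le> real q" using q0 by linarith
    then show ?thesis by simp
  qed
  obtain gn where gn: "gn \<in> sparse_relu L p s M"
    and gx: "\<And>x. x \<in> cube d \<Longrightarrow> gn x = truncate M (\<Sum>e\<in>?E. \<alpha> e * H (h e) x)"
    using realizes_output[OF H(1) _ _ _ q1 sa _ _ p s, of h M] H(2,3) finE h(1) cost(6) depth by fastforce
  define err where "err = real d ^ kk * Lb * (1 / real K) powr \<beta> + real q * \<epsilon>"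
  have near: "\<bar>gn x - f x\<bar> \<le> err" if x: "x \<in> cube d" and nb: "x \<notin> bad" for x
  proof -
    have good: "x j \<le> g j i \<or> g j i + 1 / 4 ^ r \<le> x j" if "j < d" "i \<in> {1..K}" for j i
      using nb x that unfolding bad_def strip_def g_in[OF that(2)] by force
    \<comment> \<open>The first and the last cell have widths \<rho> / (R K) and (1 - \<rho> / R) /
      K, all others 1 / K.\<close>
    have mesh: "g j (Suc i) - G.base j i \<le> 1 / real K" if ji: "j < d" "i \<le> K" for j i
    proof -
      consider "i = 0" | "1 \<le> i" "i < K" | "i = K" "K \<ge> 1" using ji(2) K by linarith
      then show ?thesis
      proof cases
        case 1
        have "real (\<rho> j) / real R / real K \<le> 1 / real K"
          by (rule divide_right_mono) (use th[OF ji(1)] in auto)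
        then show ?thesis using 1 K g_in[of 1 j] by (simp add: zb z_def)
      next
        case 2
        then show ?thesis using g_in[of i j] g_in[of "Suc i" j]
          by (simp add: zb z_def diff_divide_distrib[symmetric] of_nat_diff)
      next
        case 3
        then show ?thesis using th[OF ji(1)] K0 g_in[of K j]
          by (simp add: zb z_def of_nat_diff G.g_last field_simps)
      qed
    qed
    obtain lam where lam: "lam \<in> G.cells"
      "\<And>j. j < d \<Longrightarrow> G.front (Inl j) x = x j - G.base j (lam j) \<and> 0 \<le> x j - G.base j (lam j) \<and> x j - G.base j (lam j) \<le> 1 / real K"
      "\<And>\<eta>. \<eta> \<in> E \<Longrightarrow> G.front (Inr \<eta>) x = 1 - b \<eta> lam / real d"
      using G.front_good[OF x good mesh] by blast
    define a where "a = pt lam"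
    have a: "a \<in> cube d" unfolding a_def by (rule ptc[OF lam(1)])
    have aj: "a j = G.base j (lam j)" if "j < d" for j using that by (simp add: a_def pt_def zb)
    have mp: "mpow d (\<lambda>j. G.front (Inl j) x) \<eta> = mpow d (\<lambda>j. x j - a j) \<eta>" for \<eta>
      unfolding mpow_def using lam(2) aj by (intro prod.cong) auto
    have bb: "b \<eta> lam = (c a \<eta> + A) / (2 * A)" for \<eta> using a by (simp add: b_def a_def)
    have v: "\<alpha> (\<eta>, False) * (1 * mpow d (\<lambda>j. x j - a j) \<eta>) + \<alpha> (\<eta>, True) * (G.front (Inr \<eta>) x * mpow d (\<lambda>j. x j - a j) \<eta>)
       = c a \<eta> * mpow d (\<lambda>j. x j - a j) \<eta>" if "\<eta> \<in> E" for \<eta>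
    proof -
      have "2 * A * real d - A - 2 * A * real d * (1 - b \<eta> lam / real d) = c a \<eta>"
        using A1 d1 by (simp add: bb field_simps)
      then have "(2 * A * real d - A - 2 * A * real d * (1 - b \<eta> lam / real d)) * mpow d (\<lambda>j. x j - a j) \<eta> = c a \<eta> * mpow d (\<lambda>j. x j - a j) \<eta>"
        by simp
      then show ?thesis unfolding lam(3)[OF that] \<alpha>_def by (simp add: left_diff_distrib mult.assoc)
    qed
    let ?T = "\<lambda>e. (if snd e then G.front (Inr (fst e)) x else 1) * mpow d (\<lambda>j. G.front (Inl j) x) (fst e)"
    have "(\<Sum>e\<in>?E. \<alpha> e * ?T e) = (\<Sum>\<eta>\<in>E. c a \<eta> * mpow d (\<lambda>j. x j - a j) \<eta>)"
      unfolding sum_bool mp by (rule sum.cong[OF refl]) (use v in simp)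
    moreover have "\<bar>f x - (\<Sum>\<eta>\<in>E. c a \<eta> * mpow d (\<lambda>i. x i - a i) \<eta>)\<bar> \<le> real d ^ kk * Lb * (1 / real K) powr \<beta>"
      by (rule cT[OF a x]) (use K0 lam(2) aj in auto)
    moreover have "\<bar>(\<Sum>e\<in>?E. \<alpha> e * H (h e) x) - (\<Sum>e\<in>?E. \<alpha> e * ?T e)\<bar> \<le> real q * \<epsilon>"
    proof -
      have "\<bar>(\<Sum>e\<in>?E. \<alpha> e * H (h e) x) - (\<Sum>e\<in>?E. \<alpha> e * ?T e)\<bar> = \<bar>\<Sum>e\<in>?E. \<alpha> e * (H (h e) x - ?T e)\<bar>"
        by (simp add: sum_subtractf right_diff_distrib)
      also have "\<dots> \<le> (\<Sum>e\<in>?E. \<bar>\<alpha> e * (H (h e) x - ?T e)\<bar>)" by (rule sum_abs)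
      also have "\<dots> \<le> (\<Sum>e\<in>?E. \<bar>\<alpha> e\<bar> * \<epsilon>)"
        unfolding abs_mult by (intro sum_mono mult_left_mono h(2)) (use x in auto)
      also have "\<dots> = (\<Sum>e\<in>?E. \<bar>\<alpha> e\<bar>) * \<epsilon>" by (rule sum_distrib_right[symmetric])
      also have "\<dots> \<le> real q * \<epsilon>" by (rule mult_right_mono[OF sa]) (simp add: \<epsilon>_def)
      finally show ?thesis .
    qed
    ultimately have "\<bar>(\<Sum>e\<in>?E. \<alpha> e * H (h e) x) - f x\<bar> \<le> err" unfolding err_def by linarith
    then show ?thesis unfolding gx[OF x] using truncate_near[OF fM[OF x]] order_trans by blast
  qed
  have err0: "0 \<le> err" unfolding err_def \<epsilon>_def using Lb0 by simp
  have "(\<integral>x. (gn x - f x)\<^sup>2 \<partial>PX) \<le> (\<integral>x. err\<^sup>2 + (2 * M)\<^sup>2 * indicator bad x \<partial>PX)"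
  proof (rule integral_mono')
    show "integrable PX (\<lambda>x. err\<^sup>2 + (2 * M)\<^sup>2 * indicator bad x)"
      using bad_sets by (intro Bochner_Integration.integrable_add integrable_mult_right integrable_real_indicator)
        (auto simp: PX.emeasure_finite less_top[symmetric])
    fix x assume "x \<in> space PX"
    then have x: "x \<in> cube d" by (simp add: spX)
    show "(gn x - f x)\<^sup>2 \<le> err\<^sup>2 + (2 * M)\<^sup>2 * indicator bad x"
    proof (cases "x \<in> bad")
      case True
      have "\<bar>gn x - f x\<bar> \<le> \<bar>2 * M\<bar>"
        using sparse_relu_props(2)[OF gn p(1) M, of x] fM[OF x] by auto
      then have "(gn x - f x)\<^sup>2 \<le> (2 * M)\<^sup>2" by (simp only: abs_le_square_iff)
      then show ?thesis using True by (simp add: add_increasing)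
    next
      case False
      have "\<bar>gn x - f x\<bar> \<le> \<bar>err\<bar>" using near[OF x False] by linarith
      then have "(gn x - f x)\<^sup>2 \<le> err\<^sup>2" by (simp only: abs_le_square_iff)
      then show ?thesis using False by simp
    qed
  qed simp
  also have "\<dots> = err\<^sup>2 + (2 * M)\<^sup>2 * measure PX bad"
    using bad_sets by (simp add: PX.prob_space PX.emeasure_finite less_top[symmetric])
  also have "\<dots> \<le> err\<^sup>2 + (2 * M)\<^sup>2 * (real d / real R)"
    using bad_le by (intro add_left_mono mult_left_mono) auto
  finally show ?thesis using gn Lb0 unfolding err_def \<epsilon>_def by (intro bexI[of _ gn]) (auto simp: mult.assoc)
qed

subsection \<open>Asymptotics\<close>

lemma ceil_log2:
  assumes "n \<ge> 2"
  defines "D \<equiv> nat \<lceil>log 2 (real n)\<rceil>"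
  shows "int D = \<lceil>log 2 (real n)\<rceil>" "D \<ge> 1" "real n \<le> 2 ^ D" "real D \<le> 2 * ln (real n) + 1"
proof -
  have l1: "1 \<le> log 2 (real n)" using assms(1) by (simp add: le_log_iff)
  show D: "int D = \<lceil>log 2 (real n)\<rceil>" unfolding D_def using l1 by linarith
  show "D \<ge> 1" using D l1 by linarith
  have "log 2 (real n) \<le> real D" using D by linarith
  then have "real n \<le> 2 powr real D" using assms(1) by (simp add: log_le_iff)
  then show "real n \<le> 2 ^ D" by (simp add: powr_realpow)
  have "1 / 2 \<le> ln (2::real)" using ln2_ge_two_thirds by simp
  moreover have "0 \<le> ln (real n)" using assms(1) by simp
  ultimately have "ln (real n) \<le> (2 * ln (real n)) * ln 2"
    using mult_left_mono[of "1/2" "ln (2::real)" "2 * ln (real n)"] by simp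
  then have "log 2 (real n) \<le> 2 * ln (real n)" unfolding log_def by (simp add: divide_le_eq)
  then show "real D \<le> 2 * ln (real n) + 1" using D by linarith
qed

section \<open>Comparison with the prescribed depth, width and sparsity\<close>

lemma N_SH_bounds:
  assumes "n \<ge> 1" "\<beta> > 0"
  shows "real n powr (real d / (2 * \<beta> + real d)) \<le> real (N_SH d \<beta> n)"
    "real (N_SH d \<beta> n) \<le> 2 * real n powr (real d / (2 * \<beta> + real d))"
    "real n powr (real d / (2 * \<beta> + real d)) \<le> real n" "1 \<le> N_SH d \<beta> n"
proof -
  let ?y = "real n powr (real d / (2 * \<beta> + real d))"
  have y1: "1 \<le> ?y" using assms by (intro ge_one_powr_ge_zero) auto
  show "?y \<le> real (N_SH d \<beta> n)" unfolding N_SH_def by linarith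
  then show "1 \<le> N_SH d \<beta> n" using y1 by linarith
  show "real (N_SH d \<beta> n) \<le> 2 * ?y" unfolding N_SH_def using y1 by linarith
  have "?y \<le> real n powr 1" using assms by (intro powr_mono) auto
  then show "?y \<le> real n" using assms by simp
qed

lemma self_le_two_powr:
  fixes u :: real
  assumes "0 \<le> u"
  shows "u \<le> 2 powr u"
proof -
  have "Suc (nat \<lfloor>u\<rfloor>) \<le> 2 ^ nat \<lfloor>u\<rfloor>" by (rule Suc_leI) (rule less_exp)
  then have "real (Suc (nat \<lfloor>u\<rfloor>)) \<le> real (2 ^ nat \<lfloor>u\<rfloor>)" by (simp only: of_nat_le_iff)
  moreover have "u \<le> real (Suc (nat \<lfloor>u\<rfloor>))" using assms by linarith
  ultimately have "u \<le> 2 powr real (nat \<lfloor>u\<rfloor>)" by (simp add: powr_realpow)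
  also have "\<dots> \<le> 2 powr u" using assms by (intro powr_mono) auto
  finally show ?thesis .
qed

text \<open>The second factor in \<open>L_SH\<close>. It serves as the number of multiplication
  rounds, each of which has m + 5 layers.\<close>

definition log_depth :: "nat \<Rightarrow> real \<Rightarrow> nat" where
  "log_depth d \<beta> = nat (1 + \<lceil>log 2 (max (real d) \<beta>)\<rceil>)"

lemma log_depth_props:
  assumes "d \<ge> 1" "\<beta> > 0"
  shows "int (log_depth d \<beta>) = 1 + \<lceil>log 2 (max (real d) \<beta>)\<rceil>" "1 \<le> log_depth d \<beta>"
    "nat (\<lceil>\<beta>\<rceil> - 1) + 1 \<le> 2 ^ log_depth d \<beta>" "real (log_depth d \<beta>) \<le> real d + \<beta> + 2"
proof -
  let ?m = "max (real d) \<beta>"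
  have m1: "1 \<le> ?m" using assms by auto
  have l0: "0 \<le> log 2 ?m" using m1 by simp
  show e: "int (log_depth d \<beta>) = 1 + \<lceil>log 2 ?m\<rceil>" unfolding log_depth_def using l0 by linarith
  show "1 \<le> log_depth d \<beta>" using e l0 by linarith
  have "1 + log 2 ?m \<le> real (log_depth d \<beta>)" using e by linarith
  then have "log 2 (2 * ?m) \<le> real (log_depth d \<beta>)" using m1 by (simp add: log_mult)
  then have "2 * ?m \<le> 2 powr real (log_depth d \<beta>)" using m1 by (simp add: log_le_iff)
  then have p: "2 * ?m \<le> 2 ^ log_depth d \<beta>" by (simp add: powr_realpow)
  \<comment> \<open>Degree plus one is at most \<beta> + 1 \<le> 2 max (d, \<beta>), because d \<ge>
    1; so this many rounds suffice for a monomial with its coefficient.\<close>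
  have "real (nat (\<lceil>\<beta>\<rceil> - 1) + 1) \<le> \<beta> + 1" using assms by linarith
  also have "\<dots> \<le> 2 * ?m" using m1 by linarith
  also note p
  finally have "real (nat (\<lceil>\<beta>\<rceil> - 1) + 1) \<le> real (2 ^ log_depth d \<beta>)" by simp
  then show "nat (\<lceil>\<beta>\<rceil> - 1) + 1 \<le> 2 ^ log_depth d \<beta>" by (simp only: of_nat_le_iff)
  have "log 2 ?m \<le> ?m"
  proof -
    have "?m \<le> 2 powr ?m" using m1 by (intro self_le_two_powr) simp
    then show ?thesis using m1 by (simp add: log_le_iff)
  qed
  then show "real (log_depth d \<beta>) \<le> real d + \<beta> + 2" using e assms by linarith
qed

lemma L_SH_eq:
  assumes "n \<ge> 2" "d \<ge> 1" "\<beta> > 0"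
  shows "L_SH d \<beta> n = 8 + (nat \<lceil>log 2 (real n)\<rceil> + 5) * log_depth d \<beta>"
proof -
  have "8 + (\<lceil>log 2 (real n)\<rceil> + 5) * (1 + \<lceil>log 2 (max (real d) \<beta>)\<rceil>)
    = int (8 + (nat \<lceil>log 2 (real n)\<rceil> + 5) * log_depth d \<beta>)"
    using ceil_log2(1)[OF assms(1)] log_depth_props(1)[OF assms(2,3)] by simp
  then show ?thesis unfolding L_SH_def by (simp only: nat_int)
qed

text \<open>Makes a budget of \<open>N_SH\<close> parameters in each of the L + 1 layers admissible.
  The depth is at most ceil (log2 n) + 6 times a factor linear in d + \<beta>, which 141 (d +
  \<beta> + 1)^(3 + d) dominates.\<close>

lemma S_SH_ge:
  assumes n: "n \<ge> 2" and d: "d \<ge> 1" and \<beta>: "\<beta> > 0"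
  shows "(L_SH d \<beta> n + 1) * N_SH d \<beta> n \<le> S_SH d \<beta> n"
proof -
  define D where "D = nat \<lceil>log 2 (real n)\<rceil>"
  define t where "t = log_depth d \<beta>"
  have D: "int D = \<lceil>log 2 (real n)\<rceil>" "D \<ge> 1" using ceil_log2[OF n] by (auto simp: D_def)
  let ?b = "real d + \<beta> + 1"
  have b1: "1 \<le> ?b" using \<beta> by simp
  have t: "real t \<le> ?b + 1" using log_depth_props(4)[OF d \<beta>] by (simp add: t_def)
  have "real (L_SH d \<beta> n + 1) = 9 + (real D + 5) * real t"
    using L_SH_eq[OF n d \<beta>] by (simp add: D_def t_def)
  also have "\<dots> \<le> 9 * (real D + 6) + (real D + 6) * (?b + 1)"
    using t b1 by (intro add_mono mult_mono) auto
  also have "\<dots> = (real D + 6) * (?b + 10)" by (simp add: algebra_simps)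
  also have "\<dots> \<le> (real D + 6) * (141 * ?b)" using b1 by (intro mult_left_mono) auto
  also have "\<dots> \<le> (real D + 6) * (141 * ?b ^ (3 + d))"
    using b1 self_le_power[OF b1, of "3 + d"] by (intro mult_left_mono) auto
  finally have 1: "real (L_SH d \<beta> n + 1) \<le> (real D + 6) * (141 * ?b ^ (3 + d))" .
  have "real ((L_SH d \<beta> n + 1) * N_SH d \<beta> n) = real (L_SH d \<beta> n + 1) * real (N_SH d \<beta> n)"
    by (simp only: of_nat_mult)
  also have "\<dots> \<le> (real D + 6) * (141 * ?b ^ (3 + d)) * real (N_SH d \<beta> n)"
    using 1 by (intro mult_right_mono) auto
  also have "\<dots> = 141 * ?b ^ (3 + d) * real (N_SH d \<beta> n) * (of_int \<lceil>log 2 (real n)\<rceil> + 6)"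
    by (simp add: D(1)[symmetric] mult_ac)
  also have "\<dots> \<le> real (S_SH d \<beta> n)" unfolding S_SH_def by linarith
  finally show ?thesis by (simp only: of_nat_le_iff)
qed

lemma sparse_relu_zero:
  assumes "M \<ge> 0"
  shows "(\<lambda>_. 0) \<in> sparse_relu L p s M"
proof -
  have "(\<lambda>_. 0) = (\<lambda>x. truncate M (network L p (\<lambda>_ _ _. 0) (\<lambda>_ _. 0) x))"
    using assms by (simp add: network_def truncate_def)
  then show ?thesis unfolding sparse_relu_def by (intro CollectI exI[of _ "\<lambda>_ _ _. 0"] exI[of _ "\<lambda>_ _. 0"])
    (auto simp: case_prod_unfold)
qed

text \<open>For large n the grid is chosen just coarse enough that every layer costs at most N; for
  the finitely many other n the zero network does, at the price of a larger constant. The constant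
  is chosen before the covariate distribution and f, so it is uniform in both.\<close>

lemma F_SH_approximation:
  fixes \<beta> Lb M :: real and d :: nat
  assumes d: "d \<ge> 1" and \<beta>: "\<beta> > 0" and M: "M > 0"
  shows "\<exists>C\<ge>0. \<forall>n\<ge>1. \<forall>PX\<in>space (prob_algebra (cube_space d)). \<forall>f\<in>borel_measurable (cube_space d).
    f \<in> holder_ball d \<beta> Lb \<longrightarrow> (\<forall>x\<in>cube d. f x \<in> {-M..M}) \<longrightarrow>
    (\<exists>g\<in>F_SH d \<beta> M n. (\<integral>x. (g x - f x)\<^sup>2 \<partial>PX) \<le> C * real n powr (- 2 * \<beta> / (2 * \<beta> + real d)))"
proof -
  define kk where "kk = nat (\<lceil>\<beta>\<rceil> - 1)"
  define cE where "cE = card {\<eta>. \<eta> \<in> multi_indices d \<and> order_of d \<eta> \<le> kk}"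
  define q where "q = nat \<lceil>4 * (\<bar>Lb\<bar> + 1) * real d * real cE\<rceil>"
  define t where "t = log_depth d \<beta>"
  define J where "J = (d + 1 + cE) ^ (2 ^ t)"
  \<comment> \<open>Collects the factors of (K + 1)^d in all layer costs of
    \<open>network_approximation\<close>. With c = 1 / (2 A) the choice of K below gives A (K + 1)^d
    \<le> N.\<close>
  define A where "A = 40 * (d + 1) + 2 * cE + 24 * J + J * q * (q + 1)"
  define c where "c = 1 / (2 * real A)"
  define e where "e = 2 * \<beta> + real d"
  define \<rho> where "\<rho> = \<beta> / e"
  have A1: "A \<ge> 1" by (simp add: A_def)
  have c: "c > 0" "c \<le> 1 / 2" using A1 by (simp_all add: c_def divide_le_eq)
  have e: "e > 0" "\<beta> / e > 0" using \<beta> d by (simp_all add: e_def)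
  have \<rho>: "0 < \<rho>" "\<rho> \<le> 1 / 2" using \<beta> by (auto simp: \<rho>_def e_def divide_le_eq)
  \<comment> \<open>From here on c n^(1/e) \<ge> 1, so that the grid has K \<ge> 1.\<close>
  define n0 where "n0 = max 2 (nat \<lceil>(1 / c) powr e\<rceil>)"
  define C1 where "C1 = real d ^ kk * \<bar>Lb\<bar> * (2 / c) powr \<beta> + real q * 2 ^ t"
  define C where "C = max (C1\<^sup>2 + (2 * M)\<^sup>2 * real d) (M\<^sup>2 * real n0 powr (2 * \<rho>))"
  have C0: "C \<ge> 0" unfolding C_def by (intro max.coboundedI1) auto
  have rate: "- 2 * \<beta> / (2 * \<beta> + real d) = - (2 * \<rho>)" by (simp add: \<rho>_def e_def)
  show ?thesis
  proof (intro exI[of _ C] conjI C0 allI impI ballI)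
    fix n :: nat and PX f
    assume n1: "n \<ge> 1" and PX: "PX \<in> space (prob_algebra (cube_space d))"
      and fm: "f \<in> borel_measurable (cube_space d)" and f: "f \<in> holder_ball d \<beta> Lb"
      and fM: "\<forall>x\<in>cube d. f x \<in> {-M..M}"
    have nr: "real n powr (2 * \<rho>) > 0" using n1 by simp
    show "\<exists>g\<in>F_SH d \<beta> M n. (\<integral>x. (g x - f x)\<^sup>2 \<partial>PX) \<le> C * real n powr (- 2 * \<beta> / (2 * \<beta> + real d))"
    proof (cases "n \<ge> n0")
      case False
      have sPX: "sets PX = sets (cube_space d)" and pPX: "prob_space PX"
        using PX by (auto simp: space_prob_algebra)
      interpret PX: prob_space PX by (rule pPX)
      have spX: "space PX = cube d" using sets_eq_imp_space_eq[OF sPX] by (simp add: space_cube_space)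
      have "(\<integral>x. (0 - f x)\<^sup>2 \<partial>PX) \<le> (\<integral>x. M\<^sup>2 \<partial>PX)"
      proof (rule integral_mono')
        fix x assume "x \<in> space PX"
        then have "\<bar>f x\<bar> \<le> \<bar>M\<bar>" using fM by (auto simp: spX)
        then have "(f x)\<^sup>2 \<le> M\<^sup>2" by (simp only: abs_le_square_iff)
        then show "(0 - f x)\<^sup>2 \<le> M\<^sup>2" by simp
      qed auto
      also have "\<dots> = M\<^sup>2" by (simp add: PX.prob_space)
      also have "\<dots> \<le> M\<^sup>2 * (real n0 powr (2 * \<rho>) / real n powr (2 * \<rho>))"
      proof -
        have "real n powr (2 * \<rho>) \<le> real n0 powr (2 * \<rho>)" using False n1 \<rho> by (intro powr_mono2) auto
        then have "1 \<le> real n0 powr (2 * \<rho>) / real n powr (2 * \<rho>)" using nr by simp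
        then have "M\<^sup>2 * 1 \<le> M\<^sup>2 * (real n0 powr (2 * \<rho>) / real n powr (2 * \<rho>))"
          by (intro mult_left_mono) auto
        then show ?thesis by (simp only: mult_1_right)
      qed
      also have "\<dots> = M\<^sup>2 * real n0 powr (2 * \<rho>) * real n powr (- (2 * \<rho>))"
        by (simp add: powr_minus divide_inverse)
      also have "\<dots> \<le> C * real n powr (- (2 * \<rho>))"
        unfolding C_def by (intro mult_right_mono) auto
      finally have "(\<integral>x. (0 - f x)\<^sup>2 \<partial>PX) \<le> C * real n powr (- 2 * \<beta> / (2 * \<beta> + real d))"
        unfolding rate .
      moreover have "(\<lambda>_. 0) \<in> F_SH d \<beta> M n" unfolding F_SH_def by (rule sparse_relu_zero) (use M in simp)
      ultimately show ?thesis by (intro bexI[of _ "\<lambda>_. 0"])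
    next
      case True
      then have n2: "n \<ge> 2" by (simp add: n0_def)
      define D where "D = nat \<lceil>log 2 (real n)\<rceil>"
      have D: "D \<ge> 1" "real n \<le> 2 ^ D" using ceil_log2[OF n2] by (auto simp: D_def)
      define y where "y = real n powr (1 / e)"
      have y1: "1 \<le> y" unfolding y_def using n1 e by (intro ge_one_powr_ge_zero) auto
      have "(1 / c) powr e \<le> real n" using True unfolding n0_def by linarith
      then have "((1 / c) powr e) powr (1 / e) \<le> y" unfolding y_def using e by (intro powr_mono2) auto
      then have "1 / c \<le> y" using e c by (simp add: powr_powr)
      then have cy: "1 \<le> c * y" using c by (simp add: field_simps)
      define K where "K = nat \<lfloor>c * y\<rfloor>"
      have "1 \<le> \<lfloor>c * y\<rfloor>" using cy by (simp add: le_floor_iff)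
      then have K: "K \<ge> 1" "real K \<le> c * y" "c * y / 2 \<le> real K" unfolding K_def using cy by linarith+
      \<comment> \<open>The strip probability d / R enters the squared error and must be of order
        n^(- 2 \<rho>).\<close>
      define R where "R = nat \<lceil>real n powr (2 * \<rho>)\<rceil>"
      have nr1: "1 \<le> real n powr (2 * \<rho>)" using n1 \<rho> by (intro ge_one_powr_ge_zero) auto
      have R: "R \<ge> 1" "real n powr (2 * \<rho>) \<le> real R" "real R \<le> 2 * real n powr (2 * \<rho>)"
        unfolding R_def using nr1 by linarith+
      \<comment> \<open>4^r \<ge> 2^D \<ge> n suffices for the condition on K R, and 4^m \<ge>
        n^(1/2) \<ge> n^\<rho> for the multiplication error, since \<rho> \<le> 1/2. The divisions
        by 2 and 4 keep r + t m within the depth budget.\<close>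
      define r where "r = (D + 1) div 2"
      define m where "m = (D + 3) div 4"
      define N where "N = N_SH d \<beta> n"
      have KR: "K * R \<le> 4 ^ r"
      proof -
        have "real K * real R \<le> (c * y) * (2 * real n powr (2 * \<rho>))"
          using K R c y1 by (intro mult_mono) auto
        also have "\<dots> = (2 * c) * (y * real n powr (2 * \<rho>))" by simp
        also have "\<dots> \<le> 1 * (y * real n powr (2 * \<rho>))"
          by (rule mult_right_mono) (use c y1 nr1 in auto)
        also have "1 * (y * real n powr (2 * \<rho>)) = y * real n powr (2 * \<rho>)" by simp
        also have "\<dots> = real n powr (1 / e + 2 * \<rho>)" by (simp add: y_def powr_add)
        also have "1 / e + 2 * \<rho> = (1 + 2 * \<beta>) / e" by (simp add: \<rho>_def add_divide_distrib)
        \<comment> \<open>The exponent is at most 1 because d \<ge> 1.\<close>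
        also have "real n powr ((1 + 2 * \<beta>) / e) \<le> real n powr 1"
          using d n1 e by (intro powr_mono) (auto simp: e_def divide_le_eq)
        also have "\<dots> \<le> 2 ^ D" using D n1 by simp
        also have "\<dots> \<le> (2::real) ^ (2 * r)" by (intro power_increasing) (auto simp: r_def)
        also have "\<dots> = 4 ^ r" by (simp add: power_mult)
        finally have "real (K * R) \<le> real (4 ^ r)" by simp
        then show ?thesis by (simp only: of_nat_le_iff)
      qed
      have m4: "real n powr \<rho> \<le> 4 ^ m"
      proof -
        have "real n powr \<rho> \<le> real n powr (1 / 2)" using n1 \<rho> by (intro powr_mono) auto
        also have "\<dots> \<le> (2 ^ (4 * m)) powr (1 / 2)"
        proof (intro powr_mono2)
          have "real n \<le> 2 ^ D" by (rule D)
          also have "\<dots> \<le> (2::real) ^ (4 * m)" by (intro power_increasing) (auto simp: m_def)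
          finally show "real n \<le> 2 ^ (4 * m)" .
        qed auto
        also have "\<dots> = ((4 ^ m)\<^sup>2) powr (1 / 2)"
          by (simp add: power_mult[symmetric] power2_eq_square power_mult_distrib[symmetric] power_mult)
        also have "\<dots> = 4 ^ m" by (simp add: powr_half_sqrt)
        finally show ?thesis .
      qed
      have AK: "A * (K + 1) ^ d \<le> N"
      proof -
        have "real A * (real K + 1) ^ d \<le> real A * (2 * (c * y)) ^ d"
          using K cy by (intro mult_left_mono power_mono) auto
        also have "\<dots> = real A * ((1 / real A) * y) ^ d" by (simp add: c_def)
        also have "\<dots> = real A * (1 / real A) ^ d * y ^ d" by (simp only: power_mult_distrib mult.assoc)
        also have "\<dots> \<le> 1 * y ^ d"
        proof (rule mult_right_mono)
          have "(1 / real A) ^ d \<le> (1 / real A) ^ 1" using A1 d by (intro power_decreasing) auto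
          then have "real A * (1 / real A) ^ d \<le> real A * (1 / real A)" by (intro mult_left_mono) auto
          then show "real A * (1 / real A) ^ d \<le> 1" using A1 by simp
        qed (use y1 in auto)
        also have "y ^ d = real n powr (real d / e)"
          using n1 by (simp add: y_def powr_powr powr_realpow[symmetric])
        also have "1 * \<dots> \<le> real N" using N_SH_bounds(1)[OF n1 \<beta>, of d] by (simp add: N_def e_def)
        finally have "real (A * (K + 1) ^ d) \<le> real N" by (simp add: add.commute)
        then show ?thesis by (simp only: of_nat_le_iff)
      qed
      define X where "X = (K + 1) ^ d"
      have X1: "X \<ge> 1" by (simp add: X_def)
      have KX: "K + 1 \<le> X" unfolding X_def using self_le_power[of "K + 1" d] d by simp
      define Y where "Y = J * q * (q + 1)"
      have AX: "40 * (d * X) + 40 * X + 2 * (cE * X) + 24 * (J * X) + Y * X \<le> N"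
        using AK unfolding A_def X_def[symmetric] Y_def[symmetric] by (simp add: algebra_simps)
      have le: "J \<le> J * X" "Y \<le> Y * X" "cE \<le> cE * X" "d \<le> d * X" using X1 by (simp_all add: Suc_le_eq)
      have "d * (K + 1) \<le> d * X" using KX by (intro mult_left_mono) auto
      then have dK: "d * K + d \<le> d * X" by simp
      have costs: "20 * (d + 1) \<le> N" "2 * (d + 1) + cE * (X + 1) \<le> N" "24 * J \<le> N" "Y \<le> N"
        "3 * d * (K + 3) \<le> N" "d * (K + 2) + X * (2 * d + 1) \<le> N"
      proof -
        have "20 * (d + 1) = 20 * d + 20" "2 * (d + 1) + cE * (X + 1) = 2 * d + 2 + cE * X + cE"
          "3 * d * (K + 3) = 3 * (d * K) + 9 * d" "d * (K + 2) + X * (2 * d + 1) = d * K + 2 * d + 2 * (d * X) + X"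
          by (simp_all add: algebra_simps)
        then show "20 * (d + 1) \<le> N" "2 * (d + 1) + cE * (X + 1) \<le> N" "24 * J \<le> N" "Y \<le> N"
          "3 * d * (K + 3) \<le> N" "d * (K + 2) + X * (2 * d + 1) \<le> N"
          using AX le dK X1 by linarith+
      qed
      have w: "N \<le> W_SH d \<beta> n"
        unfolding W_SH_def N_def using d by (simp add: Suc_le_eq)
      have "\<exists>g\<in>sparse_relu (L_SH d \<beta> n) (p_SH d \<beta> n) (S_SH d \<beta> n) M. (\<integral>x. (g x - f x)\<^sup>2 \<partial>PX)
         \<le> (real d ^ kk * \<bar>Lb\<bar> * (1 / real K) powr \<beta> + real q * 2 ^ t / 4 ^ m)\<^sup>2 + (2 * M)\<^sup>2 * (real d / real R)"
      proof (rule network_approximation[where r=r and t=t and m=m and k=N and w="W_SH d \<beta> n", OF f fm _ \<beta> d PX _ K(1) R(1) KR w,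
            folded kk_def, folded cE_def, folded q_def, folded J_def])
        show "\<And>x. x \<in> cube d \<Longrightarrow> f x \<in> {-M..M}" using fM by blast
        show "kk + 1 \<le> 2 ^ t" using log_depth_props(3)[OF d \<beta>] by (simp add: kk_def t_def)
        show "20 * (d + 1) \<le> N" "2 * (d + 1) + cE * ((K + 1) ^ d + 1) \<le> N"
          "24 * J \<le> N" "J * q * (q + 1) \<le> N" "3 * d * (K + 3) \<le> N"
          "d * (K + 2) + (K + 1) ^ d * (2 * d + 1) \<le> N"
          using costs unfolding X_def Y_def by blast+
        show "p_SH d \<beta> n 0 = d" by (simp add: p_SH_def)
        show "p_SH d \<beta> n l = W_SH d \<beta> n" if "1 \<le> l" "l \<le> L_SH d \<beta> n" for l using that by (simp add: p_SH_def)
        show "p_SH d \<beta> n (Suc (L_SH d \<beta> n)) = 1" by (simp add: p_SH_def)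
        show "(L_SH d \<beta> n + 1) * N \<le> S_SH d \<beta> n" unfolding N_def by (rule S_SH_ge[OF n2 d \<beta>])
        have t1: "1 \<le> t" using log_depth_props(2)[OF d \<beta>] by (simp add: t_def)
        have "r + t * m \<le> 1 + t * D"
        proof -
          have "real r \<le> (real D + 1) / 2" "real m \<le> (real D + 3) / 4" by (simp_all add: r_def m_def real_of_nat_div)
          then have "real r + real t * real m \<le> (real D + 1) / 2 + real t * ((real D + 3) / 4)"
            by (intro add_mono mult_left_mono) auto
          also have "\<dots> \<le> 1 + real t * real D"
          proof -
            \<comment> \<open>The difference of the two sides is ((t - 1) (3 D - 3) + D - 1) /
              4.\<close>
            have "0 \<le> (real t - 1) * (3 * real D - 3)" using t1 D(1) by (intro mult_nonneg_nonneg) auto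
            then show ?thesis using D(1) by (simp add: field_simps)
          qed
          finally have "real (r + t * m) \<le> real (1 + t * D)" by simp
          then show ?thesis by (simp only: of_nat_le_iff)
        qed
        then show "r + 6 + t * (m + 5) + 1 \<le> L_SH d \<beta> n"
          unfolding L_SH_eq[OF n2 d \<beta>] D_def[symmetric] t_def[symmetric] by (simp add: algebra_simps)
      qed
      then obtain g where g: "g \<in> F_SH d \<beta> M n" "(\<integral>x. (g x - f x)\<^sup>2 \<partial>PX)
         \<le> (real d ^ kk * \<bar>Lb\<bar> * (1 / real K) powr \<beta> + real q * 2 ^ t / 4 ^ m)\<^sup>2 + (2 * M)\<^sup>2 * (real d / real R)"
        unfolding F_SH_def by blast
      let ?z = "real n powr (- \<rho>)"
      have z2: "?z\<^sup>2 = real n powr (- (2 * \<rho>))" by (simp add: power2_eq_square powr_add[symmetric])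
      have "(1 / real K) powr \<beta> \<le> (2 / c * (1 / y)) powr \<beta>"
        using K c cy y1 \<beta> by (intro powr_mono2) (auto simp: field_simps)
      also have "\<dots> = (2 / c) powr \<beta> * (1 / y) powr \<beta>" by (rule powr_mult)
      also have "(1 / y) powr \<beta> = ?z"
        using n1 by (simp add: y_def powr_divide powr_powr powr_minus_divide \<rho>_def)
      finally have e1: "(1 / real K) powr \<beta> \<le> (2 / c) powr \<beta> * ?z" .
      have e2: "1 / 4 ^ m \<le> ?z" using m4 n1 by (simp add: powr_minus_divide frac_le)
      have "real d ^ kk * \<bar>Lb\<bar> * (1 / real K) powr \<beta> + real q * 2 ^ t / 4 ^ m
         \<le> real d ^ kk * \<bar>Lb\<bar> * ((2 / c) powr \<beta> * ?z) + real q * 2 ^ t * ?z"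
        using mult_left_mono[OF e2, of "real q * 2 ^ t"] e1 by (intro add_mono mult_left_mono) auto
      also have "\<dots> = C1 * ?z" by (simp add: C1_def algebra_simps)
      finally have "(real d ^ kk * \<bar>Lb\<bar> * (1 / real K) powr \<beta> + real q * 2 ^ t / 4 ^ m)\<^sup>2 \<le> (C1 * ?z)\<^sup>2"
        by (intro power_mono) auto
      moreover have "(2 * M)\<^sup>2 * (real d / real R) \<le> (2 * M)\<^sup>2 * (real d * ?z\<^sup>2)"
      proof (rule mult_left_mono)
        have "real d / real R \<le> real d / real n powr (2 * \<rho>)" using R(2) nr by (intro frac_le) auto
        then show "real d / real R \<le> real d * ?z\<^sup>2" unfolding z2 by (simp add: powr_minus_divide)
      qed simp
      ultimately have "(\<integral>x. (g x - f x)\<^sup>2 \<partial>PX) \<le> (C1\<^sup>2 + (2 * M)\<^sup>2 * real d) * ?z\<^sup>2"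
        using g(2) by (simp add: power_mult_distrib algebra_simps)
      also have "\<dots> \<le> C * ?z\<^sup>2" unfolding C_def by (intro mult_right_mono) auto
      finally show ?thesis using g(1) unfolding z2 rate by blast
    qed
  qed
qed

text \<open>Radius 1 / n needs about n (L + 1) (w + 1)^(L + 1) grid points per unit, whose logarithm
  is of order L ln w and hence (ln n)^2. Multiplied by the sparsity, of order N ln n, this gives the
  third power.\<close>

lemma F_SH_entropy:
  fixes \<beta> M :: real and d :: nat
  assumes d: "d \<ge> 1" and \<beta>: "\<beta> > 0" and M: "M > 0"
  shows "\<exists>C\<ge>0. \<forall>n\<ge>3. \<exists>Net. finite Net \<and> (\<forall>g\<in>Net. g \<in> borel_measurable (cube_space d)) \<and>
    (\<forall>g\<in>Net. \<forall>x. g x \<in> {-M..M}) \<and>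
    (\<forall>f\<in>F_SH d \<beta> M n. \<exists>g\<in>Net. \<forall>x\<in>cube d. \<bar>f x - g x\<bar> \<le> 1 / real n) \<and>
    ln (real (card Net) + 1) \<le> C * real n powr (real d / (2 * \<beta> + real d)) * ln (real n) ^ 3"
proof -
  define t where "t = log_depth d \<beta>"
  define cL where "cL = 8 + 8 * real t"
  define cw where "cw = 12 * real (d + nat \<lceil>\<beta>\<rceil>) + 1"
  define CB where "CB = 4 + 2 * cL + (cL + 3) * (cw + 1)"
  define P where "P = (real d + \<beta> + 1) ^ (3 + d)"
  define C where "C = 1 + (2538 * P + 1) * CB"
  have pos: "0 \<le> cL" "1 \<le> cw" "0 \<le> CB" "0 \<le> P" "0 \<le> C"
    using \<beta> by (simp_all add: cL_def cw_def CB_def P_def C_def)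
  show ?thesis
  proof (intro exI[of _ C] conjI pos allI impI)
    fix n :: nat assume n3: "n \<ge> 3"
    then have n2: "n \<ge> 2" and n1: "n \<ge> 1" by auto
    let ?l = "ln (real n)" and ?y = "real n powr (real d / (2 * \<beta> + real d))"
    define D where "D = nat \<lceil>log 2 (real n)\<rceil>"
    define L where "L = L_SH d \<beta> n"
    define w where "w = W_SH d \<beta> n"
    define s where "s = S_SH d \<beta> n"
    define m where "m = n * (L + 1) * (w + 1) ^ Suc L"
    have l1: "1 \<le> ?l"
    proof -
      have "exp 1 \<le> real n" using exp_le n3 by linarith
      then show ?thesis using n1 by (simp add: ln_ge_iff)
    qed
    have l2: "?l \<le> ?l\<^sup>2" using l1 by (simp add: power2_eq_square)
    have y1: "1 \<le> ?y" using n1 \<beta> by (intro ge_one_powr_ge_zero) auto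
    have D: "int D = \<lceil>log 2 (real n)\<rceil>" "real D \<le> 3 * ?l" using ceil_log2[OF n2] l1 by (auto simp: D_def)
    have "real L = 8 + (real D + 5) * real t" using L_SH_eq[OF n2 d \<beta>] by (simp add: L_def D_def t_def)
    also have "\<dots> \<le> 8 * ?l + (8 * ?l) * real t" using l1 D by (intro add_mono mult_right_mono) auto
    finally have Lle: "real L \<le> cL * ?l" by (simp add: cL_def algebra_simps)
    have N: "real (N_SH d \<beta> n) \<le> 2 * ?y" "?y \<le> real n" "1 \<le> N_SH d \<beta> n" using N_SH_bounds[OF n1 \<beta>] by auto
    have "6 * (d + nat \<lceil>\<beta>\<rceil>) * 1 \<le> w" unfolding w_def W_SH_def using N(3) by (intro mult_left_mono) auto
    then have "6 * d + 6 * nat \<lceil>\<beta>\<rceil> \<le> w" by simp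
    then have w1: "w \<ge> 1" "d \<le> w" using d by linarith+
    have wle: "real (w + 1) \<le> cw * real n"
    proof -
      have "real w = 6 * real (d + nat \<lceil>\<beta>\<rceil>) * real (N_SH d \<beta> n)" by (simp add: w_def W_SH_def)
      also have "\<dots> \<le> 6 * real (d + nat \<lceil>\<beta>\<rceil>) * (2 * real n)" using N by (intro mult_left_mono) auto
      finally have "real w \<le> 12 * real (d + nat \<lceil>\<beta>\<rceil>) * real n" by (simp add: algebra_simps)
      then show ?thesis using n1 by (simp add: cw_def distrib_right)
    qed
    have m1: "m \<ge> 1" using n1 by (simp add: m_def Suc_le_eq)
    obtain Net where Net: "finite Net"
      "real (card Net) \<le> (real (2 * (L + 1) * w * w * (2 * m + 1)) + 1) ^ s"
      "\<And>g. g \<in> Net \<Longrightarrow> g \<in> borel_measurable (cube_space d)"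
      "\<And>g x. g \<in> Net \<Longrightarrow> g x \<in> {-M..M}"
      "\<And>f. f \<in> sparse_relu L (p_SH d \<beta> n) s M \<Longrightarrow>
       \<exists>g\<in>Net. \<forall>x\<in>cube d. \<bar>f x - g x\<bar> \<le> (real L + 1) * (1 / real m) * (real w + 1) ^ Suc L"
    proof (rule sparse_relu_cover[where L=L and p="p_SH d \<beta> n" and w=w and M=M and m=m and s=s and d=d])
      show "p_SH d \<beta> n l \<le> w" if "l \<le> L" for l using w1 that by (auto simp: p_SH_def w_def L_def)
    qed (use M m1 w1 in \<open>auto simp: p_SH_def L_def\<close>)
    have res: "(real L + 1) * (1 / real m) * (real w + 1) ^ Suc L = 1 / real n"
    proof -
      have "real m = real n * (real L + 1) * (real w + 1) ^ Suc L"
        by (simp add: m_def algebra_simps)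
      moreover have "(real L + 1) \<noteq> 0" "(real w + 1) ^ Suc L \<noteq> 0" by (simp_all add: add_nonneg_eq_0_iff)
      ultimately show ?thesis using n1 by (simp add: divide_simps del: power_Suc)
    qed
    define B where "B = real (2 * (L + 1) * w * w * (2 * m + 1)) + 1"
    have B1: "1 \<le> B" by (simp add: B_def)
    have Ble: "B \<le> 8 * real n * (real L + 1)\<^sup>2 * (real (w + 1)) ^ (L + 3)"
    proof -
      have "2 * m + 1 \<le> 3 * m" using m1 by simp
      then have "2 * (L + 1) * w * w * (2 * m + 1) + 1 \<le> 2 * (L + 1) * w * w * (3 * m) + 1 * 1 * 1 * (1 * m)"
        using m1 by (intro add_mono mult_left_mono) auto
      also have "\<dots> \<le> 2 * (L + 1) * (w + 1) * (w + 1) * (3 * m) + 2 * (L + 1) * (w + 1) * (w + 1) * (1 * m)"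
        by (intro add_mono mult_mono) auto
      also have "\<dots> = 8 * n * (L + 1)\<^sup>2 * (w + 1) ^ (L + 3)"
      proof -
        define u v where "u = L + 1" and "v = w + 1"
        have m: "m = n * u * v ^ Suc L" by (simp only: m_def u_def v_def)
        have v3: "v ^ (L + 3) = v ^ Suc L * (v * v)" by (simp add: numeral_3_eq_3)
        have "2 * u * v * v * (3 * m) + 2 * u * v * v * (1 * m) = 8 * u * (v * v) * m" by simp
        also have "\<dots> = 8 * n * u\<^sup>2 * v ^ (L + 3)" unfolding v3 m power2_eq_square by (simp only: mult_ac)
        finally show ?thesis unfolding u_def v_def .
      qed
      finally have "real (2 * (L + 1) * w * w * (2 * m + 1) + 1) \<le> real (8 * n * (L + 1)\<^sup>2 * (w + 1) ^ (L + 3))"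
        by (simp only: of_nat_le_iff)
      then show ?thesis unfolding B_def by (simp add: add.commute)
    qed
    have "ln B \<le> ln (8 * real n * (real L + 1)\<^sup>2 * (real (w + 1)) ^ (L + 3))"
      using Ble B1 by (subst ln_le_cancel_iff) auto
    also have "\<dots> = ln 8 + ?l + 2 * ln (real L + 1) + real (L + 3) * ln (real (w + 1))"
      using n1 by (simp add: ln_mult ln_realpow)
    also have "\<dots> \<le> 3 * ?l\<^sup>2 + ?l\<^sup>2 + 2 * (cL * ?l\<^sup>2) + ((cL + 3) * ?l) * ((cw + 1) * ?l)"
    proof (intro add_mono mult_left_mono mult_mono)
      have "ln (8::real) = 3 * ln 2" using ln_realpow[of 2 3] by simp
      also have "\<dots> \<le> 3 * 1" using ln_2_less_1 by simp
      also have "\<dots> \<le> 3 * ?l\<^sup>2" using l1 l2 by simp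
      finally show "ln 8 \<le> 3 * ?l\<^sup>2" .
      have "ln (real L + 1) \<le> real L" using ln_add_one_self_le_self[of "real L"] by (simp add: add.commute)
      also have "\<dots> \<le> cL * ?l" by (rule Lle)
      also have "\<dots> \<le> cL * ?l\<^sup>2" using l2 pos by (intro mult_left_mono) auto
      finally show "ln (real L + 1) \<le> cL * ?l\<^sup>2" .
      show "real (L + 3) \<le> (cL + 3) * ?l" using Lle l1 by (simp add: algebra_simps)
      have "ln (real (w + 1)) \<le> ln (cw * real n)" using wle pos n1 by (subst ln_le_cancel_iff) auto
      also have "\<dots> = ln cw + ?l" using pos n1 by (simp add: ln_mult)
      also have "\<dots> \<le> cw * ?l + ?l"
      proof -
        have "ln cw \<le> cw * 1" using ln_le_minus_one[of cw] pos by simp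
        also have "\<dots> \<le> cw * ?l" using l1 pos by (intro mult_left_mono) auto
        finally show ?thesis by simp
      qed
      finally show "ln (real (w + 1)) \<le> (cw + 1) * ?l" by (simp add: algebra_simps)
    qed (use l1 l2 pos in auto)
    also have "\<dots> = CB * ?l\<^sup>2" by (simp add: CB_def power2_eq_square algebra_simps)
    finally have lnB: "ln B \<le> CB * ?l\<^sup>2" .
    have sle: "real s \<le> (2538 * P + 1) * (?y * ?l)"
    proof -
      have "real s \<le> 141 * P * real (N_SH d \<beta> n) * (real D + 6) + 1"
      proof -
        have "0 \<le> 141 * P * real (N_SH d \<beta> n) * (of_int \<lceil>log 2 (real n)\<rceil> + 6)"
          using pos D(1)[symmetric] by simp
        then show ?thesis unfolding s_def S_SH_def P_def[symmetric] D(1)[symmetric] by simp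
      qed
      \<comment> \<open>\<open>N_SH\<close> is at most twice the power of n, and D + 6 \<le> 9 ln n;
        141 * 2 * 9 = 2538.\<close>
      also have "\<dots> \<le> 141 * P * (2 * ?y) * (9 * ?l) + 1 * 1"
        using pos N D l1 by (intro add_mono mult_mono mult_left_mono) auto
      also have "\<dots> \<le> 141 * P * (2 * ?y) * (9 * ?l) + ?y * ?l"
        using y1 l1 by (intro add_left_mono mult_mono) auto
      finally show ?thesis by (simp add: algebra_simps)
    qed
    have "ln (real (card Net) + 1) \<le> ln (2 * B ^ s)"
    proof (subst ln_le_cancel_iff)
      have "1 \<le> B ^ s" by (rule one_le_power[OF B1])
      then show "real (card Net) + 1 \<le> 2 * B ^ s" using Net(2) unfolding B_def[symmetric] by linarith
    qed (use B1 in auto)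
    also have "\<dots> = ln 2 + real s * ln B" using B1 by (simp add: ln_mult ln_realpow)
    also have "\<dots> \<le> ?y * ?l ^ 3 + ((2538 * P + 1) * (?y * ?l)) * (CB * ?l\<^sup>2)"
    proof (intro add_mono mult_mono)
      have "ln (2::real) \<le> 1 * 1" using ln_2_less_1 by simp
      also have "\<dots> \<le> ?y * ?l ^ 3" using y1 l1 by (intro mult_mono one_le_power) auto
      finally show "ln 2 \<le> ?y * ?l ^ 3" .
    qed (use sle lnB pos B1 l1 y1 in auto)
    also have "\<dots> = C * ?y * ?l ^ 3" by (simp add: C_def power2_eq_square power3_eq_cube algebra_simps)
    finally have ent: "ln (real (card Net) + 1) \<le> C * ?y * ?l ^ 3" .
    show "\<exists>Net. finite Net \<and> (\<forall>g\<in>Net. g \<in> borel_measurable (cube_space d)) \<and>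
      (\<forall>g\<in>Net. \<forall>x. g x \<in> {-M..M}) \<and>
      (\<forall>f\<in>F_SH d \<beta> M n. \<exists>g\<in>Net. \<forall>x\<in>cube d. \<bar>f x - g x\<bar> \<le> 1 / real n) \<and>
      ln (real (card Net) + 1) \<le> C * ?y * ?l ^ 3"
      using Net(1,3,4,5) ent unfolding F_SH_def L_def[symmetric] s_def[symmetric] res
      by (intro exI[of _ Net] conjI ballI allI) auto
  qed
qed

section \<open>Combination of approximation, entropy and the oracle inequality\<close>

theorem theorem10:
  fixes \<alpha> \<mu>low \<mu>up \<beta> M L\<beta> :: real and d :: nat
  assumes "0 < \<alpha>" and "\<alpha> < 1" and "d \<ge> 1"
  shows "\<exists>C_rate>0. \<exists>C_conf>0.
    \<forall>PX \<in> space (prob_algebra (cube_space d)).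
    \<forall>K \<in> cube_space d \<rightarrow>\<^sub>M prob_algebra borel.
      bounded_model d M K \<longrightarrow> density_bounds d M \<mu>low \<mu>up K \<longrightarrow> smooth_quantiles d \<alpha> \<beta> L\<beta> K \<longrightarrow>
      (\<forall>\<tau> \<in> {\<alpha> / 2, 1 - \<alpha> / 2}. \<forall>n \<ge> n_SH d \<beta> L\<beta>. \<forall>fhat.
         measurable_erm d M \<tau> n (F_SH d \<beta> M n) fhat \<longrightarrow>
         (\<forall>\<delta>. 0 < \<delta> \<and> \<delta> < 1 \<longrightarrow>
            measure (sample_distr d PX K n)
              {D \<in> space (sample_distr d PX K n).
                 L2_norm PX (\<lambda>x. fhat D x - cond_quantile K \<tau> x)
                 \<le> C_rate * real n powr (- \<beta> / (2 * \<beta> + real d)) * ln (real n) powr (3 / 2) +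
                   C_conf * sqrt (ln (1 / \<delta>) / real n)}
            \<ge> 1 - \<delta>))"
proof (cases "\<beta> > 0 \<and> M > 0 \<and> \<mu>low > 0")
  case False
  \<comment> \<open>The constants are chosen before the kernel, so parameter values that no model
    admits have to be covered; for them the claim is vacuous.\<close>
  then show ?thesis
    by (intro exI[of _ 1] conjI zero_less_one)
      (auto simp: bounded_model_def density_bounds_def smooth_quantiles_def)
next
  case True
  then have \<beta>: "\<beta> > 0" and M: "M > 0" and \<mu>: "\<mu>low > 0" by auto
  obtain CA where CA: "CA \<ge> 0" and approx: "\<And>n PX f. n \<ge> 1 \<Longrightarrow> PX \<in> space (prob_algebra (cube_space d)) \<Longrightarrow>
      f \<in> borel_measurable (cube_space d) \<Longrightarrow> f \<in> holder_ball d \<beta> L\<beta> \<Longrightarrow> \<forall>x\<in>cube d. f x \<in> {-M..M} \<Longrightarrow>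
      \<exists>g\<in>F_SH d \<beta> M n. (\<integral>x. (g x - f x)\<^sup>2 \<partial>PX) \<le> CA * real n powr (- 2 * \<beta> / (2 * \<beta> + real d))"
    using F_SH_approximation[OF assms(3) \<beta> M, of L\<beta>] by blast
  obtain CE where CE: "CE \<ge> 0" and entropy: "\<And>n. n \<ge> 3 \<Longrightarrow> \<exists>Net. finite Net \<and>
      (\<forall>g\<in>Net. g \<in> borel_measurable (cube_space d)) \<and> (\<forall>g\<in>Net. \<forall>x. g x \<in> {-M..M}) \<and>
      (\<forall>f\<in>F_SH d \<beta> M n. \<exists>g\<in>Net. \<forall>x\<in>cube d. \<bar>f x - g x\<bar> \<le> 1 / real n) \<and>
      ln (real (card Net) + 1) \<le> CE * real n powr (real d / (2 * \<beta> + real d)) * ln (real n) ^ 3"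
    using F_SH_entropy[OF assms(3) \<beta> M] by blast
  define lam where "lam = min (\<mu>low / 4) (1 / (2 * M))"
  \<comment> \<open>The absolute value is taken because no kernel is fixed yet from which the sign
    of \<open>\<mu>up\<close> would follow.\<close>
  define U where "U = \<bar>\<mu>up\<bar> / 2 + lam"
  \<comment> \<open>Collects the factors of n^(- 2 \<beta> / (2 \<beta> + d)) (ln n)^3 in the oracle
    bound: approximation error, entropy, the net radius 1 / n and its square. \<open>CD\<close> is
    the factor of ln (1 / \<delta>) / n.\<close>
  define CT where "CT = 8 / \<mu>low * (U * CA + 2 * CE / lam + 1) + 2"
  define CD where "CD = 16 / (\<mu>low * lam)"
  have lam: "lam > 0" using \<mu> M by (simp add: lam_def)
  have U: "U \<ge> 0" using lam by (simp add: U_def)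
  have CT: "CT > 0" unfolding CT_def using \<mu> U CA CE lam by (intro add_nonneg_pos mult_nonneg_nonneg add_nonneg_nonneg) auto
  have CD: "CD > 0" unfolding CD_def using \<mu> lam by simp
  show ?thesis
  proof (rule exI[of _ "sqrt CT"], rule conjI, goal_cases pos main)
    case pos
    then show ?case using CT by simp
  next
    case main
    show ?case
    proof (rule exI[of _ "sqrt CD"], intro conjI ballI allI impI)
    show "0 < sqrt CD" using CD by simp
    fix PX K \<tau> n fhat and \<delta> :: real
    assume PX: "PX \<in> space (prob_algebra (cube_space d))" and K: "K \<in> cube_space d \<rightarrow>\<^sub>M prob_algebra borel"
      and bm: "bounded_model d M K" and db: "density_bounds d M \<mu>low \<mu>up K"
      and sm: "smooth_quantiles d \<alpha> \<beta> L\<beta> K" and \<tau>: "\<tau> \<in> {\<alpha> / 2, 1 - \<alpha> / 2}"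
      and n: "n \<ge> n_SH d \<beta> L\<beta>" and erm: "measurable_erm d M \<tau> n (F_SH d \<beta> M n) fhat"
      and \<delta>: "0 < \<delta> \<and> \<delta> < 1"
    interpret Q: quantile_model d M \<mu>low \<mu>up \<tau> PX K
      using PX K bm db \<tau> assms by unfold_locales auto
    \<comment> \<open>The last entry of \<open>n_SH\<close> is at least exp 3, as (2 \<beta> + d) /
      (2 \<beta>) \<ge> 1. Consequently ln n \<ge> 1, and terms without a logarithm can be absorbed
      into those with one.\<close>
    have n3: "n \<ge> 3"
    proof -
      have "3 \<le> 3 * (2 * \<beta> + real d) / (2 * \<beta>)" using \<beta> by (simp add: le_divide_eq)
      then have "exp 3 \<le> exp (3 * (2 * \<beta> + real d) / (2 * \<beta>))" by simp
      also have "\<dots> \<le> real (n_SH d \<beta> L\<beta>)" unfolding n_SH_def by linarith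
      also have "\<dots> \<le> real n" using n by simp
      finally have "exp 3 \<le> real n" .
      then show ?thesis using exp_ge_add_one_self[of "3::real"] by linarith
    qed
    then have n1: "n \<ge> 1" and nr: "real n > 0" by auto
    let ?f = "cond_quantile K \<tau>" and ?l = "ln (real n)"
    define z where "z = real n powr (- \<beta> / (2 * \<beta> + real d))"
    have e0: "2 * \<beta> + real d > 0" using \<beta> by simp
    have z2: "real n powr (- 2 * \<beta> / (2 * \<beta> + real d)) = z\<^sup>2"
      by (simp add: z_def power2_eq_square powr_add[symmetric] add_divide_distrib[symmetric])
    have zy: "real n powr (real d / (2 * \<beta> + real d)) / real n = z\<^sup>2"
    proof -
      have "real n powr (real d / (2 * \<beta> + real d)) / real n = real n powr (real d / (2 * \<beta> + real d) - 1)"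
        using nr by (simp add: powr_diff)
      also have "real d / (2 * \<beta> + real d) - 1 = - 2 * \<beta> / (2 * \<beta> + real d)"
        using e0 by (simp add: field_simps)
      finally show ?thesis unfolding z2 .
    qed
    have l1: "1 \<le> ?l"
    proof -
      have "exp 1 \<le> real n" using exp_le n3 by linarith
      then show ?thesis using n1 by (simp add: ln_ge_iff)
    qed
    have l3: "1 \<le> ?l ^ 3" using l1 by simp
    have nz: "1 / real n \<le> z\<^sup>2"
    proof -
      have "1 \<le> real n powr (real d / (2 * \<beta> + real d))" using n1 \<beta> by (intro ge_one_powr_ge_zero) auto
      then show ?thesis unfolding zy[symmetric] using nr by (simp add: divide_right_mono)
    qed
    have zl: "z\<^sup>2 \<le> z\<^sup>2 * ?l ^ 3" using mult_left_mono[OF l3, of "z\<^sup>2"] by simp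
    have fM: "\<forall>x\<in>cube d. ?f x \<in> {-M..M}" using Q.q_props(1) by blast
    have "?f \<in> holder_ball d \<beta> L\<beta>" using sm \<tau> by (auto simp: smooth_quantiles_def)
    from approx[OF n1 PX Q.q_measurable this fM] obtain g where g: "g \<in> F_SH d \<beta> M n"
      "(\<integral>x. (g x - ?f x)\<^sup>2 \<partial>PX) \<le> CA * z\<^sup>2" unfolding z2 by blast
    obtain Net where "finite Net" and Net0: "\<forall>g\<in>Net. g \<in> borel_measurable (cube_space d)"
      "\<forall>g\<in>Net. \<forall>x. g x \<in> {-M..M}" "\<forall>f\<in>F_SH d \<beta> M n. \<exists>g\<in>Net. \<forall>x\<in>cube d. \<bar>f x - g x\<bar> \<le> 1 / real n"
      and ent: "ln (real (card Net) + 1) \<le> CE * real n powr (real d / (2 * \<beta> + real d)) * ?l ^ 3"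
      using entropy[OF n3] by (elim exE conjE) (rule that)
    note Net = \<open>finite Net\<close> Net0[THEN bspec]
    have p0: "p_SH d \<beta> n 0 = d" by (simp add: p_SH_def)
    note gp = sparse_relu_props[OF g(1)[unfolded F_SH_def] p0 less_imp_le[OF M]]
    define t where "t = ln ((real (card Net) + 1) / \<delta>)"
    define V where "V = 8 / \<mu>low * ((\<mu>up / 2 + lam) * (CA * z\<^sup>2) + 2 * t / (real n * lam) + 1 / real n) + 2 * (1 / real n)\<^sup>2"
    have ora: "1 - \<delta> \<le> measure (sample_distr d PX K n)
      {D \<in> space (sample_distr d PX K n). (\<integral>x. (fhat D x - ?f x)\<^sup>2 \<partial>PX) \<le> V}"
      unfolding V_def t_def lam_def
      by (rule Q.erm_oracle_inequality[OF Net(1,2) _ Net(4) g(1) gp(1) gp(2) g(2) erm n1])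
        (use Net(3) \<delta> in \<open>blast+\<close>)
    have V: "V \<le> CT * (z\<^sup>2 * ?l ^ 3) + CD * (ln (1 / \<delta>) / real n)"
    proof -
      have "t = ln (real (card Net) + 1) + ln (1 / \<delta>)"
        using \<delta> by (simp add: t_def ln_div)
      then have "t / real n \<le> (CE * real n powr (real d / (2 * \<beta> + real d)) * ?l ^ 3 + ln (1 / \<delta>)) / real n"
        using ent nr by (intro divide_right_mono) auto
      also have "\<dots> = CE * (real n powr (real d / (2 * \<beta> + real d)) / real n) * ?l ^ 3 + ln (1 / \<delta>) / real n"
        by (simp add: add_divide_distrib)
      finally have tn: "t / real n \<le> CE * (z\<^sup>2 * ?l ^ 3) + ln (1 / \<delta>) / real n" unfolding zy by simp
      define Z where "Z = z\<^sup>2 * ?l ^ 3"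
      define T where "T = ln (1 / \<delta>) / real n"
      have "2 * t / (real n * lam) = 2 / lam * (t / real n)" by simp
      also have "\<dots> \<le> 2 / lam * (CE * Z + T)" using tn lam unfolding Z_def T_def by (intro mult_left_mono) auto
      finally have a1: "2 * t / (real n * lam) \<le> 2 / lam * (CE * Z + T)" .
      have "(\<mu>up / 2 + lam) * (CA * z\<^sup>2) \<le> U * (CA * Z)"
        unfolding U_def Z_def using zl CA lam by (intro mult_mono) auto
      then have "(\<mu>up / 2 + lam) * (CA * z\<^sup>2) + 2 * t / (real n * lam) + 1 / real n \<le> U * (CA * Z) + 2 / lam * (CE * Z + T) + Z"
        using a1 nz zl unfolding Z_def by linarith
      then have "8 / \<mu>low * ((\<mu>up / 2 + lam) * (CA * z\<^sup>2) + 2 * t / (real n * lam) + 1 / real n)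
         \<le> 8 / \<mu>low * (U * (CA * Z) + 2 / lam * (CE * Z + T) + Z)"
        using \<mu> by (intro mult_left_mono) auto
      moreover have "(1 / real n)\<^sup>2 \<le> Z"
      proof -
        have "(1 / real n)\<^sup>2 \<le> 1 / real n" using n1 by (simp add: power2_eq_square divide_simps)
        then show ?thesis using nz zl unfolding Z_def by linarith
      qed
      ultimately have "V \<le> 8 / \<mu>low * (U * (CA * Z) + 2 / lam * (CE * Z + T) + Z) + 2 * Z"
        unfolding V_def by linarith
      also have "\<dots> = CT * Z + CD * T"
        using \<mu> lam by (simp add: CT_def CD_def field_simps)
      finally show ?thesis unfolding Z_def T_def .
    qed
    have l0: "0 \<le> ln (1 / \<delta>) / real n"
      using \<delta> by (intro divide_nonneg_nonneg ln_ge_zero) (auto simp: le_divide_eq)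
    have root: "sqrt (CT * (z\<^sup>2 * ?l ^ 3) + CD * (ln (1 / \<delta>) / real n))
      \<le> sqrt CT * z * ?l powr (3 / 2) + sqrt CD * sqrt (ln (1 / \<delta>) / real n)"
    proof -
      have "(?l powr (3 / 2))\<^sup>2 = ?l powr 3" by (simp add: power2_eq_square powr_add[symmetric])
      also have "\<dots> = ?l ^ 3" using powr_realpow[of ?l 3] l1 by simp
      finally have "sqrt (?l ^ 3) = ?l powr (3 / 2)" by (intro real_sqrt_unique) auto
      moreover have "sqrt (z\<^sup>2) = z" by (simp add: z_def)
      ultimately have "sqrt (CT * (z\<^sup>2 * ?l ^ 3)) = sqrt CT * z * ?l powr (3 / 2)"
        by (simp add: real_sqrt_mult)
      moreover have "sqrt (CT * (z\<^sup>2 * ?l ^ 3) + CD * (ln (1 / \<delta>) / real n))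
        \<le> sqrt (CT * (z\<^sup>2 * ?l ^ 3)) + sqrt (CD * (ln (1 / \<delta>) / real n))"
        using CT CD l0 l1 by (intro sqrt_add_le_add_sqrt mult_nonneg_nonneg) auto
      moreover have "sqrt (CD * (ln (1 / \<delta>) / real n)) = sqrt CD * sqrt (ln (1 / \<delta>) / real n)"
        by (rule real_sqrt_mult)
      ultimately show ?thesis by linarith
    qed
    let ?b = "sqrt CT * real n powr (- \<beta> / (2 * \<beta> + real d)) * ?l powr (3 / 2) + sqrt CD * sqrt (ln (1 / \<delta>) / real n)"
    have sub: "{D \<in> space (sample_distr d PX K n). (\<integral>x. (fhat D x - ?f x)\<^sup>2 \<partial>PX) \<le> V}
      \<subseteq> {D \<in> space (sample_distr d PX K n). L2_norm PX (\<lambda>x. fhat D x - ?f x) \<le> ?b}"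
    proof (intro Collect_mono impI, elim conjE, intro conjI)
      fix D assume "(\<integral>x. (fhat D x - ?f x)\<^sup>2 \<partial>PX) \<le> V"
      then have "(\<integral>x. (fhat D x - ?f x)\<^sup>2 \<partial>PX) \<le> CT * (z\<^sup>2 * ?l ^ 3) + CD * (ln (1 / \<delta>) / real n)"
        using V by linarith
      then have "L2_norm PX (\<lambda>x. fhat D x - ?f x) \<le> sqrt (CT * (z\<^sup>2 * ?l ^ 3) + CD * (ln (1 / \<delta>) / real n))"
        unfolding L2_norm_def by (rule real_sqrt_le_mono)
      then show "L2_norm PX (\<lambda>x. fhat D x - ?f x) \<le> ?b" using root unfolding z_def by linarith
    qed
    interpret S: prob_space "sample_distr d PX K n"
      unfolding sample_distr_def by (rule prob_space_PiM) (rule Q.P.prob_space_axioms)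
    \<comment> \<open>Monotonicity of the measure requires the larger event to be measurable; joint
      measurability of the estimator provides this.\<close>
    have "{D \<in> space (sample_distr d PX K n). L2_norm PX (\<lambda>x. fhat D x - ?f x) \<le> ?b} \<in> sets (sample_distr d PX K n)"
    proof -
      note Q.L2_risk_measurable[OF erm, measurable]
      show ?thesis unfolding L2_norm_def by measurable
    qed
    from S.finite_measure_mono[OF sub this] ora
    show "1 - \<delta> \<le> measure (sample_distr d PX K n)
      {D \<in> space (sample_distr d PX K n). L2_norm PX (\<lambda>x. fhat D x - ?f x) \<le> ?b}"
      by linarith
    qed
  qed
qed

end
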